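(* Let $(f_n)_{n\in\mathbb N}$ be an approximate identity for $(C_u(\mathbb R^d),* )$ such that for all $n$: $f_n\in C_c(\mathbb R^d)$, $\mathrm{supp}(f_n)\subseteq K$ for a fixed compact set $K$ independent of $n$, $f_n\ge0$, $\int f_n(x)\,dx=1$, and $f_n$ is positive definite. Let $\mu$ be a measure on $\mathbb R^d$. Then $\mu$ is Fourier transformable if and only if $\mu$ is tempered and there exists a sequence of finite measures $(\nu_n)_{n\in\mathbb N}$ such that the set $\{\nu_n:n\in\mathbb N\}$ is equi translation bounded and $\check{\nu_n}=(f_n*\mu)\,\lambda$ for all $n$.
   Context: $C_u(\mathbb R^d)$ is the space of bounded uniformly continuous functions; $(f_n)$ being an approximate identity means $f_n*g\to g$ uniformly for every $g\in C_u(\mathbb R^d)$. $\lambda$ denotes Lebesgue measure. Measures on $\mathbb R^d$ are complex Radon measures; $|\mu|$ is the total variation. Conventions: $\check f(y)=\int f(x)e^{2\pi ixy}dx$, $\widetilde f(x)=\overline{f(-x)}$; for a finite measure $\nu$, $\check\nu$ is the function $x\mapsto\int e^{2\pi ixy}\,d\nu(y)$, viewed as the measure with that density. A measure $\mu$ is Fourier transformable if there is a measure $\widehat\mu$ with $\check f\in L^2(\widehat\mu)$ and $\mu(f*\widetilde f)=\widehat\mu(|\check f|^2)$ for all $f\in C_c(\mathbb R^d)$. Tempered: defines a tempered distribution. A function $f$ is positive definite if $\sum_{i,j}c_i\overline{c_j}f(x_i-x_j)\ge0$ for all finite choices. Equi translation bounded: $\sup_n\sup_t|\nu_n|(t+W)<\infty$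 for every compact $W$. *)

theory Defs
  imports "HOL-Analysis.Analysis"
begin

text \<open>A complex Radon measure mu on R^d is represented by its polar decomposition
  mu = h |mu|: a pair (M, h) where M is a locally finite positive Borel measure
  (the total variation |mu|) and h is a Borel function with norm (h x) = 1.
  On R^d locally finite Borel measures are Radon.\<close>

type_synonym 'a cmeasure = "'a measure \<times> ('a \<Rightarrow> complex)"

definition is_cmeasure :: "('a::euclidean_space) cmeasure \<Rightarrow> bool" where
  "is_cmeasure mu \<longleftrightarrow> sets (fst mu) = sets borel
     \<and> (\<forall>K. compact K \<longrightarrow> emeasure (fst mu) K < \<infinity>)
     \<and> snd mu \<in> borel_measurable borel
     \<and> (\<forall>x. norm (snd mu x) = 1)"

definition tvar :: "'a cmeasure \<Rightarrow> 'a measure" where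
  "tvar mu = fst mu"

definition cint :: "'a cmeasure \<Rightarrow> ('a \<Rightarrow> complex) \<Rightarrow> complex" where
  "cint mu f = (\<integral>x. f x * snd mu x \<partial>fst mu)"

definition finite_cmeasure :: "('a::euclidean_space) cmeasure \<Rightarrow> bool" where
  "finite_cmeasure mu \<longleftrightarrow> emeasure (tvar mu) UNIV < \<infinity>"

definition fsupp :: "('a::real_normed_vector \<Rightarrow> 'b::zero) \<Rightarrow> 'a set" where
  "fsupp f = closure {x. f x \<noteq> 0}"

definition Cc :: "('a::euclidean_space \<Rightarrow> 'b::real_normed_vector) \<Rightarrow> bool" where
  "Cc f \<longleftrightarrow> continuous_on UNIV f \<and> compact (fsupp f)"

definition Cu :: "('a::euclidean_space \<Rightarrow> complex) \<Rightarrow> bool" where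
  "Cu g \<longleftrightarrow> bounded (range g) \<and> uniformly_continuous_on UNIV g"

definition conv :: "('a::euclidean_space \<Rightarrow> complex) \<Rightarrow> ('a \<Rightarrow> complex) \<Rightarrow> 'a \<Rightarrow> complex" where
  "conv f g x = (\<integral>y. f (x - y) * g y \<partial>lborel)"

definition conv_meas :: "('a::euclidean_space \<Rightarrow> complex) \<Rightarrow> 'a cmeasure \<Rightarrow> 'a \<Rightarrow> complex" where
  "conv_meas f mu x = cint mu (\<lambda>y. f (x - y))"

definition tilde :: "('a::euclidean_space \<Rightarrow> complex) \<Rightarrow> 'a \<Rightarrow> complex" where
  "tilde f x = cnj (f (- x))"

definition fcheck :: "('a::euclidean_space \<Rightarrow> complex) \<Rightarrow> 'a \<Rightarrow> complex" where
  "fcheck f y = (\<integral>x. f x * cis (2 * pi * (x \<bullet> y)) \<partial>lborel)"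

definition mcheck :: "('a::euclidean_space) cmeasure \<Rightarrow> 'a \<Rightarrow> complex" where
  "mcheck nu x = cint nu (\<lambda>y. cis (2 * pi * (x \<bullet> y)))"

definition same_density_measure :: "('a::euclidean_space \<Rightarrow> complex) \<Rightarrow> ('a \<Rightarrow> complex) \<Rightarrow> bool" where
  "same_density_measure g1 g2 \<longleftrightarrow>
     (\<forall>\<phi>::'a \<Rightarrow> complex. Cc \<phi> \<longrightarrow>
        (\<integral>x. \<phi> x * g1 x \<partial>lborel) = (\<integral>x. \<phi> x * g2 x \<partial>lborel))"

definition pos_def :: "('a::euclidean_space \<Rightarrow> complex) \<Rightarrow> bool" where
  "pos_def f \<longleftrightarrow> (\<forall>(n::nat) (c::nat \<Rightarrow> complex) (x::nat \<Rightarrow> 'a).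
     let s = (\<Sum>i<n. \<Sum>j<n. c i * cnj (c j) * f (x i - x j)) in Im s = 0 \<and> Re s \<ge> 0)"

definition approx_identity :: "(nat \<Rightarrow> 'a::euclidean_space \<Rightarrow> complex) \<Rightarrow> bool" where
  "approx_identity f \<longleftrightarrow> (\<forall>g. Cu g \<longrightarrow> uniform_limit UNIV (\<lambda>n. conv (f n) g) g sequentially)"

definition equi_translation_bounded :: "(nat \<Rightarrow> ('a::euclidean_space) cmeasure) \<Rightarrow> bool" where
  "equi_translation_bounded nu \<longleftrightarrow>
     (\<forall>W. compact W \<longrightarrow> (\<exists>C::real. \<forall>n t. emeasure (tvar (nu n)) ((+) t ` W) \<le> ennreal C))"

definition fourier_transformable :: "('a::euclidean_space) cmeasure \<Rightarrow> bool" where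
  "fourier_transformable mu \<longleftrightarrow> (\<exists>muhat. is_cmeasure muhat \<and>
     (\<forall>f::'a \<Rightarrow> complex. Cc f \<longrightarrow>
        integrable (tvar muhat) (\<lambda>y. (cmod (fcheck f y))\<^sup>2) \<and>
        cint mu (conv f (tilde f)) = cint muhat (\<lambda>y. complex_of_real ((cmod (fcheck f y))\<^sup>2))))"

fun dirs :: "'a list \<Rightarrow> ('a::euclidean_space \<Rightarrow> complex) \<Rightarrow> 'a \<Rightarrow> complex" where
  "dirs [] \<phi> = \<phi>"
| "dirs (v # vs) \<phi> = (\<lambda>x. vector_derivative (\<lambda>t::real. dirs vs \<phi> (x + t *\<^sub>R v)) (at 0))"

definition smooth :: "('a::euclidean_space \<Rightarrow> complex) \<Rightarrow> bool" where
  "smooth \<phi> \<longleftrightarrow> (\<forall>vs \<in> lists Basis. continuous_on UNIV (dirs vs \<phi>) \<and>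
     (\<forall>v\<in>Basis. \<forall>x. ((\<lambda>t::real. dirs vs \<phi> (x + t *\<^sub>R v)) has_vector_derivative dirs (v # vs) \<phi> x) (at 0)))"

definition test_fun :: "('a::euclidean_space \<Rightarrow> complex) \<Rightarrow> bool" where
  "test_fun \<phi> \<longleftrightarrow> smooth \<phi> \<and> compact (fsupp \<phi>)"

text \<open>mu is tempered: the distribution phi |-> mu(phi) on test functions is continuous
  for the Schwartz topology, i.e. bounded by a Schwartz seminorm
  sup_x (1+|x|)^N sum_{|beta| <= N} |D^beta phi(x)| (hence extends to a tempered distribution).\<close>
definition tempered :: "('a::euclidean_space) cmeasure \<Rightarrow> bool" where
  "tempered mu \<longleftrightarrow> (\<exists>(C::real) (N::nat). \<forall>\<phi> B. test_fun \<phi> \<longrightarrow>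
     (\<forall>x. \<forall>vs\<in>lists Basis. length vs \<le> N \<longrightarrow> (1 + norm x) ^ N * norm (dirs vs \<phi> x) \<le> B) \<longrightarrow>
     norm (cint mu \<phi>) \<le> C * B)"

end

theory Submission
  imports Defs "HOL-Probability.Probability"
begin

text \<open>If $\mu$ is transformable, then $|\widehat\mu|$ is translation bounded, so that
$\check f_n \ge 0$ is integrable against it, $f_n \in C_c$ being positive definite.  Put
$\nu_n = \check f_n \widehat\mu$; and $\mu(\varphi) = \widehat\mu(\check\varphi)$ for test
functions $\varphi$ shows that $\mu$ is tempered.

Conversely, $\check f_m \nu_n = \check f_n \nu_m$, because both sides have the Fourier transform
$f_m * f_n * \mu$.  As $\check f_n \to 1$ pointwise, the quotients $\nu_n / \check f_n$ glue to one
measure $\nu$, which is translation bounded by Fatou's lemma.  For $f \in C_c$, the square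
integrability of $\check f$ against a translation bounded measure is a Schur test with a Gaussian
kernel, and $\mu(f * \widetilde f) = \nu(|\check f|^2)$ follows from
$\mu(f * \widetilde f * f_n) = \nu_n(|\check f|^2)$ by dominated convergence.\<close>

subsection \<open>Affine substitutions and Gaussians\<close>

text \<open>Two obstacles shape the proof: \<open>fhat n\<close> may have zeros, and a function in
  C_c need not have an integrable transform. Positive definiteness makes the transform of
  \<open>f n\<close> nonnegative. Its Gaussian means at the origin are averages of
  \<open>f n\<close>, hence bounded, and this gives integrability for Lebesgue measure. For a
  translation bounded measure, choose \<open>a\<close> such that \<open>conv a F\<close> is 1 on the
  support of \<open>F = f n\<close>. Multiplying \<open>F\<close> by \<open>conv a F\<close> changes
  nothing, but on the transform side it is a convolution with a product of two functions whose
  square integrals are bounded uniformly over all translates. Division by \<open>fhat n\<close> is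
  avoided by taking densities of all \<open>nu n\<close> with respect to one dominating finite
  measure: the pointwise limit of the densities replaces the quotient. A transform is given only
  through the functions \<open>conv g (tilde g)\<close>. Polarization yields
  \<open>conv F (f n)\<close>, and the limit in \<open>n\<close> yields every \<open>F\<close> in
  C_c whose transform is integrable; both the formula for \<open>nu n\<close> and temperedness rest
  on this extension.\<close>

abbreviation wave :: "'a::euclidean_space \<Rightarrow> 'a \<Rightarrow> complex" where
  "wave x y \<equiv> cis (2 * pi * (x \<bullet> y))"

lemma continuous_on_cis_comp [continuous_intros]:
  "continuous_on S f \<Longrightarrow> continuous_on S (\<lambda>x. cis (f x))"
  unfolding cis_conv_exp by (intro continuous_intros)

lemma borel_measurable_cis [measurable (raw)]:
  assumes "f \<in> borel_measurable M" shows "(\<lambda>x. cis (f x)) \<in> borel_measurable M"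
  by (rule borel_measurable_continuous_on[OF _ assms]) (intro continuous_intros)

lemma lborel_nn_integral_affine:
  fixes f :: "'a::euclidean_space \<Rightarrow> ennreal"
  assumes [measurable]: "f \<in> borel_measurable borel" and c: "c \<noteq> 0"
  shows "(\<integral>\<^sup>+x. f x \<partial>lborel) = ennreal (\<bar>c\<bar> ^ DIM('a)) * (\<integral>\<^sup>+x. f (t + c *\<^sub>R x) \<partial>lborel)"
  by (subst lborel_affine[OF c, of t])
     (simp add: nn_integral_density nn_integral_distr nn_integral_cmult)

lemma lborel_integrable_affine:
  fixes f :: "'a::euclidean_space \<Rightarrow> 'b :: {banach, second_countable_topology}"
  assumes f: "integrable lborel f" and c: "c \<noteq> 0"
  shows "integrable lborel (\<lambda>x. f (t + c *\<^sub>R x))"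
proof -
  have [measurable]: "f \<in> borel_measurable borel" using f by auto
  have "(\<integral>\<^sup>+x. norm (f x) \<partial>lborel) < \<infinity>" using f by (simp add: integrable_iff_bounded)
  then have "(\<integral>\<^sup>+x. norm (f (t + c *\<^sub>R x)) \<partial>lborel) < \<infinity>"
    using c by (subst (asm) lborel_nn_integral_affine[where c=c and t=t])
      (auto simp: ennreal_mult_less_top)
  then show ?thesis by (simp add: integrable_iff_bounded)
qed

text \<open>Integrability is not assumed: by the inverse affine map both integrands fail to be
  integrable together, and then both integrals are 0 by convention.\<close>

lemma lborel_integral_affine:
  fixes f :: "'a::euclidean_space \<Rightarrow> 'b :: {banach, second_countable_topology}"
  assumes c: "c \<noteq> 0"
  shows "(\<integral>x. f x \<partial>lborel) = (\<bar>c\<bar> ^ DIM('a)) *\<^sub>R (\<integral>x. f (t + c *\<^sub>R x) \<partial>lborel)"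
proof cases
  assume f: "integrable lborel f"
  then have [measurable]: "f \<in> borel_measurable borel" by auto
  show ?thesis
    using c f lborel_integrable_affine[OF f c, of t]
    by (subst lborel_affine[OF c, of t]) (simp add: integral_density integral_distr)
next
  assume f: "\<not> integrable lborel f"
  have "\<not> integrable lborel (\<lambda>x. f (t + c *\<^sub>R x))"
  proof
    assume "integrable lborel (\<lambda>x. f (t + c *\<^sub>R x))"
    from lborel_integrable_affine[OF this, of "1/c" "- (1/c) *\<^sub>R t"] c f show False
      by (simp add: algebra_simps)
  qed
  with f show ?thesis by (simp add: not_integrable_integral_eq)
qed

lemma lborel_integral_translate:
  fixes f :: "'a::euclidean_space \<Rightarrow> 'b :: {banach, second_countable_topology}"
  shows "(\<integral>x. f (t + x) \<partial>lborel) = (\<integral>x. f x \<partial>lborel)"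
  using lborel_integral_affine[of 1 f t] by simp

lemma lborel_integral_reflect:
  fixes f :: "'a::euclidean_space \<Rightarrow> 'b :: {banach, second_countable_topology}"
  shows "(\<integral>x. f (t - x) \<partial>lborel) = (\<integral>x. f x \<partial>lborel)"
  using lborel_integral_affine[of "-1" f t] by simp

lemma lborel_integrable_translate:
  fixes f :: "'a::euclidean_space \<Rightarrow> 'b :: {banach, second_countable_topology}"
  shows "integrable lborel f \<Longrightarrow> integrable lborel (\<lambda>x. f (t + x))"
  using lborel_integrable_affine[of f 1 t] by simp

text \<open>\<open>lborel\<close> is the image of a product of one-dimensional Lebesgue measures
  under \<open>\<lambda>f. \<Sum>b\<in>Basis. f b *\<^sub>R b\<close>. The factors are complex so
  that characters split along with the Gaussian.\<close>

lemma
  fixes g :: "'a::euclidean_space \<Rightarrow> real \<Rightarrow> complex"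
  assumes g: "\<And>b. b \<in> Basis \<Longrightarrow> integrable lborel (g b)"
  shows lborel_integrable_prod: "integrable lborel (\<lambda>x. \<Prod>b\<in>Basis. g b (x \<bullet> b))"
    and lborel_integral_prod: "(\<integral>x. (\<Prod>b\<in>Basis. g b (x \<bullet> b)) \<partial>lborel) = (\<Prod>b\<in>Basis. \<integral>x. g b x \<partial>lborel)"
proof -
  interpret product_sigma_finite "\<lambda>_::'a. lborel :: real measure" ..
  have [measurable]: "\<And>b. b \<in> Basis \<Longrightarrow> g b \<in> borel_measurable borel"
    using g by auto
  have eq: "(\<Prod>b\<in>Basis. g b ((\<Sum>c\<in>Basis. f c *\<^sub>R c) \<bullet> b)) = (\<Prod>b\<in>Basis. g b (f b))" for f
    by (intro prod.cong refl) simp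
  have [measurable]: "(\<lambda>x::'a. \<Prod>b\<in>Basis. g b (x \<bullet> b)) \<in> borel_measurable borel"
    by measurable
  have [measurable]: "(\<lambda>f. \<Sum>b\<in>Basis. f b *\<^sub>R b) \<in> measurable (\<Pi>\<^sub>M b\<in>Basis. lborel) (borel :: 'a measure)"
    by measurable
  have "integrable (\<Pi>\<^sub>M b\<in>Basis. lborel) (\<lambda>f. \<Prod>b\<in>Basis. g b (f b))"
    by (rule product_integrable_prod) (use g in auto)
  then show "integrable lborel (\<lambda>x. \<Prod>b\<in>Basis. g b (x \<bullet> b))"
    by (subst lborel_eq, subst integrable_distr_eq) (simp_all add: eq)
  have "(\<integral>f. (\<Prod>b\<in>Basis. g b (f b)) \<partial>(\<Pi>\<^sub>M b\<in>Basis. lborel)) = (\<Prod>b\<in>Basis. \<integral>x. g b x \<partial>lborel)"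
    by (rule product_integral_prod) (use g in auto)
  then show "(\<integral>x. (\<Prod>b\<in>Basis. g b (x \<bullet> b)) \<partial>lborel) = (\<Prod>b\<in>Basis. \<integral>x. g b x \<partial>lborel)"
    by (subst lborel_eq, subst integral_distr) (simp_all add: eq)
qed

text \<open>The standard normal density in d dimensions. Unit variance is kept, rather than a
  normalisation adapted to \<open>wave\<close>, because its transform is then a product of known
  characteristic functions.\<close>

definition gauss :: "'a::euclidean_space \<Rightarrow> real" where
  "gauss x = exp (- (norm x)\<^sup>2 / 2) / sqrt (2 * pi) ^ DIM('a)"

lemma gauss_prod: "gauss (x::'a::euclidean_space) = (\<Prod>b\<in>Basis. std_normal_density (x \<bullet> b))"
proof -
  have "(norm x)\<^sup>2 = (\<Sum>b\<in>Basis. (x \<bullet> b)\<^sup>2)"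
    unfolding power2_norm_eq_inner by (subst euclidean_inner) (simp add: power2_eq_square)
  then have "- (norm x)\<^sup>2 / 2 = (\<Sum>b\<in>Basis. - (x \<bullet> b)\<^sup>2 / 2)"
    by (simp add: sum_negf sum_divide_distrib)
  then have "exp (- (norm x)\<^sup>2 / 2) = (\<Prod>b\<in>Basis. exp (- (x \<bullet> b)\<^sup>2 / 2))"
    by (simp only: exp_sum finite_Basis)
  then show ?thesis
    unfolding gauss_def std_normal_density_def by (simp add: prod_dividef)
qed

lemma gauss_pos: "gauss x > 0" by (simp add: gauss_def)
lemma gauss_minus: "gauss (- x) = gauss x" by (simp add: gauss_def)
lemma continuous_on_gauss [continuous_intros]:
  "continuous_on S f \<Longrightarrow> continuous_on S (\<lambda>x. gauss (f x))"
  unfolding gauss_def by (intro continuous_intros) auto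
lemma gauss_measurable [measurable]: "gauss \<in> borel_measurable borel"
  by (rule borel_measurable_continuous_onI) (intro continuous_intros)

lemma fourier_std_normal:
  "(\<integral>x. of_real (std_normal_density x) * cis (t * x) \<partial>lborel) = of_real (exp (- t\<^sup>2 / 2))"
proof -
  have "of_real (exp (- t\<^sup>2 / 2)) = char std_normal_distribution t"
    by (simp add: char_std_normal_distribution)
  also have "\<dots> = (\<integral>x. std_normal_density x *\<^sub>R cis (t * x) \<partial>lborel)"
    unfolding char_def
    by (subst integral_density) (auto simp: normal_density_nonneg cis_conv_exp mult_ac)
  finally show ?thesis by (simp add: scaleR_conv_of_real)
qed

lemma cis_sum: "finite A \<Longrightarrow> cis (\<Sum>a\<in>A. f a) = (\<Prod>a\<in>A. cis (f a))"
  by (induction rule: finite_induct) (auto simp: cis_mult[symmetric])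

lemma integrable_std_normal_cis:
  "integrable lborel (\<lambda>x. of_real (std_normal_density x) * cis (t * x))"
  by (rule Bochner_Integration.integrable_bound[of _ std_normal_density])
     (auto simp: norm_mult)

lemma gauss_cis_prod:
  fixes x y :: "'a::euclidean_space"
  shows "of_real (gauss x) * cis (x \<bullet> y) =
   (\<Prod>b\<in>Basis. of_real (std_normal_density (x \<bullet> b)) * cis ((y \<bullet> b) * (x \<bullet> b)))"
proof -
  have "x \<bullet> y = (\<Sum>b\<in>Basis. (y \<bullet> b) * (x \<bullet> b))"
    by (subst euclidean_inner) (simp add: mult.commute)
  then show ?thesis
    by (simp add: gauss_prod cis_sum prod.distrib)
qed

lemma fourier_gauss:
  fixes y :: "'a::euclidean_space"
  shows "(\<integral>x. of_real (gauss x) * cis (x \<bullet> y) \<partial>lborel) = of_real (exp (- (norm y)\<^sup>2 / 2))"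
proof -
  have "(norm y)\<^sup>2 = (\<Sum>b\<in>Basis. (y \<bullet> b)\<^sup>2)"
    unfolding power2_norm_eq_inner by (subst euclidean_inner) (simp add: power2_eq_square)
  then have "- (norm y)\<^sup>2 / 2 = (\<Sum>b\<in>Basis. - (y \<bullet> b)\<^sup>2 / 2)"
    by (simp add: sum_negf sum_divide_distrib)
  then have *: "(\<Prod>b\<in>Basis. exp (- (y \<bullet> b)\<^sup>2 / 2)) = exp (- (norm y)\<^sup>2 / 2)"
    by (simp only: exp_sum finite_Basis)
  have "(\<integral>x. of_real (gauss x) * cis (x \<bullet> y) \<partial>lborel)
    = (\<Prod>b\<in>Basis. \<integral>x. of_real (std_normal_density x) * cis ((y \<bullet> b) * x) \<partial>lborel)"
    unfolding gauss_cis_prod by (intro lborel_integral_prod integrable_std_normal_cis)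
  also have "\<dots> = of_real (exp (- (norm y)\<^sup>2 / 2))"
    unfolding fourier_std_normal of_real_prod[symmetric] * ..
  finally show ?thesis .
qed

lemma integrable_gauss_cis:
  fixes y :: "'a::euclidean_space"
  shows "integrable lborel (\<lambda>x. of_real (gauss x) * cis (x \<bullet> y))"
  unfolding gauss_cis_prod by (intro lborel_integrable_prod integrable_std_normal_cis)

lemma integrable_gauss: "integrable lborel (gauss :: 'a::euclidean_space \<Rightarrow> real)"
  using integrable_norm[OF integrable_gauss_cis[of "0::'a"]]
  by (simp add: norm_mult abs_of_pos[OF gauss_pos])

lemma integral_gauss: "(\<integral>x. gauss (x::'a::euclidean_space) \<partial>lborel) = 1"
proof -
  have "of_real (\<integral>x. gauss (x::'a) \<partial>lborel) = (1::complex)"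
    using fourier_gauss[of "0::'a"] by (simp flip: integral_complex_of_real)
  then show ?thesis by (simp only: of_real_eq_1_iff)
qed

text \<open>Passes to the convention of \<open>wave\<close>: (2 pi s |y|)^2 / 2 = 2 pi^2 s^2 |y|^2,
  which for \<open>s = 1\<close> is the exponent in \<open>gker\<close>.\<close>

lemma fourier_gauss_scaled:
  fixes y :: "'a::euclidean_space"
  shows "(\<integral>x. of_real (gauss x) * wave x (s *\<^sub>R y) \<partial>lborel)
     = of_real (exp (- 2 * pi\<^sup>2 * s\<^sup>2 * (norm y)\<^sup>2))"
proof -
  have "(norm ((2 * pi * s) *\<^sub>R y))\<^sup>2 = 4 * pi\<^sup>2 * s\<^sup>2 * (norm y)\<^sup>2"
    by (simp add: power2_eq_square)
  moreover have "wave x (s *\<^sub>R y) = cis (x \<bullet> ((2 * pi * s) *\<^sub>R y))" for x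
    by (simp add: mult.assoc)
  ultimately show ?thesis
    using fourier_gauss[of "(2 * pi * s) *\<^sub>R y"] by simp
qed

subsection \<open>Compactly supported functions and Fourier transforms\<close>

text \<open>\<open>is_cmeasure\<close> without the phase, so that \<open>lborel\<close>, total
  variations and the glued measure are treated alike.\<close>

definition locally_finite :: "'a::euclidean_space measure \<Rightarrow> bool" where
  "locally_finite M \<longleftrightarrow> sets M = sets borel \<and> (\<forall>K. compact K \<longrightarrow> emeasure M K < \<infinity>)"

lemma locally_finite_sets: "locally_finite M \<Longrightarrow> sets M = sets borel"
  by (simp add: locally_finite_def)

lemma locally_finite_lborel: "locally_finite lborel"
  using emeasure_bounded_finite[OF compact_imp_bounded] by (auto simp: locally_finite_def)

lemma locally_finite_compact: "locally_finite M \<Longrightarrow> compact K \<Longrightarrow> emeasure M K < \<infinity>"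
  by (simp add: locally_finite_def)

lemma locally_finite_sigma_finite:
  assumes "locally_finite M" shows "sigma_finite_measure M"
proof
  have "(\<Union>n. cball (0::'a) (real n)) = UNIV"
    by (auto simp: real_arch_simple)
  then show "\<exists>A. countable A \<and> A \<subseteq> sets M \<and> \<Union>A = space M \<and> (\<forall>a\<in>A. emeasure M a \<noteq> \<infinity>)"
    using assms sets_eq_imp_space_eq[of M borel]
    by (intro exI[of _ "range (\<lambda>n::nat. cball 0 (real n))"])
       (auto simp: locally_finite_def less_top)
qed

lemma CcI:
  assumes "continuous_on UNIV f" "compact K" "\<And>x. x \<notin> K \<Longrightarrow> f x = 0"
  shows "Cc f"
proof -
  have "fsupp f \<subseteq> K" unfolding fsupp_def
    using assms by (intro closure_minimal) (auto intro: compact_imp_closed)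
  then show ?thesis
    using assms compact_Int_closed[of K "fsupp f"]
    by (auto simp: Cc_def fsupp_def Int_absorb1 Int_absorb2)
qed

lemma not_in_fsupp: "x \<notin> fsupp f \<Longrightarrow> f x = 0"
  unfolding fsupp_def using closure_subset[of "{x. f x \<noteq> 0}"] by auto

lemma Cc_cont: "Cc f \<Longrightarrow> continuous_on UNIV f" by (simp add: Cc_def)
lemma Cc_compact: "Cc f \<Longrightarrow> compact (fsupp f)" by (simp add: Cc_def)

lemma Cc_cont_comp: "Cc f \<Longrightarrow> continuous_on S g \<Longrightarrow> continuous_on S (\<lambda>x. f (g x))"
  using continuous_on_compose2[OF Cc_cont, of f S g] by auto

lemma Cc_measurable: "Cc f \<Longrightarrow> f \<in> borel_measurable borel"
  by (intro borel_measurable_continuous_onI Cc_cont)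

lemma Cc_bounded:
  assumes "Cc f" obtains B where "B > 0" "\<And>x. norm (f x) \<le> B"
proof -
  have "compact (f ` fsupp f)"
    using assms continuous_on_subset by (intro compact_continuous_image) (auto simp: Cc_def)
  then obtain B where B: "\<And>x. x \<in> fsupp f \<Longrightarrow> norm (f x) \<le> B"
    by (meson compact_imp_bounded bounded_iff image_eqI)
  have "norm (f x) \<le> max B 1" for x
    using B[of x] not_in_fsupp[of x f] by (cases "x \<in> fsupp f") auto
  then show ?thesis using that[of "max B 1"] by auto
qed

lemma Cc_integrable:
  fixes f :: "'a::euclidean_space \<Rightarrow> 'b::{banach, second_countable_topology}"
  assumes "Cc f" "locally_finite M" shows "integrable M f"
proof -
  obtain B where B: "\<And>x. norm (f x) \<le> B" using Cc_bounded[OF assms(1)] by metis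
  have [measurable_cong]: "sets M = sets borel" using assms by (simp add: locally_finite_def)
  have [measurable]: "f \<in> borel_measurable borel" "fsupp f \<in> sets borel"
    using assms by (auto intro: Cc_measurable Cc_compact borel_compact)
  have "integrable M (\<lambda>x. B * indicator (fsupp f) x)"
    using assms Cc_compact[OF assms(1)] by (auto simp: locally_finite_def)
  then show ?thesis
    by (rule Bochner_Integration.integrable_bound)
      (use B in \<open>auto simp: not_in_fsupp indicator_def intro: order_trans[OF _ abs_ge_self]\<close>)
qed

text \<open>Enlarge a ball around the support by 1: two points closer than 1 either both lie in the
  larger ball, which is compact, or both lie outside the support.\<close>

lemma Cc_uniformly_continuous:
  fixes f :: "'a::euclidean_space \<Rightarrow> 'b::real_normed_vector"
  assumes "Cc f" shows "uniformly_continuous_on UNIV f"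
proof -
  obtain r where r: "fsupp f \<subseteq> cball 0 r"
    using compact_imp_bounded[OF Cc_compact[OF assms]] unfolding bounded_iff
    by (metis mem_cball_0 subsetI)
  have "uniformly_continuous_on (cball 0 (r + 1)) f"
    by (rule compact_uniformly_continuous[OF continuous_on_subset[OF Cc_cont[OF assms]]]) auto
  note uc = this[unfolded uniformly_continuous_on_def, rule_format]
  show ?thesis unfolding uniformly_continuous_on_def
  proof (intro allI impI)
    fix e :: real assume "0 < e"
    from uc[OF this] obtain d where d: "d > 0"
      "\<And>x x'. x \<in> cball 0 (r+1) \<Longrightarrow> x' \<in> cball 0 (r+1) \<Longrightarrow> dist x' x < d \<Longrightarrow> dist (f x') (f x) < e"
      by blast
    have "dist (f x') (f x) < e" if "dist x' x < min d 1" for x x'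
    proof (cases "x \<in> cball 0 r \<or> x' \<in> cball 0 r")
      case True
      have "dist 0 x \<le> dist 0 x' + dist x' x" "dist 0 x' \<le> dist 0 x + dist x' x"
        by (metis dist_triangle, metis dist_triangle dist_commute)
      with True have "x \<in> cball 0 (r+1)" "x' \<in> cball 0 (r+1)" using that by (auto simp del: dist_0_norm)
      then show ?thesis using that d by auto
    next
      case False
      then have "f x = 0" "f x' = 0" using r not_in_fsupp by blast+
      then show ?thesis using \<open>0 < e\<close> by simp
    qed
    then show "\<exists>d>0. \<forall>x\<in>UNIV. \<forall>x'\<in>UNIV. dist x' x < d \<longrightarrow> dist (f x') (f x) < e"
      using d(1) by (intro exI[of _ "min d 1"]) auto
  qed
qed

lemma Cc_Cu: "Cc f \<Longrightarrow> Cu f"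
  using Cc_bounded[of f] Cc_uniformly_continuous[of f] unfolding Cu_def bounded_iff by (metis rangeE)

lemma Cc_mult_cont:
  fixes f :: "'a::euclidean_space \<Rightarrow> complex"
  assumes "Cc f" "continuous_on UNIV g" shows "Cc (\<lambda>x. f x * g x)"
  by (rule CcI[of _ "fsupp f"]) (use assms in \<open>auto intro!: continuous_intros simp: Cc_cont Cc_compact not_in_fsupp\<close>)

lemma Cc_add:
  fixes f g :: "'a::euclidean_space \<Rightarrow> complex"
  assumes "Cc f" "Cc g" shows "Cc (\<lambda>x. f x + g x)"
  by (rule CcI[of _ "fsupp f \<union> fsupp g"])
     (use assms in \<open>auto intro!: continuous_intros simp: Cc_cont Cc_compact not_in_fsupp\<close>)

lemma Cc_affine:
  fixes f :: "'a::euclidean_space \<Rightarrow> complex"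
  assumes "Cc f" "c \<noteq> 0" shows "Cc (\<lambda>x. f (t + c *\<^sub>R x))"
proof (rule CcI[of _ "(\<lambda>x. (1/c) *\<^sub>R (x - t)) ` fsupp f"])
  show "compact ((\<lambda>x. (1/c) *\<^sub>R (x - t)) ` fsupp f)"
    using assms by (intro compact_continuous_image continuous_intros Cc_compact)
  fix x assume x: "x \<notin> (\<lambda>x. (1/c) *\<^sub>R (x - t)) ` fsupp f"
  have "x = (1/c) *\<^sub>R ((t + c *\<^sub>R x) - t)" using assms by simp
  with x have "t + c *\<^sub>R x \<notin> fsupp f" by blast
  then show "f (t + c *\<^sub>R x) = 0" by (rule not_in_fsupp)
qed (intro Cc_cont_comp[OF assms(1)] continuous_intros)

lemma Cc_tilde: assumes "Cc f" shows "Cc (tilde f)"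
proof -
  have "Cc (\<lambda>x. f (0 + (-1) *\<^sub>R x))" by (rule Cc_affine) (use assms in auto)
  then have *: "Cc (\<lambda>x. f (- x))" by simp
  show ?thesis unfolding tilde_def
    by (rule CcI[of _ "fsupp (\<lambda>x. f (- x))"])
      (use * in \<open>auto intro!: continuous_intros simp: Cc_compact Cc_cont dest: not_in_fsupp\<close>)
qed

lemma tilde_tilde [simp]: "tilde (tilde f) = f" by (simp add: tilde_def fun_eq_iff)

section \<open>Parameter integrals and exchange of integrals\<close>

lemma continuous_integral:
  fixes k :: "'a::euclidean_space \<Rightarrow> 'b \<Rightarrow> 'c::{banach, second_countable_topology}"
  assumes "\<And>x. k x \<in> borel_measurable M" "\<And>y. continuous_on UNIV (\<lambda>x. k x y)"
    "integrable M w" "\<And>x y. norm (k x y) \<le> w y"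
  shows "continuous_on UNIV (\<lambda>x. \<integral>y. k x y \<partial>M)"
proof (subst continuous_on_sequentially, safe)
  fix x :: "nat \<Rightarrow> 'a" and a assume x: "x \<longlonglongrightarrow> a"
  have "(\<lambda>n. k (x n) y) \<longlonglongrightarrow> k a y" for y
    using assms(2)[of y] x by (rule continuous_on_tendsto_compose) auto
  then show "((\<lambda>x. \<integral>y. k x y \<partial>M) \<circ> x) \<longlonglongrightarrow> (\<integral>y. k a y \<partial>M)"
    unfolding o_def using assms by (intro integral_dominated_convergence[where w=w]) auto
qed

text \<open>The product \<open>f x * g y\<close> is integrable on the product space and, up to the
  factor \<open>B\<close>, dominates the integrand, so applications need no joint integrability. The
  kernel will be a character, a translate of a bounded function or a Gaussian.\<close>

lemma Fubini_kernel:
  fixes f g :: "_ \<Rightarrow> complex"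
  assumes "sigma_finite_measure M" "sigma_finite_measure N"
    and f: "integrable M f" and g: "integrable N g"
    and k[measurable]: "case_prod k \<in> borel_measurable (M \<Otimes>\<^sub>M N)" and B: "\<And>x y. norm (k x y) \<le> B"
  shows "(\<integral>x. f x * (\<integral>y. g y * k x y \<partial>N) \<partial>M) = (\<integral>y. g y * (\<integral>x. f x * k x y \<partial>M) \<partial>N)"
proof -
  interpret M: sigma_finite_measure M by fact
  interpret N: sigma_finite_measure N by fact
  interpret pair_sigma_finite M N ..
  have [measurable]: "f \<in> borel_measurable M" "g \<in> borel_measurable N" using f g by auto
  have 1: "integrable (M \<Otimes>\<^sub>M N) (\<lambda>(x,y). f x * g y)"
    using f g by (intro Fubini_integrable) (auto simp: norm_mult intro!: integrable_mult_left integrable_mult_right)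
  have "norm (f x * g y * k x y) \<le> norm (of_real B * (f x * g y))" for x y
    using B[of x y] mult_left_mono[OF B[of x y], of "norm (f x * g y)"] norm_ge_zero[of "k x y"]
    by (simp add: norm_mult mult_ac abs_of_nonneg[of B] order_trans[OF norm_ge_zero B])
  then have "integrable (M \<Otimes>\<^sub>M N) (\<lambda>(x,y). f x * g y * k x y)"
    by (intro Bochner_Integration.integrable_bound[OF integrable_mult_right[OF 1, of "of_real B"]]) auto
  from Fubini_integral[OF this] show ?thesis
    by (simp add: mult_ac flip: integral_mult_right_zero)
qed

lemma Fubini_wave:
  fixes M N :: "'a::euclidean_space measure"
  assumes "sigma_finite_measure M" "sigma_finite_measure N" "sets M = sets borel" "sets N = sets borel"
    and f: "integrable M f" and g: "integrable N g"
  shows "(\<integral>x. f x * (\<integral>y. g y * wave x y \<partial>N) \<partial>M) = (\<integral>y. g y * (\<integral>x. f x * wave x y \<partial>M) \<partial>N)"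
proof (rule Fubini_kernel[where B=1])
  note [measurable_cong] = assms(3,4)
  show "case_prod (\<lambda>x y. wave x y) \<in> borel_measurable (M \<Otimes>\<^sub>M N)"
    by measurable
qed (use assms in auto)

lemma integrable_mult_bounded:
  fixes f g :: "_ \<Rightarrow> complex"
  assumes f: "integrable M f" and g: "g \<in> borel_measurable M" "\<And>x. norm (g x) \<le> B"
  shows "integrable M (\<lambda>x. f x * g x)"
proof -
  have "norm (f x * g x) \<le> norm (of_real B * f x)" for x
    using mult_left_mono[OF g(2)[of x], of "norm (f x)"] order_trans[OF norm_ge_zero g(2)[of x]]
    by (simp add: norm_mult mult_ac)
  then show ?thesis
    using f g by (intro Bochner_Integration.integrable_bound[OF integrable_mult_right[OF f, of "of_real B"]]) auto
qed

section \<open>Rules for the transform of functions\<close>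

lemma wave_measurable [measurable]: "(\<lambda>x. wave x y) \<in> borel_measurable borel" "(\<lambda>y. wave x y) \<in> borel_measurable borel"
  by measurable

lemma fcheck_norm_le: "norm (fcheck f y) \<le> (\<integral>x. norm (f x) \<partial>lborel)"
  unfolding fcheck_def by (rule order_trans[OF integral_norm_bound]) (simp add: norm_mult)

lemma continuous_fcheck:
  assumes f: "integrable lborel f" shows "continuous_on UNIV (fcheck f)"
proof -
  have [measurable]: "f \<in> borel_measurable borel" using f by auto
  show ?thesis unfolding fcheck_def[abs_def]
    using f by (intro continuous_integral[where w="\<lambda>x. norm (f x)"]) (auto simp: norm_mult intro!: continuous_intros)
qed

lemma Cc_lborel: "Cc f \<Longrightarrow> integrable lborel (f :: 'a::euclidean_space \<Rightarrow> complex)"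
  by (intro Cc_integrable locally_finite_lborel)

lemma fcheck_measurable: "integrable lborel f \<Longrightarrow> fcheck f \<in> borel_measurable borel"
  by (intro borel_measurable_continuous_onI continuous_fcheck)

lemma wave_minus: "wave (- x) y = cnj (wave x y)" "wave x (- y) = cnj (wave x y)"
  by (simp_all add: cis_cnj)

lemma wave_add: "wave (x + z) y = wave x y * wave z y" "wave x (y + z) = wave x y * wave x z"
  by (simp_all add: cis_mult inner_add_left inner_add_right algebra_simps)

lemma wave_diff: "wave (x - z) y = wave x y * cnj (wave z y)" "wave x (y - z) = wave x y * cnj (wave x z)"
  by (simp_all add: cis_mult cis_cnj inner_diff_left inner_diff_right algebra_simps)

lemma fcheck_modulate: "fcheck (\<lambda>x. f x * wave x z) y = fcheck f (y + z)"
  unfolding fcheck_def wave_add by (simp add: mult_ac)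

lemma fcheck_translate: "fcheck (\<lambda>x. f (x - t)) y = wave t y * fcheck f y"
proof -
  have "fcheck (\<lambda>x. f (x - t)) y = (\<integral>x. f ((t + x) - t) * wave (t + x) y \<partial>lborel)"
    unfolding fcheck_def by (rule lborel_integral_translate[symmetric])
  also have "\<dots> = (\<integral>x. wave t y * (f x * wave x y) \<partial>lborel)"
    unfolding wave_add by (simp add: mult_ac)
  finally show ?thesis by (simp add: fcheck_def)
qed

lemma fcheck_tilde: "fcheck (tilde f) y = cnj (fcheck f y)"
proof -
  have "fcheck (tilde f) y = (\<integral>x. tilde f (0 - x) * wave (0 - x) y \<partial>lborel)"
    unfolding fcheck_def by (rule lborel_integral_reflect[symmetric])
  also have "\<dots> = (\<integral>x. cnj (f x * wave x y) \<partial>lborel)"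
    using wave_minus(1)[of _ y] by (simp add: tilde_def)
  also have "\<dots> = cnj (\<integral>x. f x * wave x y \<partial>lborel)"
    by (rule Bochner_Integration.integral_cnj)
  finally show ?thesis by (simp add: fcheck_def)
qed

section \<open>Convolution in C_c\<close>

lemma conv_eq_0:
  assumes x: "x \<notin> {x + y | x y. x \<in> fsupp f \<and> y \<in> fsupp g}"
  shows "conv f g x = 0"
proof -
  have "f (x - y) * g y = 0" for y
  proof (rule ccontr)
    assume "f (x - y) * g y \<noteq> 0"
    then have "x - y \<in> fsupp f" "y \<in> fsupp g"
      using not_in_fsupp[of "x - y" f] not_in_fsupp[of y g] by auto
    with x show False by (metis (mono_tags, lifting) diff_add_cancel mem_Collect_eq)
  qed
  then have "(\<lambda>y. f (x - y) * g y) = (\<lambda>_. 0)" by auto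
  then show ?thesis by (simp add: conv_def)
qed

lemma conv_commute: "conv f g = conv g f"
proof
  fix x show "conv f g x = conv g f x"
    unfolding conv_def by (subst lborel_integral_reflect[symmetric, of _ x]) (simp add: mult.commute)
qed

lemma Cc_conv:
  fixes f g :: "'a::euclidean_space \<Rightarrow> complex"
  assumes f: "Cc f" and g: "Cc g" shows "Cc (conv f g)"
proof (rule CcI)
  have [measurable]: "f \<in> borel_measurable borel" "g \<in> borel_measurable borel"
    using f g by (auto intro: Cc_measurable)
  obtain B where B: "\<And>x. norm (f x) \<le> B" using Cc_bounded[OF f] by metis
  show "continuous_on UNIV (conv f g)"
    unfolding conv_def[abs_def]
    using g B by (intro continuous_integral[where w="\<lambda>y. B * norm (g y)"])
      (auto simp: norm_mult intro!: continuous_intros Cc_cont_comp[OF f] mult_right_mono integrable_mult_right integrable_norm Cc_lborel)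
  show "compact {x + y | x y. x \<in> fsupp f \<and> y \<in> fsupp g}"
    using f g by (intro compact_sums Cc_compact)
qed (rule conv_eq_0)

lemma fcheck_conv:
  assumes f: "integrable lborel f" and g: "Cc g" "Cc f"
  shows "fcheck (conv f g) z = fcheck f z * fcheck g z"
proof -
  have [measurable]: "f \<in> borel_measurable borel" "g \<in> borel_measurable borel"
    using f g by (auto intro: Cc_measurable)
  obtain B where B: "\<And>x. norm (f x) \<le> B" using Cc_bounded[OF g(2)] by metis
  let ?S = "{x + y | x y. x \<in> fsupp f \<and> y \<in> fsupp g}"
  have S: "compact ?S" using g by (intro compact_sums Cc_compact)
  then have [measurable]: "?S \<in> sets borel" by (rule borel_compact)
  have i: "integrable lborel (indicator ?S :: 'a \<Rightarrow> real)" using emeasure_bounded_finite[OF compact_imp_bounded[OF S]] by simp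
  \<comment> \<open>\<open>wave x z\<close> alone is not integrable in \<open>x\<close>, as
    \<open>Fubini_kernel\<close> would need. The indicator of the compact set \<open>?S\<close>
    repairs this without changing anything, since \<open>conv f g x\<close> and every product
    \<open>f (x - y) * g y\<close> vanish for \<open>x\<close> outside \<open>?S\<close>.\<close>
  define I :: "'a \<Rightarrow> complex" where "I x = of_real (indicator ?S x)" for x
  have I: "x \<in> ?S \<Longrightarrow> I x = 1" "x \<notin> ?S \<Longrightarrow> I x = 0" for x by (simp_all only: I_def indicator_simps of_real_1 of_real_0 simp_thms)
  have "integrable lborel I" unfolding I_def[abs_def] using i by (rule integrable_of_real)
  then have ic: "integrable lborel (\<lambda>x. I x * wave x z)"
    by (rule integrable_mult_bounded[where B=1]) auto
  have "fcheck (conv f g) z = (\<integral>x. (I x * wave x z) * (\<integral>y. g y * f (x - y) \<partial>lborel) \<partial>lborel)"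
    unfolding fcheck_def
  proof (intro Bochner_Integration.integral_cong refl)
    fix x
    show "conv f g x * wave x z = (I x * wave x z) * (\<integral>y. g y * f (x - y) \<partial>lborel)"
    proof (cases "x \<in> ?S")
      case True
      show ?thesis unfolding I(1)[OF True] by (simp add: conv_def mult_ac)
    next
      case False
      show ?thesis unfolding I(2)[OF False] conv_eq_0[OF False] by simp
    qed
  qed
  also have "\<dots> = (\<integral>y. g y * (\<integral>x. (I x * wave x z) * f (x - y) \<partial>lborel) \<partial>lborel)"
    by (rule Fubini_kernel[OF _ _ ic Cc_lborel[OF g(1)], where B=B]) (use B in \<open>auto intro: sigma_finite_lborel\<close>)
  also have "\<dots> = (\<integral>y. g y * (\<integral>x. wave x z * f (x - y) \<partial>lborel) \<partial>lborel)"
  proof (intro Bochner_Integration.integral_cong refl)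
    fix y
    have "I x * f (x - y) = f (x - y)" if "g y \<noteq> 0" for x
    proof (cases "f (x - y) = 0")
      case False
      with that have "x - y \<in> fsupp f" "y \<in> fsupp g"
      using not_in_fsupp[of "x - y" f] not_in_fsupp[of y g] by auto
      then have "x \<in> ?S" by (metis (mono_tags, lifting) diff_add_cancel mem_Collect_eq)
      then show ?thesis using I(1) by simp
    qed simp
    then have *: "(I x * wave x z) * f (x - y) = wave x z * f (x - y)" if "g y \<noteq> 0" for x
      using that by (metis (no_types, lifting) mult.assoc mult.commute)
    show "g y * (\<integral>x. (I x * wave x z) * f (x - y) \<partial>lborel) = g y * (\<integral>x. wave x z * f (x - y) \<partial>lborel)"
    proof (cases "g y = 0")
      case False show ?thesis by (simp only: *[OF False])
    qed simp
  qed
  also have "\<dots> = (\<integral>y. g y * fcheck (\<lambda>x. f (x - y)) z \<partial>lborel)"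
    by (simp add: fcheck_def mult_ac)
  also have "\<dots> = (\<integral>y. fcheck f z * (g y * wave y z) \<partial>lborel)"
    by (simp add: fcheck_translate mult_ac)
  finally show ?thesis by (simp add: fcheck_def)
qed

subsection \<open>Translation bounded measures\<close>

lemma borel_measurable_cnj [measurable (raw)]:
  assumes "f \<in> borel_measurable M" shows "(\<lambda>x. cnj (f x)) \<in> borel_measurable M"
  by (rule borel_measurable_continuous_on[OF _ assms]) (intro continuous_intros)

text \<open>A finite cover of \<open>W\<close> by balls of radius \<open>r\<close> moves along with
  \<open>W\<close>, so the number of balls times \<open>C\<close> bounds all translates at once.
  This also passes from one radius to another.\<close>

lemma emeasure_translates_bounded:
  fixes N :: "'a::euclidean_space measure"
  assumes Ns: "sets N = sets borel" and r: "0 < r" and bd: "\<And>t. emeasure N (cball t r) \<le> ennreal C"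
    and W: "compact W"
  obtains C' where "\<And>t. emeasure N ((+) t ` W) \<le> ennreal C'"
proof -
  obtain D where D: "finite D" "W \<subseteq> (\<Union>d\<in>D. ball d r)"
  proof (rule compactE_image[OF W, of W "\<lambda>x. ball x r"])
    show "W \<subseteq> (\<Union>x\<in>W. ball x r)" using r by auto
  qed auto
  have sets: "cball u r \<in> sets N" for u using Ns by simp
  have "emeasure N ((+) t ` W) \<le> of_nat (card D) * ennreal C" for t
  proof -
    have "(+) t ` W \<subseteq> (\<Union>d\<in>D. cball (t + d) r)"
    proof
      fix x assume "x \<in> (+) t ` W"
      then obtain v where v: "v \<in> W" "x = t + v" by auto
      then obtain d where d: "d \<in> D" "dist d v < r" using D(2) by auto
      then have "x \<in> cball (t + d) r" using v by (simp add: dist_norm)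
      with d show "x \<in> (\<Union>d\<in>D. cball (t + d) r)" by blast
    qed
    then have "emeasure N ((+) t ` W) \<le> emeasure N (\<Union>d\<in>D. cball (t + d) r)"
      by (rule emeasure_mono) (intro sets.finite_UN D(1) sets)
    also have "\<dots> \<le> (\<Sum>d\<in>D. emeasure N (cball (t + d) r))"
      by (rule emeasure_subadditive_finite[OF D(1)]) (use sets in blast)
    also have "\<dots> \<le> (\<Sum>d\<in>D. ennreal C)"
      by (intro sum_mono bd)
    finally show ?thesis by simp
  qed
  also have "of_nat (card D) * ennreal C = ennreal (real (card D) * C)"
    by (simp add: ennreal_mult' ennreal_of_nat_eq_real_of_nat)
  finally show ?thesis by (rule that)
qed

text \<open>Unit balls represent all compact sets by the preceding lemma. The constant belongs to
  the predicate because gluing preserves it.\<close>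

definition translation_bounded :: "'a::euclidean_space measure \<Rightarrow> real \<Rightarrow> bool" where
  "translation_bounded N C \<longleftrightarrow> sets N = sets borel \<and> 0 < C \<and> (\<forall>t. emeasure N (cball t 1) \<le> ennreal C)"

lemma translation_bounded_locally_finite:
  assumes "translation_bounded N C" shows "locally_finite N"
proof -
  have "emeasure N K < \<infinity>" if K: "compact K" for K
  proof -
    obtain C' where C': "\<And>t. emeasure N ((+) t ` K) \<le> ennreal C'"
      using emeasure_translates_bounded[of N 1 C K] assms K by (auto simp: translation_bounded_def)
    have "emeasure N K \<le> ennreal C'" using C'[of 0] by simp
    also have "\<dots> < \<infinity>" by simp
    finally show ?thesis .
  qed
  then show ?thesis using assms by (simp add: locally_finite_def translation_bounded_def)
qed

lemma measure_unit_ball: "0 < measure lborel (cball (0::'a::euclidean_space) 1)"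
  "emeasure lborel (cball (y::'a::euclidean_space) 1) = ennreal (measure lborel (cball (0::'a) 1))"
proof -
  show "0 < measure lborel (cball (0::'a) 1)" by (simp add: content_cball_pos)
  have "measure lborel (cball y 1) = measure lborel (cball (0::'a) 1)"
    by (simp add: content_cball)
  then show "emeasure lborel (cball y 1) = ennreal (measure lborel (cball (0::'a) 1))"
    using emeasure_eq_ennreal_measure[of lborel "cball y 1"] emeasure_bounded_finite[OF bounded_cball, of y 1]
    by simp
qed

text \<open>Replace $w(y)$ by an average of $w'$ over the unit ball around $y$ and exchange the integrals.\<close>

lemma translation_bounded_weight:
  fixes w w' :: "'a::euclidean_space \<Rightarrow> real"
  assumes N: "translation_bounded N C"
    and w: "w \<in> borel_measurable borel" and w': "integrable lborel w'" "\<And>x. 0 \<le> w' x"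
    and le: "\<And>t y. dist t y \<le> 1 \<Longrightarrow> w y \<le> w' t"
  shows "(\<integral>\<^sup>+y. ennreal (w (y - z)) \<partial>N) \<le> ennreal (C * (\<integral>x. w' x \<partial>lborel) / measure lborel (cball (0::'a) 1))"
proof -
  let ?b = "measure lborel (cball (0::'a) 1)"
  have [measurable_cong]: "sets N = sets borel" using N by (simp add: translation_bounded_def)
  interpret N: sigma_finite_measure N
    using N translation_bounded_locally_finite locally_finite_sigma_finite by blast
  interpret pair_sigma_finite lborel N ..
  have [measurable]: "w \<in> borel_measurable borel" "w' \<in> borel_measurable borel" using w w' by auto
  have C: "0 \<le> C" using N by (simp add: translation_bounded_def)
  have i0: "0 \<le> (\<integral>x. w' x \<partial>lborel)" using w' by simp
  have "ennreal ?b * (\<integral>\<^sup>+y. ennreal (w (y - z)) \<partial>N) = (\<integral>\<^sup>+y. ennreal (w (y - z)) * emeasure lborel (cball y 1) \<partial>N)"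
    by (subst mult.commute) (simp add: measure_unit_ball nn_integral_multc)
  also have "\<dots> = (\<integral>\<^sup>+y. (\<integral>\<^sup>+t. ennreal (w (y - z)) * indicator (cball y 1) t \<partial>lborel) \<partial>N)"
    by (intro nn_integral_cong) (simp add: nn_integral_cmult_indicator)
  also have "\<dots> \<le> (\<integral>\<^sup>+y. (\<integral>\<^sup>+t. ennreal (w' (t - z)) * indicator {(t,y). dist y t \<le> 1} (t,y) \<partial>lborel) \<partial>N)"
  proof (intro nn_integral_mono)
    fix y t
    have "dist (t - z) (y - z) = dist t y" by (simp add: dist_norm)
    then show "ennreal (w (y - z)) * indicator (cball y 1) t \<le> ennreal (w' (t - z)) * indicator {(t,y). dist y t \<le> 1} (t,y)"
      by (auto simp: indicator_def dist_commute intro!: le ennreal_leI)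
  qed
  also have "\<dots> = (\<integral>\<^sup>+t. (\<integral>\<^sup>+y. ennreal (w' (t - z)) * indicator {(t,y). dist y t \<le> 1} (t,y) \<partial>N) \<partial>lborel)"
    by (rule Fubini') measurable
  also have "\<dots> = (\<integral>\<^sup>+t. ennreal (w' (t - z)) * emeasure N (cball t 1) \<partial>lborel)"
  proof (intro nn_integral_cong)
    fix t
    have "(\<integral>\<^sup>+y. ennreal (w' (t - z)) * indicator {(t,y). dist y t \<le> 1} (t,y) \<partial>N)
      = (\<integral>\<^sup>+y. ennreal (w' (t - z)) * indicator (cball t 1) y \<partial>N)"
      by (intro nn_integral_cong) (auto simp: indicator_def dist_commute)
    then show "(\<integral>\<^sup>+y. ennreal (w' (t - z)) * indicator {(t,y). dist y t \<le> 1} (t,y) \<partial>N)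
      = ennreal (w' (t - z)) * emeasure N (cball t 1)"
      by (simp add: nn_integral_cmult_indicator)
  qed
  also have "\<dots> \<le> (\<integral>\<^sup>+t. ennreal (w' (t - z)) * ennreal C \<partial>lborel)"
    using N by (intro nn_integral_mono mult_left_mono) (auto simp: translation_bounded_def)
  also have "\<dots> = ennreal C * (\<integral>\<^sup>+t. ennreal (w' (t - z)) \<partial>lborel)"
    by (simp add: nn_integral_cmult mult.commute)
  also have "(\<integral>\<^sup>+t. ennreal (w' (t - z)) \<partial>lborel) = (\<integral>\<^sup>+t. ennreal (w' t) \<partial>lborel)"
    by (subst lborel_nn_integral_affine[of _ 1 "-z"]) (auto simp: lborel_nn_integral_affine[of "\<lambda>t. ennreal (w' t)" 1 "-z"])
  also have "\<dots> = ennreal (\<integral>x. w' x \<partial>lborel)"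
    using w' by (intro nn_integral_eq_integral) auto
  also have "ennreal C * ennreal (\<integral>x. w' x \<partial>lborel) = ennreal ?b * ennreal (C * (\<integral>x. w' x \<partial>lborel) / ?b)"
    using C i0 measure_unit_ball(1)[where 'a='a] by (simp flip: ennreal_mult)
  finally show ?thesis
    using measure_unit_ball(1)[where 'a='a] by (subst (asm) ennreal_mult_le_mult_iff) auto
qed

section \<open>The Gaussian kernel and a weighted square-integral bound\<close>

definition gker :: "'a::euclidean_space \<Rightarrow> real" where
  "gker y = exp (- 2 * pi\<^sup>2 * (norm y)\<^sup>2)"

lemma gker_measurable [measurable]: "gker \<in> borel_measurable borel"
  unfolding gker_def by measurable

lemma integrable_exp_norm_sq:
  assumes "0 < a" shows "integrable lborel (\<lambda>x::'a::euclidean_space. exp (- a * (norm x)\<^sup>2))"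
proof -
  define c where "c = sqrt (2 * a)"
  have c: "c \<noteq> 0" "c\<^sup>2 = 2 * a" using assms by (auto simp: c_def)
  have "integrable lborel (\<lambda>x::'a. sqrt (2 * pi) ^ DIM('a) * gauss (0 + c *\<^sub>R x))"
    by (intro integrable_mult_right lborel_integrable_affine integrable_gauss c)
  moreover have eq: "sqrt (2 * pi) ^ DIM('a) * gauss (0 + c *\<^sub>R x) = exp (- a * (norm x)\<^sup>2)" for x :: 'a
    by (simp add: gauss_def power_mult_distrib c)
  ultimately show ?thesis by (simp only: eq)
qed

lemma translation_bounded_gker:
  fixes N :: "'a::euclidean_space measure"
  assumes N: "translation_bounded N C"
  obtains S where "0 < S" "\<And>z. (\<integral>\<^sup>+y. ennreal (gker (y - z)) \<partial>N) \<le> ennreal S"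
proof -
  \<comment> \<open>|t| \<le> |y| + 1 implies |t|^2 \<le> 2 |y|^2 + 2. So half the exponent, paid
    for with the factor exp (2 pi^2), dominates \<open>gker y\<close> at every \<open>t\<close> in
    the unit ball around \<open>y\<close>.\<close>
  define w' where "w' x = exp (2 * pi\<^sup>2) * exp (- pi\<^sup>2 * (norm x)\<^sup>2)" for x :: 'a
  have le: "gker y \<le> w' t" if "dist t y \<le> 1" for t y
  proof -
    have "norm t \<le> norm y + 1" using that norm_triangle_sub[of t y] by (simp add: dist_norm)
    then have "(norm t)\<^sup>2 \<le> (norm y + 1)\<^sup>2" by (intro power_mono) auto
    also have "\<dots> \<le> 2 * (norm y)\<^sup>2 + 2" using zero_le_power2[of "norm y - 1"] by (simp add: power2_eq_square algebra_simps)
    finally have "pi\<^sup>2 * (norm t)\<^sup>2 \<le> pi\<^sup>2 * (2 * (norm y)\<^sup>2 + 2)" by (intro mult_left_mono) auto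
    then have "- 2 * pi\<^sup>2 * (norm y)\<^sup>2 \<le> 2 * pi\<^sup>2 + (- pi\<^sup>2 * (norm t)\<^sup>2)" by (simp add: algebra_simps)
    then show ?thesis unfolding gker_def w'_def exp_add[symmetric] by simp
  qed
  have w': "integrable lborel w'"
    unfolding w'_def by (intro integrable_mult_right integrable_exp_norm_sq) simp
  have w0: "0 \<le> w' x" for x by (simp add: w'_def)
  have *: "(\<integral>\<^sup>+y. ennreal (gker (y - z)) \<partial>N) \<le> ennreal (C * (\<integral>x. w' x \<partial>lborel) / measure lborel (cball (0::'a) 1))" for z
    by (rule translation_bounded_weight[OF N gker_measurable w' w0 le])
  let ?S = "C * (\<integral>x. w' x \<partial>lborel) / measure lborel (cball (0::'a) 1)"
  show ?thesis
    by (rule that[of "max 1 ?S"]) (auto intro!: order_trans[OF *] ennreal_leI)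
qed

text \<open>Duality and Schur's test. Put $I = \int |\check f|^2 dN$ and let $U$ be the transform of
  $\overline{\check f} N$. Then $I = \int f U$, while $\int |U|^2 \mathrm{gauss} \le S I$ by Schur's test
  for the kernel \<^const>\<open>gker\<close>, the transform of \<^const>\<open>gauss\<close>; now apply AM-GM to $f U$.\<close>

lemma fourier_L2_bound_finite:
  fixes N :: "'a::euclidean_space measure"
  assumes "finite_measure N" and N: "sets N = sets borel" and S: "0 < S"
    and bd: "\<And>z. (\<integral>\<^sup>+y. ennreal (gker (y - z)) \<partial>N) \<le> ennreal S"
    and f: "Cc f"
  shows "(\<integral>\<^sup>+y. ennreal ((cmod (fcheck f y))\<^sup>2) \<partial>N) \<le> ennreal (S * (\<integral>x. (cmod (f x))\<^sup>2 / gauss x \<partial>lborel))"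
proof -
  note [measurable_cong] = N
  interpret finite_measure N by fact
  interpret pair_sigma_finite N N ..
  have sf: "sigma_finite_measure N" "sigma_finite_measure (lborel :: 'a measure)" ..
  have fi: "integrable lborel f" using f by (rule Cc_lborel)
  define B where "B = (\<integral>x. norm (f x) \<partial>lborel)"
  define u where "u y = cnj (fcheck f y)" for y
  define U where "U x = (\<integral>y. u y * wave x y \<partial>N)" for x
  have um[measurable]: "u \<in> borel_measurable borel"
  proof -
    have [measurable]: "fcheck f \<in> borel_measurable borel" using fcheck_measurable[OF fi] .
    show ?thesis unfolding u_def
      by (rule borel_measurable_continuous_on[of cnj]) (auto intro!: continuous_intros)
  qed
  have ub: "norm (u y) \<le> B" for y using fcheck_norm_le[of f y] by (simp add: u_def B_def)
  have ui: "integrable N u" using ub by (intro integrable_const_bound[where B=B]) auto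
  have Ucont: "continuous_on UNIV U" unfolding U_def[abs_def]
    using ui by (intro continuous_integral[where w="\<lambda>x. norm (u x)"]) (auto simp: norm_mult intro!: continuous_intros)
  then have [measurable]: "U \<in> borel_measurable borel" by (rule borel_measurable_continuous_onI)
  have Ub: "norm (U x) \<le> (\<integral>y. norm (u y) \<partial>N)" for x
    unfolding U_def by (rule order_trans[OF integral_norm_bound]) (simp add: norm_mult)
  define I where "I = (\<integral>y. (cmod (u y))\<^sup>2 \<partial>N)"
  have u2i: "integrable N (\<lambda>y. (cmod (u y))\<^sup>2)"
    using ub by (intro integrable_const_bound[where B="B\<^sup>2"]) (auto intro!: power_mono)
  have I: "(\<integral>\<^sup>+y. ennreal ((cmod (u y))\<^sup>2) \<partial>N) = ennreal I"
    unfolding I_def using u2i by (intro nn_integral_eq_integral) auto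
  have I0: "0 \<le> I" unfolding I_def by simp
  have "of_real I = (\<integral>y. u y * (\<integral>x. f x * wave x y \<partial>lborel) \<partial>N)"
    unfolding I_def u_def fcheck_def[symmetric]
    by (simp add: complex_norm_square mult.commute flip: integral_complex_of_real del: of_real_power)
  also have "\<dots> = (\<integral>x. f x * U x \<partial>lborel)"
    unfolding U_def by (rule Fubini_wave[symmetric]) (use sf N fi ui in auto)
  finally have I_eq: "of_real I = (\<integral>x. f x * U x \<partial>lborel)" .
  define G :: "'a \<Rightarrow> complex" where "G x = of_real (gauss x)" for x
  have Gi: "integrable lborel G" unfolding G_def using integrable_gauss by (rule integrable_of_real)
  define J where "J = (\<integral>x. gauss x * (cmod (U x))\<^sup>2 \<partial>lborel)"
  have Ji: "integrable lborel (\<lambda>x. gauss x * (cmod (U x))\<^sup>2)"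
  proof -
    let ?D = "\<integral>y. norm (u y) \<partial>N"
    have "norm (gauss x * (cmod (U x))\<^sup>2) \<le> norm (?D\<^sup>2 * gauss x)" for x
      using power_mono[OF Ub[of x], of 2] gauss_pos[of x] by (simp add: abs_mult mult.commute)
    then show ?thesis
      by (intro Bochner_Integration.integrable_bound[OF integrable_mult_right[OF integrable_gauss, of "?D\<^sup>2"]]) auto
  qed
  \<comment> \<open>Open both factors of |U|^2 and integrate over \<open>x\<close> first: the
    Gaussian becomes \<open>gker\<close> of the difference of the two frequencies.\<close>
  have "of_real J = (\<integral>x. (G x * cnj (U x)) * (\<integral>y. u y * wave x y \<partial>N) \<partial>lborel)"
    unfolding J_def U_def[symmetric] integral_complex_of_real[symmetric]
    by (intro Bochner_Integration.integral_cong refl) (simp add: G_def complex_norm_square mult_ac del: of_real_power)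
  also have "\<dots> = (\<integral>y. u y * (\<integral>x. (G x * cnj (U x)) * wave x y \<partial>lborel) \<partial>N)"
    by (rule Fubini_wave) (use sf N ui Ub in \<open>auto intro!: integrable_mult_bounded[OF Gi]\<close>)
  also have "\<dots> = (\<integral>y. u y * (\<integral>y'. cnj (u y') * of_real (gker (y' - y)) \<partial>N) \<partial>N)"
  proof (rule Bochner_Integration.integral_cong[OF refl arg_cong2[where f=times, OF refl]])
    fix y
    have cU: "cnj (U x) = (\<integral>y'. cnj (u y') * cnj (wave x y') \<partial>N)" for x
      unfolding U_def by (simp flip: Bochner_Integration.integral_cnj)
    have "(\<integral>x. (G x * cnj (U x)) * wave x y \<partial>lborel) = (\<integral>x. (G x * wave x y) * (\<integral>y'. cnj (u y') * cnj (wave x y') \<partial>N) \<partial>lborel)"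
      by (simp add: cU mult_ac)
    also have "\<dots> = (\<integral>y'. cnj (u y') * (\<integral>x. (G x * wave x y) * cnj (wave x y') \<partial>lborel) \<partial>N)"
      by (rule Fubini_kernel[where B=1]) (use sf N ui in \<open>auto intro!: integrable_mult_bounded[OF Gi, where B=1]\<close>)
    also have "\<dots> = (\<integral>y'. cnj (u y') * of_real (gker (y' - y)) \<partial>N)"
    proof (rule Bochner_Integration.integral_cong[OF refl arg_cong2[where f=times, OF refl]])
      fix y'
      have "(\<integral>x. (G x * wave x y) * cnj (wave x y') \<partial>lborel) = (\<integral>x. G x * wave x (y - y') \<partial>lborel)"
        unfolding wave_diff(2) by (simp only: mult.assoc)
      also have "\<dots> = of_real (gker (y - y'))"
        using fourier_gauss_scaled[of 1 "y - y'"] by (simp add: G_def gker_def)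
      finally show "(\<integral>x. (G x * wave x y) * cnj (wave x y') \<partial>lborel) = of_real (gker (y' - y))"
        by (simp add: gker_def norm_minus_commute)
    qed
    finally show "(\<integral>x. (G x * cnj (U x)) * wave x y \<partial>lborel) = (\<integral>y'. cnj (u y') * of_real (gker (y' - y)) \<partial>N)" .
  qed
  finally have J_eq: "of_real J = (\<integral>y. u y * (\<integral>y'. cnj (u y') * of_real (gker (y' - y)) \<partial>N) \<partial>N)" .
  have gk: "0 \<le> gker x" for x :: 'a by (simp add: gker_def)
  have sq: "(\<integral>\<^sup>+y. \<integral>\<^sup>+y'. ennreal ((cmod (u y))\<^sup>2 * gker (y' - y)) \<partial>N \<partial>N) \<le> ennreal (S * I)"
  proof -
    have "(\<integral>\<^sup>+y. \<integral>\<^sup>+y'. ennreal ((cmod (u y))\<^sup>2 * gker (y' - y)) \<partial>N \<partial>N)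
      = (\<integral>\<^sup>+y. ennreal ((cmod (u y))\<^sup>2) * (\<integral>\<^sup>+y'. ennreal (gker (y' - y)) \<partial>N) \<partial>N)"
      by (simp add: ennreal_mult gk nn_integral_cmult)
    also have "\<dots> \<le> (\<integral>\<^sup>+y. ennreal ((cmod (u y))\<^sup>2) * ennreal S \<partial>N)"
      by (intro nn_integral_mono mult_left_mono bd) auto
    also have "\<dots> = ennreal (S * I)"
      using S I0 by (subst nn_integral_multc) (auto simp: I ennreal_mult mult.commute)
    finally show ?thesis .
  qed
  have sq': "(\<integral>\<^sup>+y. \<integral>\<^sup>+y'. ennreal ((cmod (u y'))\<^sup>2 * gker (y' - y)) \<partial>N \<partial>N) \<le> ennreal (S * I)"
  proof -
    have "(\<integral>\<^sup>+y. \<integral>\<^sup>+y'. ennreal ((cmod (u y'))\<^sup>2 * gker (y' - y)) \<partial>N \<partial>N)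
       = (\<integral>\<^sup>+y'. \<integral>\<^sup>+y. ennreal ((cmod (u y'))\<^sup>2 * gker (y' - y)) \<partial>N \<partial>N)"
      by (rule Fubini') measurable
    also have "\<dots> = (\<integral>\<^sup>+y'. \<integral>\<^sup>+y. ennreal ((cmod (u y'))\<^sup>2 * gker (y - y')) \<partial>N \<partial>N)"
      by (simp add: gker_def norm_minus_commute)
    finally show ?thesis using sq by simp
  qed
  have "ennreal J \<le> (\<integral>\<^sup>+y. ennreal (norm (u y * (\<integral>y'. cnj (u y') * of_real (gker (y' - y)) \<partial>N))) \<partial>N)"
  proof -
    have "J \<le> norm (complex_of_real J)" by simp
    then have "ennreal J \<le> ennreal (norm (complex_of_real J))" by (rule ennreal_leI)
    also have "\<dots> \<le> (\<integral>\<^sup>+y. ennreal (norm (u y * (\<integral>y'. cnj (u y') * of_real (gker (y' - y)) \<partial>N))) \<partial>N)"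
      unfolding J_eq by (cases "integrable N (\<lambda>y. u y * (\<integral>y'. cnj (u y') * of_real (gker (y' - y)) \<partial>N))")
        (auto intro: integral_norm_bound_ennreal simp: not_integrable_integral_eq)
    finally show ?thesis .
  qed
  also have "\<dots> \<le> (\<integral>\<^sup>+y. (\<integral>\<^sup>+y'. ennreal (norm (u y) * (norm (u y') * gker (y' - y))) \<partial>N) \<partial>N)"
  proof (intro nn_integral_mono)
    fix y
    have "ennreal (norm (\<integral>y'. cnj (u y') * of_real (gker (y' - y)) \<partial>N)) \<le> (\<integral>\<^sup>+y'. ennreal (norm (u y') * gker (y' - y)) \<partial>N)"
      using integral_norm_bound_ennreal[of N "\<lambda>y'. cnj (u y') * of_real (gker (y' - y))"]
      by (cases "integrable N (\<lambda>y'. cnj (u y') * of_real (gker (y' - y)))")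
        (auto simp: not_integrable_integral_eq norm_mult gk)
    then have "ennreal (norm (u y)) * ennreal (norm (\<integral>y'. cnj (u y') * of_real (gker (y' - y)) \<partial>N))
       \<le> ennreal (norm (u y)) * (\<integral>\<^sup>+y'. ennreal (norm (u y') * gker (y' - y)) \<partial>N)"
      by (rule mult_left_mono) simp
    also have "\<dots> = (\<integral>\<^sup>+y'. ennreal (norm (u y) * (norm (u y') * gker (y' - y))) \<partial>N)"
      by (simp add: ennreal_mult gk nn_integral_cmult)
    finally show "ennreal (norm (u y * (\<integral>y'. cnj (u y') * of_real (gker (y' - y)) \<partial>N)))
       \<le> (\<integral>\<^sup>+y'. ennreal (norm (u y) * (norm (u y') * gker (y' - y))) \<partial>N)"
      by (simp add: norm_mult ennreal_mult)
  qed
  \<comment> \<open>After this inequality each summand contains \<open>u\<close> at one of the two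
    points only, and integrating the symmetric kernel over the other point costs the factor
    \<open>S\<close>.\<close>
  also have "\<dots> \<le> (\<integral>\<^sup>+y. (\<integral>\<^sup>+y'. ennreal (1/2) * (ennreal ((cmod (u y))\<^sup>2 * gker (y' - y)) + ennreal ((cmod (u y'))\<^sup>2 * gker (y' - y))) \<partial>N) \<partial>N)"
  proof (intro nn_integral_mono)
    fix y y'
    have "norm (u y) * norm (u y') \<le> 1/2 * ((norm (u y))\<^sup>2 + (norm (u y'))\<^sup>2)"
      using zero_le_power2[of "norm (u y) - norm (u y')"] by (simp add: power2_eq_square algebra_simps)
    from mult_right_mono[OF this gk[of "y' - y"]]
    have "norm (u y) * (norm (u y') * gker (y' - y)) \<le> 1/2 * ((cmod (u y))\<^sup>2 * gker (y' - y) + (cmod (u y'))\<^sup>2 * gker (y' - y))"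
      by (simp add: algebra_simps)
    then show "ennreal (norm (u y) * (norm (u y') * gker (y' - y))) \<le>
      ennreal (1/2) * (ennreal ((cmod (u y))\<^sup>2 * gker (y' - y)) + ennreal ((cmod (u y'))\<^sup>2 * gker (y' - y)))"
      by (subst ennreal_plus[symmetric], simp add: gk, simp add: gk, subst ennreal_mult[symmetric])
        (auto simp: gk intro!: ennreal_leI)
  qed
  also have "\<dots> = ennreal (1/2) * ((\<integral>\<^sup>+y. \<integral>\<^sup>+y'. ennreal ((cmod (u y))\<^sup>2 * gker (y' - y)) \<partial>N \<partial>N) + (\<integral>\<^sup>+y. \<integral>\<^sup>+y'. ennreal ((cmod (u y'))\<^sup>2 * gker (y' - y)) \<partial>N \<partial>N))"
    by (simp add: nn_integral_cmult nn_integral_add)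
  also have "\<dots> \<le> ennreal (1/2) * (ennreal (S * I) + ennreal (S * I))"
    by (intro mult_left_mono add_mono sq sq') auto
  also have "\<dots> = ennreal (S * I)"
  proof -
    have "0 \<le> S * I" using S I0 by simp
    then have "ennreal (1/2) * (ennreal (S * I) + ennreal (S * I)) = ennreal (1/2 * (S * I + S * I))"
      by (simp only: ennreal_plus[symmetric] ennreal_mult[symmetric] add_nonneg_nonneg divide_nonneg_nonneg zero_le_one zero_le_numeral)
    also have "1/2 * (S * I + S * I) = S * I" by simp
    finally show ?thesis .
  qed
  finally have JI: "J \<le> S * I" using S I0 by (simp add: ennreal_le_iff)
  define P where "P = (\<integral>x. (cmod (f x))\<^sup>2 / gauss x \<partial>lborel)"
  have Pc: "Cc (\<lambda>x. (cmod (f x))\<^sup>2 / gauss x)"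
  proof (rule CcI[of _ "fsupp f"])
    have [simp]: "gauss x \<noteq> 0" for x :: 'a using gauss_pos[of x] by simp
    show "continuous_on UNIV (\<lambda>x. (cmod (f x))\<^sup>2 / gauss x)"
      using Cc_cont[OF f] by (intro continuous_intros) auto
  qed (use f in \<open>auto simp: Cc_compact not_in_fsupp\<close>)
  then have Pi: "integrable lborel (\<lambda>x. (cmod (f x))\<^sup>2 / gauss x)"
    by (intro Cc_integrable locally_finite_lborel)
  have "I \<le> (\<integral>x. norm (f x * U x) \<partial>lborel)"
    using integral_norm_bound[of lborel "\<lambda>x. f x * U x"] I0 unfolding I_eq[symmetric] by simp
  \<comment> \<open>The weight is chosen so that \<open>J \<le> S * I\<close> turns the second term
    into at most \<open>I / 2\<close>, which is absorbed on the left. Absorbing requires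
    \<open>I\<close> to be finite, hence the restriction to finite \<open>N\<close>.\<close>
  also have "\<dots> \<le> (\<integral>x. S / 2 * ((cmod (f x))\<^sup>2 / gauss x) + 1 / (2 * S) * (gauss x * (cmod (U x))\<^sup>2) \<partial>lborel)"
  proof (rule integral_mono)
    show "integrable lborel (\<lambda>x. norm (f x * U x))"
      using Ub by (intro integrable_norm integrable_mult_bounded[OF fi]) auto
    show "integrable lborel (\<lambda>x. S / 2 * ((cmod (f x))\<^sup>2 / gauss x) + 1 / (2 * S) * (gauss x * (cmod (U x))\<^sup>2))"
      using Pi Ji by (intro Bochner_Integration.integrable_add integrable_mult_right)
    fix x :: 'a
    have g: "0 < gauss x" by (rule gauss_pos)
    have "0 \<le> (S * cmod (f x) - gauss x * cmod (U x))\<^sup>2 / (2 * S * gauss x)" using g S by simp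
    also have "\<dots> = S / 2 * ((cmod (f x))\<^sup>2 / gauss x) + 1 / (2 * S) * (gauss x * (cmod (U x))\<^sup>2) - cmod (f x) * cmod (U x)"
      using g S by (simp add: field_simps power2_eq_square)
    finally show "norm (f x * U x) \<le> S / 2 * ((cmod (f x))\<^sup>2 / gauss x) + 1 / (2 * S) * (gauss x * (cmod (U x))\<^sup>2)"
      by (simp add: norm_mult)
  qed
  also have "\<dots> = S / 2 * P + 1 / (2 * S) * J"
    unfolding P_def J_def
    by (subst Bochner_Integration.integral_add[OF integrable_mult_right[OF Pi] integrable_mult_right[OF Ji]])
       (simp only: integral_mult_right_zero)
  also have "\<dots> \<le> S / 2 * P + 1 / (2 * S) * (S * I)"
    using JI S by (intro add_mono mult_left_mono) auto
  also have "\<dots> = S / 2 * P + I / 2" using S by simp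
  finally have "I \<le> S * P" by simp
  then show ?thesis
    using I by (simp add: u_def P_def ennreal_leI)
qed

text \<open>The restrictions of \<open>N\<close> to balls are finite and inherit the Gaussian bound,
  so \<open>S\<close> is the same for all of them and monotone convergence applies.\<close>

lemma fourier_L2_bound:
  fixes N :: "'a::euclidean_space measure"
  assumes N: "translation_bounded N C"
  obtains S where "0 < S" "\<And>f. Cc f \<Longrightarrow>
    (\<integral>\<^sup>+y. ennreal ((cmod (fcheck f y))\<^sup>2) \<partial>N) \<le> ennreal (S * (\<integral>x. (cmod (f x))\<^sup>2 / gauss x \<partial>lborel))"
proof -
  obtain S where S: "0 < S" "\<And>z. (\<integral>\<^sup>+y. ennreal (gker (y - z)) \<partial>N) \<le> ennreal S"
    using translation_bounded_gker[OF N] by metis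
  have [measurable_cong]: "sets N = sets borel" using N by (simp add: translation_bounded_def)
  show ?thesis
  proof (rule that[OF S(1)])
    fix f :: "'a \<Rightarrow> complex" assume f: "Cc f"
    have [measurable]: "fcheck f \<in> borel_measurable borel"
      using fcheck_measurable[OF Cc_lborel[OF f]] .
    define R where "R n = density N (indicator (cball 0 (real n)))" for n
    have R: "(\<integral>\<^sup>+y. g y \<partial>R n) = (\<integral>\<^sup>+y. g y * indicator (cball 0 (real n)) y \<partial>N)"
      if [measurable]: "g \<in> borel_measurable borel" for g n
    proof -
      have [measurable]: "cball 0 (real n) \<in> sets N" using N by (simp add: translation_bounded_def)
      show ?thesis unfolding R_def by (subst nn_integral_density) (auto simp: mult.commute)
    qed
    have le: "(\<integral>\<^sup>+y. ennreal ((cmod (fcheck f y))\<^sup>2) * indicator (cball 0 (real n)) y \<partial>N)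
       \<le> ennreal (S * (\<integral>x. (cmod (f x))\<^sup>2 / gauss x \<partial>lborel))" for n
    proof -
      have "(\<integral>\<^sup>+y. ennreal ((cmod (fcheck f y))\<^sup>2) \<partial>R n) \<le> ennreal (S * (\<integral>x. (cmod (f x))\<^sup>2 / gauss x \<partial>lborel))"
      proof (rule fourier_L2_bound_finite[OF _ _ S(1) _ f])
        show "sets (R n) = sets borel" using N by (simp add: R_def translation_bounded_def)
        have "emeasure (R n) (space (R n)) = emeasure N (cball 0 (real n))"
        proof -
          have "cball 0 (real n) \<in> sets N" using N by (simp add: translation_bounded_def)
          moreover have "emeasure (R n) (space (R n)) = (\<integral>\<^sup>+y. 1 \<partial>R n)" by simp
          ultimately show ?thesis using R[of "\<lambda>_. 1" n] by simp
        qed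
        then show "finite_measure (R n)"
          using locally_finite_compact[OF translation_bounded_locally_finite[OF N], of "cball 0 (real n)"]
          by (intro finite_measureI) auto
        fix z
        have "(\<integral>\<^sup>+y. ennreal (gker (y - z)) \<partial>R n) \<le> (\<integral>\<^sup>+y. ennreal (gker (y - z)) \<partial>N)"
          by (subst R) (auto intro!: nn_integral_mono simp: indicator_def)
        also have "\<dots> \<le> ennreal S" by (rule S)
        finally show "(\<integral>\<^sup>+y. ennreal (gker (y - z)) \<partial>R n) \<le> ennreal S" .
      qed
      then show ?thesis by (subst (asm) R) auto
    qed
    have "(\<integral>\<^sup>+y. ennreal ((cmod (fcheck f y))\<^sup>2) \<partial>N)
       = (\<integral>\<^sup>+y. (SUP n. ennreal ((cmod (fcheck f y))\<^sup>2) * indicator (cball 0 (real n)) y) \<partial>N)"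
    proof (intro nn_integral_cong antisym)
      fix y :: 'a
      obtain n where "norm y \<le> real n" using real_arch_simple by blast
      then show "ennreal ((cmod (fcheck f y))\<^sup>2) \<le> (SUP n. ennreal ((cmod (fcheck f y))\<^sup>2) * indicator (cball 0 (real n)) y)"
        by (intro SUP_upper2[of n]) auto
      show "(SUP n. ennreal ((cmod (fcheck f y))\<^sup>2) * indicator (cball 0 (real n)) y) \<le> ennreal ((cmod (fcheck f y))\<^sup>2)"
        by (intro SUP_least) (auto simp: indicator_def)
    qed
    also have "\<dots> = (SUP n. \<integral>\<^sup>+y. ennreal ((cmod (fcheck f y))\<^sup>2) * indicator (cball 0 (real n)) y \<partial>N)"
      by (intro nn_integral_monotone_convergence_SUP) (auto simp: incseq_def le_fun_def indicator_def)
    also have "\<dots> \<le> ennreal (S * (\<integral>x. (cmod (f x))\<^sup>2 / gauss x \<partial>lborel))"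
      by (intro SUP_least le)
    finally show "(\<integral>\<^sup>+y. ennreal ((cmod (fcheck f y))\<^sup>2) \<partial>N) \<le> ennreal (S * (\<integral>x. (cmod (f x))\<^sup>2 / gauss x \<partial>lborel))" .
  qed
qed

subsection \<open>Positive definite functions\<close>

lemma pos_defD:
  assumes "pos_def f"
  shows "(\<Sum>i<(n::nat). \<Sum>j<n. c i * cnj (c j) * f (x i - x j)) \<in> \<real>\<^sub>\<ge>\<^sub>0"
  using assms unfolding pos_def_def Let_def complex_nonneg_Reals_iff by blast

text \<open>Turns integrals into the finite sums that positive definiteness speaks about. Only the
  values of \<open>g\<close> on the finite range of \<open>s\<close> enter, so \<open>g\<close> is
  arbitrary.\<close>

lemma integral_simple_comp:
  fixes g :: "'b \<Rightarrow> complex"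
  assumes "finite_measure M" and s: "simple_function M s"
  shows "integrable M (\<lambda>x. g (s x))"
    and "(\<integral>x. g (s x) \<partial>M) = (\<Sum>v\<in>s ` space M. of_real (measure M (s -` {v} \<inter> space M)) * g v)"
proof -
  interpret finite_measure M by fact
  let ?V = "s ` space M" and ?A = "\<lambda>v. s -` {v} \<inter> space M"
  have V: "finite ?V" using s by (rule simple_functionD)
  have A: "?A v \<in> sets M" for v using s by (rule simple_functionD)
  have eq: "g (s x) = (\<Sum>v\<in>?V. of_real (indicator (?A v) x) * g v)" if "x \<in> space M" for x
  proof -
    have "(\<Sum>v\<in>?V. of_real (indicator (?A v) x) * g v) = (\<Sum>v\<in>?V. if v = s x then g v else 0)"
      using that by (intro sum.cong) (auto simp: indicator_def)
    then show ?thesis using V that by simp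
  qed
  have i: "integrable M (\<lambda>x. complex_of_real (indicator (?A v) x) * g v)" for v
    using A[of v] by (intro integrable_mult_left integrable_of_real integrable_real_indicator) (auto simp: less_top[symmetric])
  show "integrable M (\<lambda>x. g (s x))"
  proof -
    have "integrable M (\<lambda>x. \<Sum>v\<in>?V. of_real (indicator (?A v) x) * g v)"
      by (intro Bochner_Integration.integrable_sum i)
    then show ?thesis by (subst Bochner_Integration.integrable_cong[OF refl eq])
  qed
  have "(\<integral>x. g (s x) \<partial>M) = (\<integral>x. (\<Sum>v\<in>?V. of_real (indicator (?A v) x) * g v) \<partial>M)"
    by (intro Bochner_Integration.integral_cong refl eq)
  also have "\<dots> = (\<Sum>v\<in>?V. \<integral>x. of_real (indicator (?A v) x) * g v \<partial>M)"
    by (intro Bochner_Integration.integral_sum i)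
  also have "\<dots> = (\<Sum>v\<in>?V. of_real (measure M (?A v)) * g v)"
    using A by (intro sum.cong refl) simp
  finally show "(\<integral>x. g (s x) \<partial>M) = (\<Sum>v\<in>?V. of_real (measure M (?A v)) * g v)" .
qed

lemma pos_def_sum:
  assumes "pos_def F" "finite V"
  shows "(\<Sum>v\<in>V. \<Sum>v'\<in>V. c v * cnj (c v') * F (v - v')) \<in> \<real>\<^sub>\<ge>\<^sub>0"
proof -
  obtain x where x: "bij_betw x {..<card V} V" using assms(2) ex_bij_betw_nat_finite[of V]
    by (auto simp: atLeast0LessThan)
  have "(\<Sum>v\<in>V. \<Sum>v'\<in>V. c v * cnj (c v') * F (v - v'))
     = (\<Sum>i<card V. \<Sum>j<card V. c (x i) * cnj (c (x j)) * F (x i - x j))"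
    by (subst sum.reindex_bij_betw[OF x, symmetric], subst sum.reindex_bij_betw[OF x, symmetric]) simp
  then show ?thesis
    using pos_defD[OF assms(1), where n="card V" and c="\<lambda>i. c (x i)" and x=x] by simp
qed

text \<open>A character of a difference factors as \<open>wave (x i) y * cnj (wave (x j) y)\<close>,
  and the two factors are absorbed by the coefficients.\<close>

lemma pos_def_modulate:
  assumes "pos_def F" shows "pos_def (\<lambda>x. F x * wave x y)"
  unfolding pos_def_def
proof (intro allI)
  fix n :: nat and c :: "nat \<Rightarrow> complex" and x :: "nat \<Rightarrow> 'a"
  have "(\<Sum>i<n. \<Sum>j<n. c i * cnj (c j) * (F (x i - x j) * wave (x i - x j) y))
     = (\<Sum>i<n. \<Sum>j<n. (c i * wave (x i) y) * cnj (c j * wave (x j) y) * F (x i - x j))"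
    unfolding wave_diff by (intro sum.cong refl) (simp add: mult_ac)
  then show "let s = \<Sum>i<n. \<Sum>j<n. c i * cnj (c j) * (F (x i - x j) * wave (x i - x j) y) in Im s = 0 \<and> 0 \<le> Re s"
    using pos_defD[OF assms, where n=n and c="\<lambda>i. c i * wave (x i) y" and x=x]
    by (simp add: complex_nonneg_Reals_iff Let_def)
qed

text \<open>Approximate the identity map by simple functions \<open>s k\<close>. For each
  \<open>k\<close> the double integral is a quadratic form of \<open>F\<close> whose coefficients
  are the masses of the level sets of \<open>s k\<close>. Continuity and boundedness of
  \<open>F\<close> allow dominated convergence twice, and the nonnegative reals are closed.\<close>

lemma pos_def_double_integral:
  fixes F :: "'a::euclidean_space \<Rightarrow> complex"
  assumes F: "pos_def F" "continuous_on UNIV F" and B: "\<And>x. norm (F x) \<le> B"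
    and M: "finite_measure M" "sets M = sets borel"
  shows "(\<integral>x. (\<integral>x'. F (x - x') \<partial>M) \<partial>M) \<in> \<real>\<^sub>\<ge>\<^sub>0"
proof -
  interpret finite_measure M by fact
  note [measurable_cong] = M(2)
  have sp: "space M = UNIV" using sets_eq_imp_space_eq[OF M(2)] by simp
  obtain s where s: "\<And>k. simple_function M (s k)" "\<And>x. (\<lambda>k. s k x) \<longlonglongrightarrow> (x::'a)"
    using borel_measurable_implies_sequence_metric[of "\<lambda>x. x" M 0] by (auto simp: sp)
  have [measurable]: "F \<in> borel_measurable borel" using F(2) by (rule borel_measurable_continuous_onI)
  have sm[measurable]: "s k \<in> borel_measurable M" for k using s(1) by (rule borel_measurable_simple_function)
  have lim: "(\<lambda>k. F (s k x - s k x')) \<longlonglongrightarrow> F (x - x')" for x x'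
    using F(2) tendsto_diff[OF s(2) s(2)] by (rule continuous_on_tendsto_compose) auto
  have lim1: "(\<lambda>k. \<integral>x'. F (s k x - s k x') \<partial>M) \<longlonglongrightarrow> (\<integral>x'. F (x - x') \<partial>M)" for x
    by (rule integral_dominated_convergence[where w="\<lambda>_. B"]) (use lim B in auto)
  have "(\<lambda>k. \<integral>x. (\<integral>x'. F (s k x - s k x') \<partial>M) \<partial>M) \<longlonglongrightarrow> (\<integral>x. (\<integral>x'. F (x - x') \<partial>M) \<partial>M)"
  proof (rule integral_dominated_convergence[where w="\<lambda>_. B * measure M (space M)"])
    fix k
    show "AE x in M. norm (\<integral>x'. F (s k x - s k x') \<partial>M) \<le> B * measure M (space M)"
    proof (intro always_eventually allI)
      fix x
      have "norm (\<integral>x'. F (s k x - s k x') \<partial>M) \<le> (\<integral>x'. norm (F (s k x - s k x')) \<partial>M)"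
        by (rule integral_norm_bound)
      also have "\<dots> \<le> (\<integral>x'. B \<partial>M)"
        using B order_trans[OF norm_ge_zero B] by (intro integral_mono integrable_const_bound[where B=B]) auto
      finally show "norm (\<integral>x'. F (s k x - s k x') \<partial>M) \<le> B * measure M (space M)" by (simp add: mult.commute)
    qed
  qed (use lim1 in auto)
  moreover have "(\<integral>x. (\<integral>x'. F (s k x - s k x') \<partial>M) \<partial>M) \<in> \<real>\<^sub>\<ge>\<^sub>0" for k
  proof -
    let ?V = "s k ` space M" and ?m = "\<lambda>v. measure M (s k -` {v} \<inter> space M)"
    have "(\<integral>x. (\<integral>x'. F (s k x - s k x') \<partial>M) \<partial>M) = (\<Sum>v\<in>?V. of_real (?m v) * (\<integral>x'. F (v - s k x') \<partial>M))"
      using integral_simple_comp(2)[OF M(1) s(1)[of k], of "\<lambda>v. \<integral>x'. F (v - s k x') \<partial>M"] by simp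
    also have "\<dots> = (\<Sum>v\<in>?V. of_real (?m v) * (\<Sum>v'\<in>?V. of_real (?m v') * F (v - v')))"
      by (intro sum.cong refl arg_cong2[where f=times] integral_simple_comp(2)[OF M(1) s(1)])
    also have "\<dots> = (\<Sum>v\<in>?V. \<Sum>v'\<in>?V. of_real (?m v) * cnj (of_real (?m v')) * F (v - v'))"
      by (simp add: sum_distrib_left mult.assoc)
    also have "\<dots> \<in> \<real>\<^sub>\<ge>\<^sub>0"
      using F(1) simple_functionD(1)[OF s(1)[of k]] by (rule pos_def_sum)
    finally show ?thesis .
  qed
  ultimately show ?thesis
    using closed_sequentially[OF closed_nonneg_Reals_complex, of "\<lambda>k. \<integral>x. (\<integral>x'. F (s k x - s k x') \<partial>M) \<partial>M"] by simp
qed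

text \<open>Integrate $F(x - x')$ against a product of two Gaussians and split off $z = x - x'$ with the
  parallelogram law.\<close>

lemma pos_def_gauss_integral:
  fixes F :: "'a::euclidean_space \<Rightarrow> complex"
  assumes F: "pos_def F" "Cc F" and e: "0 < e"
  shows "(\<integral>z. F z * of_real (exp (- (e\<^sup>2 * (norm z)\<^sup>2 / 4))) \<partial>lborel) \<in> \<real>\<^sub>\<ge>\<^sub>0"
proof -
  obtain B where B: "\<And>x. norm (F x) \<le> B" using Cc_bounded[OF F(2)] by metis
  have [measurable]: "F \<in> borel_measurable borel" using F(2) by (rule Cc_measurable)
  define G where "G x = exp (- (e\<^sup>2 * (norm x)\<^sup>2 / 2))" for x :: 'a
  have Gi: "integrable lborel G" unfolding G_def using integrable_exp_norm_sq[of "e\<^sup>2 / 2"] e by simp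
  have Gm[measurable]: "G \<in> borel_measurable borel" using Gi by auto
  have G0: "0 < G x" "G x \<le> 1" for x by (auto simp: G_def)
  define M where "M = density lborel (\<lambda>x. ennreal (G x))"
  have M: "sets M = sets borel" by (simp add: M_def)
  have Mi: "(\<integral>x. h x \<partial>M) = (\<integral>x. of_real (G x) * h x \<partial>lborel)" if "h \<in> borel_measurable borel" for h :: "'a \<Rightarrow> complex"
    unfolding M_def using that G0 by (subst integral_density) (auto simp: scaleR_conv_of_real less_imp_le)
  have fm: "finite_measure M"
  proof (intro finite_measureI)
    have "emeasure M (space M) = (\<integral>\<^sup>+x. ennreal (G x) \<partial>lborel)"
      by (simp add: M_def emeasure_density)
    also have "\<dots> < \<infinity>" using Gi G0 by (simp add: integrable_iff_bounded less_imp_le abs_of_pos)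
    finally show "emeasure M (space M) \<noteq> \<infinity>" by simp
  qed
  define Gc where "Gc x = complex_of_real (G x)" for x
  have Gci: "integrable lborel Gc" unfolding Gc_def using Gi by (rule integrable_of_real)
  have "(\<integral>x. (\<integral>x'. F (x - x') \<partial>M) \<partial>M) = (\<integral>x. Gc x * (\<integral>x'. Gc x' * F (x - x') \<partial>lborel) \<partial>lborel)"
    by (simp add: Mi Gc_def)
  also have "\<dots> = (\<integral>x. Gc x * (\<integral>z. F z * Gc (x - z) \<partial>lborel) \<partial>lborel)"
  proof -
    have "(\<integral>x'. Gc x' * F (x - x') \<partial>lborel) = (\<integral>z. F z * Gc (x - z) \<partial>lborel)" for x
      using lborel_integral_reflect[of "\<lambda>z. F z * Gc (x - z)" x] by (simp add: mult.commute)
    then show ?thesis by simp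
  qed
  also have "\<dots> = (\<integral>z. F z * (\<integral>x. Gc x * Gc (x - z) \<partial>lborel) \<partial>lborel)"
    by (rule Fubini_kernel[OF sigma_finite_lborel sigma_finite_lborel Gci Cc_lborel[OF F(2)], where B=1])
      (use G0 in \<open>simp_all add: Gc_def abs_of_pos\<close>)
  also have "\<dots> = (\<integral>z. F z * (of_real (exp (- (e\<^sup>2 * (norm z)\<^sup>2 / 4))) * of_real (\<integral>x. exp (- (e\<^sup>2 * (norm (x::'a))\<^sup>2)) \<partial>lborel)) \<partial>lborel)"
  proof (rule Bochner_Integration.integral_cong[OF refl arg_cong2[where f=times, OF refl]])
    fix z :: 'a
    have "Gc x * Gc (x - z) = of_real (exp (- (e\<^sup>2 * (norm z)\<^sup>2 / 4)) * exp (- (e\<^sup>2 * (norm (- (1/2) *\<^sub>R z + x))\<^sup>2)))" for x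
    proof -
      have "(norm x)\<^sup>2 + (norm (x - z))\<^sup>2 = (norm z)\<^sup>2 / 2 + 2 * (norm (- (1/2) *\<^sub>R z + x))\<^sup>2"
        by (simp add: power2_norm_eq_inner inner_simps inner_commute field_simps)
      then have "e\<^sup>2 * (norm x)\<^sup>2 / 2 + e\<^sup>2 * (norm (x - z))\<^sup>2 / 2 = e\<^sup>2 * (norm z)\<^sup>2 / 4 + e\<^sup>2 * (norm (- (1/2) *\<^sub>R z + x))\<^sup>2"
        by (simp only: distrib_left[symmetric] add_divide_distrib[symmetric]) (simp add: field_simps)
      then show ?thesis
        unfolding Gc_def G_def of_real_mult[symmetric] exp_add[symmetric] by simp
    qed
    then have "(\<integral>x. Gc x * Gc (x - z) \<partial>lborel) = (\<integral>x. of_real (exp (- (e\<^sup>2 * (norm z)\<^sup>2 / 4)) * exp (- (e\<^sup>2 * (norm (- (1/2) *\<^sub>R z + x))\<^sup>2))) \<partial>lborel)"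
      by presburger
    also have "\<dots> = of_real (\<integral>x. exp (- (e\<^sup>2 * (norm z)\<^sup>2 / 4)) * exp (- (e\<^sup>2 * (norm (- (1/2) *\<^sub>R z + x))\<^sup>2)) \<partial>lborel)"
      by (rule integral_complex_of_real)
    also have "\<dots> = of_real (exp (- (e\<^sup>2 * (norm z)\<^sup>2 / 4)) * (\<integral>x. exp (- (e\<^sup>2 * (norm (x::'a))\<^sup>2)) \<partial>lborel))"
      using lborel_integral_translate[of "\<lambda>x. exp (- (e\<^sup>2 * (norm (x::'a))\<^sup>2))" "- (1/2) *\<^sub>R z"]
      by (simp only: integral_mult_right_zero)
    finally show "(\<integral>x. Gc x * Gc (x - z) \<partial>lborel) = of_real (exp (- (e\<^sup>2 * (norm z)\<^sup>2 / 4))) * of_real (\<integral>x. exp (- (e\<^sup>2 * (norm (x::'a))\<^sup>2)) \<partial>lborel)"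
      by (simp only: of_real_mult)
  qed
  also have "\<dots> = (\<integral>z. F z * of_real (exp (- (e\<^sup>2 * (norm z)\<^sup>2 / 4))) \<partial>lborel) * of_real (\<integral>x. exp (- (e\<^sup>2 * (norm (x::'a))\<^sup>2)) \<partial>lborel)"
    by (simp only: mult.assoc[symmetric] integral_mult_left_zero)
  finally have eq: "(\<integral>x. (\<integral>x'. F (x - x') \<partial>M) \<partial>M) = \<dots>" .
  \<comment> \<open>The factor left over by the inner Gaussian integral; it is positive and can be
    divided out.\<close>
  define c where "c = (\<integral>x. exp (- (e\<^sup>2 * (norm (x::'a))\<^sup>2)) \<partial>lborel)"
  have c: "0 < c"
  proof -
    have "integrable lborel (\<lambda>x::'a. exp (- (e\<^sup>2 * (norm x)\<^sup>2)))"
      using integrable_exp_norm_sq[of "e\<^sup>2"] e by simp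
    note i = this
    have "c \<noteq> 0"
    proof
      assume "c = 0"
      then have "AE x in (lborel :: 'a measure). exp (- (e\<^sup>2 * (norm x)\<^sup>2)) = 0"
        unfolding c_def by (subst (asm) integral_nonneg_eq_0_iff_AE[OF i]) auto
      then have "AE x in (lborel :: 'a measure). False" by simp
      then show False by (auto elim!: AE_E simp: emeasure_lborel_UNIV top_unique dest: emeasure_mono[of UNIV _ lborel])
    qed
    moreover have "0 \<le> c" unfolding c_def by simp
    ultimately show ?thesis by simp
  qed
  have "(\<integral>z. F z * of_real (exp (- (e\<^sup>2 * (norm z)\<^sup>2 / 4))) \<partial>lborel) * of_real c \<in> \<real>\<^sub>\<ge>\<^sub>0"
    unfolding c_def eq[symmetric] using F B fm M by (intro pos_def_double_integral) (auto intro: Cc_cont)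
  then show ?thesis using c by (simp add: complex_nonneg_Reals_iff zero_le_mult_iff)
qed

text \<open>The Gaussian factor of the preceding lemma tends to 1 as its parameter \<open>e\<close>
  tends to 0, and \<open>norm (F z)\<close> dominates.\<close>

lemma pos_def_integral:
  fixes F :: "'a::euclidean_space \<Rightarrow> complex"
  assumes F: "pos_def F" "Cc F"
  shows "(\<integral>z. F z \<partial>lborel) \<in> \<real>\<^sub>\<ge>\<^sub>0"
proof -
  have [measurable]: "F \<in> borel_measurable borel" using F(2) by (rule Cc_measurable)
  have "(\<lambda>n. \<integral>z. F z * of_real (exp (- ((inverse (real (Suc n)))\<^sup>2 * (norm z)\<^sup>2 / 4))) \<partial>lborel) \<longlonglongrightarrow> (\<integral>z. F z \<partial>lborel)"
  proof (rule integral_dominated_convergence[where w="\<lambda>z. norm (F z)"])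
    show "AE z in lborel. (\<lambda>n. F z * of_real (exp (- ((inverse (real (Suc n)))\<^sup>2 * (norm z)\<^sup>2 / 4)))) \<longlonglongrightarrow> F z"
    proof (intro always_eventually allI)
      fix z :: 'a
      have "(\<lambda>n. F z * of_real (exp (- ((inverse (real (Suc n)))\<^sup>2 * (norm z)\<^sup>2 / 4)))) \<longlonglongrightarrow> F z * of_real (exp (- (0\<^sup>2 * (norm z)\<^sup>2 / 4)))"
        by (intro tendsto_intros LIMSEQ_inverse_real_of_nat) auto
      then show "(\<lambda>n. F z * of_real (exp (- ((inverse (real (Suc n)))\<^sup>2 * (norm z)\<^sup>2 / 4)))) \<longlonglongrightarrow> F z" by simp
    qed
    show "AE z in lborel. norm (F z * of_real (exp (- ((inverse (real (Suc n)))\<^sup>2 * (norm z)\<^sup>2 / 4)))) \<le> norm (F z)" for n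
      by (intro always_eventually allI) (auto simp: norm_mult intro!: mult_left_le)
  qed (use F in \<open>auto intro: Cc_lborel integrable_norm\<close>)
  then show ?thesis
    using closed_sequentially[OF closed_nonneg_Reals_complex,
       of "\<lambda>n. \<integral>z. F z * of_real (exp (- ((inverse (real (Suc n)))\<^sup>2 * (norm z)\<^sup>2 / 4))) \<partial>lborel"]
      pos_def_gauss_integral[OF F] by simp
qed

lemma pos_def_fcheck:
  fixes F :: "'a::euclidean_space \<Rightarrow> complex"
  assumes F: "pos_def F" "Cc F"
  shows "fcheck F y \<in> \<real>\<^sub>\<ge>\<^sub>0"
  unfolding fcheck_def using assms
  by (intro pos_def_integral pos_def_modulate Cc_mult_cont) (auto intro!: continuous_intros)

text \<open>For the points \<open>x\<close>, 0 and the coefficients 1, \<open>\<i>\<close> the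
  quadratic form is 2 f(0) + i (f(-x) - f(x)), and its imaginary part must vanish.\<close>

lemma pos_def_even:
  assumes "pos_def (\<lambda>x. complex_of_real (f x))" shows "f (- x) = f x"
  using pos_defD[OF assms, where n=2 and c="\<lambda>i. if i = 0 then 1 else \<i>" and x="\<lambda>i. if i = 0 then x else 0"]
  by (simp add: numeral_2_eq_2 complex_nonneg_Reals_iff)

section \<open>Gaussian summability and Fourier inversion\<close>

lemma fourier_gker:
  fixes x :: "'a::euclidean_space"
  assumes s: "0 < s"
  shows "(\<integral>z. of_real (gker (s *\<^sub>R z)) * wave x z \<partial>lborel) = of_real (gauss (x /\<^sub>R s) / s ^ DIM('a))"
    and "integrable lborel (\<lambda>z::'a. gker (s *\<^sub>R z))"
proof -
  have g: "gker (s *\<^sub>R z) = sqrt (2 * pi) ^ DIM('a) * gauss ((2 * pi * s) *\<^sub>R z)" for z :: 'a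
    using s by (simp add: gker_def gauss_def power_mult_distrib mult_ac)
  show "integrable lborel (\<lambda>z::'a. gker (s *\<^sub>R z))"
    unfolding g using lborel_integrable_affine[OF integrable_gauss, of "2 * pi * s" 0] s
    by (intro integrable_mult_right) simp
  have "(\<integral>z. of_real (gauss z) * cis (z \<bullet> (x /\<^sub>R s)) \<partial>lborel)
    = of_real (2 * pi * s) ^ DIM('a) * (\<integral>z. of_real (gauss ((2 * pi * s) *\<^sub>R z)) * wave x z \<partial>lborel)"
  proof -
    have eq: "(0 + (2 * pi * s) *\<^sub>R z) \<bullet> (x /\<^sub>R s) = 2 * pi * (x \<bullet> z)" for z
      using s by (simp add: inner_commute)
    show ?thesis
      using s lborel_integral_affine[of "2 * pi * s" "\<lambda>z. of_real (gauss z) * cis (z \<bullet> (x /\<^sub>R s))" 0]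
      unfolding eq by (simp add: scaleR_conv_of_real)
  qed
  then have "(\<integral>z. of_real (gauss ((2 * pi * s) *\<^sub>R z)) * wave x z \<partial>lborel) = of_real (exp (- (norm (x /\<^sub>R s))\<^sup>2 / 2)) / of_real (2 * pi * s) ^ DIM('a)"
    using s unfolding fourier_gauss by (simp add: field_simps)
  moreover have "(\<integral>z. of_real (gker (s *\<^sub>R z)) * wave x z \<partial>lborel) = of_real (sqrt (2 * pi) ^ DIM('a)) * (\<integral>z. of_real (gauss ((2 * pi * s) *\<^sub>R z)) * wave x z \<partial>lborel)"
    unfolding g of_real_mult mult.assoc by (rule integral_mult_right_zero)
  ultimately have "(\<integral>z. of_real (gker (s *\<^sub>R z)) * wave x z \<partial>lborel)
     = of_real (sqrt (2 * pi) ^ DIM('a) * exp (- (norm (x /\<^sub>R s))\<^sup>2 / 2) / (2 * pi * s) ^ DIM('a))"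
    by simp
  also have "sqrt (2 * pi) ^ DIM('a) * exp (- (norm (x /\<^sub>R s))\<^sup>2 / 2) / (2 * pi * s) ^ DIM('a) = gauss (x /\<^sub>R s) / s ^ DIM('a)"
  proof -
    have "(2 * pi * s) ^ DIM('a) = sqrt (2 * pi) ^ DIM('a) * sqrt (2 * pi) ^ DIM('a) * s ^ DIM('a)"
    proof -
      have "2 * pi * s = sqrt (2 * pi) * sqrt (2 * pi) * s" by simp
      then show ?thesis by (metis power_mult_distrib)
    qed
    then show ?thesis using s by (simp add: gauss_def field_simps)
  qed
  finally show "(\<integral>z. of_real (gker (s *\<^sub>R z)) * wave x z \<partial>lborel) = of_real (gauss (x /\<^sub>R s) / s ^ DIM('a))" .
qed

text \<open>Fubini moves the transform from \<open>F\<close> to the Gaussian factor, where it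
  produces a normal density of width \<open>s\<close> centred at \<open>x\<close>; then substitute
  \<open>t = x + s *\<^sub>R r\<close>.\<close>

lemma gauss_summability:
  fixes F :: "'a::euclidean_space \<Rightarrow> complex"
  assumes F: "integrable lborel F" and s: "0 < s"
  shows "(\<integral>z. of_real (gker (s *\<^sub>R z)) * cnj (wave x z) * fcheck F z \<partial>lborel) = (\<integral>r. F (x + s *\<^sub>R r) * of_real (gauss r) \<partial>lborel)"
proof -
  define g where "g z = of_real (gker (s *\<^sub>R z)) * cnj (wave x z)" for z
  have gi: "integrable lborel g"
    unfolding g_def using integrable_of_real[OF fourier_gker(2)[OF s]] by (rule integrable_mult_bounded[where B=1]) auto
  have "(\<integral>z. g z * fcheck F z \<partial>lborel) = (\<integral>t. F t * (\<integral>z. g z * wave t z \<partial>lborel) \<partial>lborel)"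
    unfolding fcheck_def by (rule Fubini_wave[symmetric]) (use gi F in \<open>auto intro: sigma_finite_lborel\<close>)
  also have "\<dots> = (\<integral>t. F t * of_real (gauss ((t - x) /\<^sub>R s) / s ^ DIM('a)) \<partial>lborel)"
  proof (rule Bochner_Integration.integral_cong[OF refl arg_cong2[where f=times, OF refl]])
    fix t
    have "g z * wave t z = of_real (gker (s *\<^sub>R z)) * wave (t - x) z" for z
      unfolding g_def wave_diff by (simp add: mult_ac)
    then show "(\<integral>z. g z * wave t z \<partial>lborel) = of_real (gauss ((t - x) /\<^sub>R s) / s ^ DIM('a))"
      unfolding fourier_gker(1)[OF s, symmetric] by presburger
  qed
  also have "\<dots> = (\<integral>r. F (x + s *\<^sub>R r) * of_real (gauss r) \<partial>lborel)"
  proof -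
    have eq: "F (x + s *\<^sub>R r) * of_real (gauss ((x + s *\<^sub>R r - x) /\<^sub>R s) / s ^ DIM('a))
      = F (x + s *\<^sub>R r) * of_real (gauss r) / of_real (s ^ DIM('a))" for r
      using s by simp
    show ?thesis
      using s lborel_integral_affine[of s "\<lambda>t. F t * of_real (gauss ((t - x) /\<^sub>R s) / s ^ DIM('a))" x]
      unfolding eq integral_divide_zero by (simp add: scaleR_conv_of_real)
  qed
  finally show ?thesis by (simp add: g_def mult.assoc)
qed

lemma gker_scaled_tendsto: "(\<lambda>n. gker (inverse (real (Suc n)) *\<^sub>R z)) \<longlonglongrightarrow> 1"
proof -
  have "(\<lambda>n. gker (inverse (real (Suc n)) *\<^sub>R z)) \<longlonglongrightarrow> exp (- 2 * pi\<^sup>2 * (norm (0 *\<^sub>R z))\<^sup>2)"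
    unfolding gker_def by (intro tendsto_intros LIMSEQ_inverse_real_of_nat)
  then show ?thesis by simp
qed

text \<open>At \<open>x = 0\<close> the Gaussian means of the transform are averages of
  \<open>F\<close>, so they are bounded by the supremum of |F|. Since the transform is nonnegative,
  they are also Gaussian means of its absolute value, and Fatou's lemma removes the
  Gaussian.\<close>

lemma fcheck_integrable_nonneg:
  fixes F :: "'a::euclidean_space \<Rightarrow> complex"
  assumes F: "Cc F" and nn: "\<And>y. fcheck F y \<in> \<real>\<^sub>\<ge>\<^sub>0"
  shows "integrable lborel (fcheck F)"
proof -
  obtain B where B: "\<And>x. norm (F x) \<le> B" using Cc_bounded[OF F] by metis
  have Fi: "integrable lborel F" using F by (rule Cc_lborel)
  have [measurable]: "fcheck F \<in> borel_measurable borel" "F \<in> borel_measurable borel"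
    using fcheck_measurable[OF Fi] Fi by auto
  let ?e = "\<lambda>n. inverse (real (Suc n))"
  have nrm: "fcheck F z = of_real (norm (fcheck F z))" for z
    using nn[of z] by (simp add: nonneg_Reals_def)  (metis abs_of_nonneg nn nonneg_Reals_cases norm_of_real)
  have le: "(\<integral>\<^sup>+z. ennreal (gker (?e n *\<^sub>R z) * norm (fcheck F z)) \<partial>lborel) \<le> ennreal B" for n
  proof -
    have i: "integrable lborel (\<lambda>z. gker (?e n *\<^sub>R z) * norm (fcheck F z))"
    proof -
      have "integrable lborel (\<lambda>z. of_real (gker (?e n *\<^sub>R z)) * fcheck F z)"
        by (rule integrable_mult_bounded[OF integrable_of_real[OF fourier_gker(2)]]) (use fcheck_norm_le[of F] in auto)
      from integrable_norm[OF this] show ?thesis by (simp add: norm_mult gker_def)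
    qed
    have "of_real (\<integral>z. gker (?e n *\<^sub>R z) * norm (fcheck F z) \<partial>lborel) = (\<integral>z. of_real (gker (?e n *\<^sub>R z)) * fcheck F z \<partial>lborel)"
      using nrm by (simp flip: integral_complex_of_real)
    also have "\<dots> = (\<integral>r. F (?e n *\<^sub>R r) * of_real (gauss r) \<partial>lborel)"
      using gauss_summability[OF Fi, of "?e n" 0] by simp
    finally have eq: "of_real (\<integral>z. gker (?e n *\<^sub>R z) * norm (fcheck F z) \<partial>lborel) = (\<integral>r. F (?e n *\<^sub>R r) * of_real (gauss r) \<partial>lborel)" .
    have "(\<integral>z. gker (?e n *\<^sub>R z) * norm (fcheck F z) \<partial>lborel) \<le> norm (complex_of_real (\<integral>z. gker (?e n *\<^sub>R z) * norm (fcheck F z) \<partial>lborel))"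
      by simp
    also have "\<dots> \<le> (\<integral>r. norm (F (?e n *\<^sub>R r) * of_real (gauss r)) \<partial>lborel)"
      unfolding eq by (rule integral_norm_bound)
    also have "\<dots> \<le> (\<integral>r. B * gauss (r::'a) \<partial>lborel)"
    proof (rule integral_mono)
      show "integrable lborel (\<lambda>r. norm (F (?e n *\<^sub>R r) * of_real (gauss r)))"
        unfolding mult.commute[of "F _"] using B by (intro integrable_norm integrable_mult_bounded[OF integrable_of_real[OF integrable_gauss]]) auto
      show "integrable lborel (\<lambda>r::'a. B * gauss r)" by (intro integrable_mult_right integrable_gauss)
      fix r :: 'a
      show "norm (F (?e n *\<^sub>R r) * of_real (gauss r)) \<le> B * gauss r"
        using B gauss_pos[of r] by (simp add: norm_mult mult_right_mono)
    qed
    also have "\<dots> = B" by (simp add: integral_gauss)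
    finally have "(\<integral>z. gker (?e n *\<^sub>R z) * norm (fcheck F z) \<partial>lborel) \<le> B" .
    then show ?thesis
      by (subst nn_integral_eq_integral[OF i]) (auto simp: gker_def intro: ennreal_leI)
  qed
  have "(\<integral>\<^sup>+z. ennreal (norm (fcheck F z)) \<partial>lborel) = (\<integral>\<^sup>+z. liminf (\<lambda>n. ennreal (gker (?e n *\<^sub>R z) * norm (fcheck F z))) \<partial>lborel)"
  proof (intro nn_integral_cong)
    fix z :: 'a
    have "(\<lambda>n. ennreal (gker (?e n *\<^sub>R z) * norm (fcheck F z))) \<longlonglongrightarrow> ennreal (1 * norm (fcheck F z))"
      by (intro tendsto_ennrealI tendsto_mult gker_scaled_tendsto tendsto_const)
    then show "ennreal (norm (fcheck F z)) = liminf (\<lambda>n. ennreal (gker (?e n *\<^sub>R z) * norm (fcheck F z)))"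
      using lim_imp_Liminf[of sequentially "\<lambda>n. ennreal (gker (?e n *\<^sub>R z) * norm (fcheck F z))"] by simp
  qed
  also have "\<dots> \<le> liminf (\<lambda>n. \<integral>\<^sup>+z. ennreal (gker (?e n *\<^sub>R z) * norm (fcheck F z)) \<partial>lborel)"
    by (intro nn_integral_liminf) measurable
  also have "\<dots> \<le> ennreal B"
  proof -
    have "liminf (\<lambda>n. \<integral>\<^sup>+z. ennreal (gker (?e n *\<^sub>R z) * norm (fcheck F z)) \<partial>lborel) \<le> liminf (\<lambda>n. ennreal B)"
      by (intro Liminf_mono always_eventually allI le)
    also have "\<dots> = ennreal B" by (rule Liminf_const) simp
    finally show ?thesis .
  qed
  finally have "(\<integral>\<^sup>+z. ennreal (norm (fcheck F z)) \<partial>lborel) < \<infinity>"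
    by (rule le_less_trans) simp
  then show ?thesis by (simp add: integrable_iff_bounded)
qed

lemma gauss_mean_tendsto:
  fixes F :: "'a::euclidean_space \<Rightarrow> complex"
  assumes F: "Cc F"
  shows "(\<lambda>n. \<integral>r. F (x + inverse (real (Suc n)) *\<^sub>R r) * of_real (gauss r) \<partial>lborel) \<longlonglongrightarrow> F x"
proof -
  let ?e = "\<lambda>n. inverse (real (Suc n))"
  obtain B where B: "\<And>x. norm (F x) \<le> B" using Cc_bounded[OF F] by metis
  have [measurable]: "F \<in> borel_measurable borel" using F by (rule Cc_measurable)
  have "(\<lambda>n. \<integral>r. F (x + ?e n *\<^sub>R r) * of_real (gauss r) \<partial>lborel) \<longlonglongrightarrow> (\<integral>r. F x * of_real (gauss (r::'a)) \<partial>lborel)"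
  proof (rule integral_dominated_convergence[where w="\<lambda>r. B * gauss r"])
    show "AE r in lborel. (\<lambda>n. F (x + ?e n *\<^sub>R r) * of_real (gauss r)) \<longlonglongrightarrow> F x * of_real (gauss r)"
    proof (intro always_eventually allI tendsto_mult tendsto_const)
      fix r
      have "(\<lambda>n. x + ?e n *\<^sub>R r) \<longlonglongrightarrow> x + 0 *\<^sub>R r" by (intro tendsto_intros LIMSEQ_inverse_real_of_nat)
      then show "(\<lambda>n. F (x + ?e n *\<^sub>R r)) \<longlonglongrightarrow> F x"
        using continuous_on_tendsto_compose[OF Cc_cont[OF F]] by fastforce
    qed
    show "AE r in lborel. norm (F (x + ?e n *\<^sub>R r) * of_real (gauss r)) \<le> B * gauss r" for n
      using B by (intro always_eventually allI)
        (simp add: norm_mult mult_right_mono abs_of_pos[OF gauss_pos] less_imp_le[OF gauss_pos])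
  qed (auto intro!: integrable_mult_right integrable_gauss)
  then show ?thesis
    by (simp add: integral_gauss)
qed

text \<open>Both sides are limits of the same Gaussian means: the averages of \<open>F\<close>
  around \<open>x\<close> converge by continuity, the means of the transform by its
  integrability.\<close>

lemma fourier_inversion:
  fixes F :: "'a::euclidean_space \<Rightarrow> complex"
  assumes F: "Cc F" and i: "integrable lborel (fcheck F)"
  shows "F x = (\<integral>z. fcheck F z * cnj (wave x z) \<partial>lborel)"
proof (rule LIMSEQ_unique)
  let ?e = "\<lambda>n. inverse (real (Suc n))"
  have Fi: "integrable lborel F" using F by (rule Cc_lborel)
  have [measurable]: "fcheck F \<in> borel_measurable borel" "F \<in> borel_measurable borel"
    using fcheck_measurable[OF Fi] Fi by auto
  show "(\<lambda>n. \<integral>r. F (x + ?e n *\<^sub>R r) * of_real (gauss r) \<partial>lborel) \<longlonglongrightarrow> F x"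
    by (rule gauss_mean_tendsto[OF F])
  have "(\<lambda>n. \<integral>z. of_real (gker (?e n *\<^sub>R z)) * cnj (wave x z) * fcheck F z \<partial>lborel) \<longlonglongrightarrow> (\<integral>z. fcheck F z * cnj (wave x z) \<partial>lborel)"
  proof (rule integral_dominated_convergence[where w="\<lambda>z. norm (fcheck F z)"])
    show "AE z in lborel. (\<lambda>n. of_real (gker (?e n *\<^sub>R z)) * cnj (wave x z) * fcheck F z) \<longlonglongrightarrow> fcheck F z * cnj (wave x z)"
    proof (intro always_eventually allI)
      fix z
      have "(\<lambda>n. of_real (gker (?e n *\<^sub>R z)) * cnj (wave x z) * fcheck F z) \<longlonglongrightarrow> of_real 1 * cnj (wave x z) * fcheck F z"
        by (intro tendsto_mult tendsto_of_real gker_scaled_tendsto tendsto_const)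
      then show "(\<lambda>n. of_real (gker (?e n *\<^sub>R z)) * cnj (wave x z) * fcheck F z) \<longlonglongrightarrow> fcheck F z * cnj (wave x z)"
        by (simp add: mult.commute)
    qed
    show "AE z in lborel. norm (of_real (gker (?e n *\<^sub>R z)) * cnj (wave x z) * fcheck F z) \<le> norm (fcheck F z)" for n
      by (intro always_eventually allI) (auto simp: norm_mult gker_def intro!: mult_left_le_one_le)
  qed (use i in auto)
  then show "(\<lambda>n. \<integral>r. F (x + ?e n *\<^sub>R r) * of_real (gauss r) \<partial>lborel) \<longlonglongrightarrow> (\<integral>z. fcheck F z * cnj (wave x z) \<partial>lborel)"
    by (subst (asm) gauss_summability[OF Fi]) auto
qed

subsection \<open>Uniqueness of Fourier transforms\<close>

lemma Cc_conv_plateau: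
  fixes F :: "'a::euclidean_space \<Rightarrow> complex"
  assumes F: "Cc F" "(\<integral>x. F x \<partial>lborel) = 1"
  obtains a :: "'a \<Rightarrow> complex" where "Cc a" "\<And>x. x \<in> fsupp F \<Longrightarrow> conv a F x = 1"
proof -
  obtain r where r: "\<And>x. x \<in> fsupp F \<Longrightarrow> norm x \<le> r"
    using compact_imp_bounded[OF Cc_compact[OF F(1)]] unfolding bounded_iff by metis
  \<comment> \<open>Two points of the support of \<open>F\<close> differ by at most
    \<open>2 * r\<close>, and \<open>a\<close> is 1 up to that distance. So for \<open>x\<close> in
    the support the convolution reduces to the integral of \<open>F\<close>.\<close>
  define a where "a x = complex_of_real (max 0 (min 1 (2 * r + 1 - norm x)))" for x :: 'a
  have "Cc a" unfolding a_def
    by (rule CcI[of _ "cball 0 (2 * r + 1)"]) (auto intro!: continuous_intros)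
  moreover have "conv a F x = 1" if x: "x \<in> fsupp F" for x
  proof -
    have "a (x - y) * F y = F y" for y
    proof (cases "y \<in> fsupp F")
      case True
      then have "norm (x - y) \<le> 2 * r" using r[OF x] r[of y] norm_triangle_ineq4[of x y] by simp
      then show ?thesis by (simp add: a_def)
    qed (use not_in_fsupp[of y F] in simp)
    then show ?thesis unfolding conv_def using F(2) by presburger
  qed
  ultimately show ?thesis by (rule that)
qed

text \<open>Replace \<open>F x\<close> by its inversion integral and integrate over \<open>x\<close>
  first. Only \<open>F\<close>, not \<open>\<phi>\<close>, must have an integrable
  transform.\<close>

lemma fcheck_mult:
  fixes F :: "'a::euclidean_space \<Rightarrow> complex"
  assumes F: "Cc F" "integrable lborel (fcheck F)" and \<phi>: "Cc \<phi>"
  shows "fcheck (\<lambda>x. F x * \<phi> x) y = (\<integral>z. fcheck F z * fcheck \<phi> (y - z) \<partial>lborel)"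
proof -
  have "fcheck (\<lambda>x. F x * \<phi> x) y = (\<integral>x. (\<phi> x * wave x y) * (\<integral>z. fcheck F z * cnj (wave x z) \<partial>lborel) \<partial>lborel)"
    unfolding fcheck_def[of "\<lambda>x. F x * \<phi> x"] fourier_inversion[OF F, symmetric] by (simp add: mult_ac)
  also have "\<dots> = (\<integral>z. fcheck F z * (\<integral>x. (\<phi> x * wave x y) * cnj (wave x z) \<partial>lborel) \<partial>lborel)"
    by (rule Fubini_kernel[OF sigma_finite_lborel sigma_finite_lborel integrable_mult_bounded[OF Cc_lborel[OF \<phi>], where B=1] F(2), where B=1])
       simp_all
  also have "\<dots> = (\<integral>z. fcheck F z * fcheck \<phi> (y - z) \<partial>lborel)"
    unfolding fcheck_def[of \<phi>] wave_diff(2) by (simp add: mult.assoc)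
  finally show ?thesis .
qed

text \<open>Modulating \<open>a\<close> shifts its transform by \<open>z\<close> and leaves |a|,
  hence the bound, unchanged. This gives uniformity in \<open>z\<close>.\<close>

lemma fourier_L2_bound_shift:
  assumes a: "Cc a" and S: "\<And>f. Cc f \<Longrightarrow>
    (\<integral>\<^sup>+y. ennreal ((cmod (fcheck f y))\<^sup>2) \<partial>N) \<le> ennreal (S * (\<integral>x. (cmod (f x))\<^sup>2 / gauss x \<partial>lborel))"
  shows "(\<integral>\<^sup>+y. ennreal ((cmod (fcheck a (y - z)))\<^sup>2) \<partial>N) \<le> ennreal (S * (\<integral>x. (cmod (a x))\<^sup>2 / gauss x \<partial>lborel))"
proof -
  have "Cc (\<lambda>x. a x * wave x (- z))"
    using a by (rule Cc_mult_cont) (intro continuous_intros)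
  from S[OF this] show ?thesis
    unfolding fcheck_modulate by (simp add: norm_mult)
qed

text \<open>With \<open>\<phi> = conv a F\<close> equal to 1 on the support of \<open>F\<close>, the
  identity F = F \<phi> becomes a convolution of \<open>fcheck F\<close> with
  \<open>fcheck a * fcheck F\<close>. The first factor is Lebesgue integrable by positivity; the
  \<open>N\<close>-integrals of all translates of the second are bounded by two square integrals,
  uniformly in the shift. Integrating over \<open>N\<close> first finishes the proof.\<close>

lemma pos_def_fcheck_integrable:
  fixes F :: "'a::euclidean_space \<Rightarrow> complex"
  assumes N: "translation_bounded N C" and F: "Cc F" "pos_def F" "(\<integral>x. F x \<partial>lborel) = 1"
  shows "integrable N (fcheck F)"
proof -
  obtain S where S: "\<And>f. Cc f \<Longrightarrow>
    (\<integral>\<^sup>+y. ennreal ((cmod (fcheck f y))\<^sup>2) \<partial>N) \<le> ennreal (S * (\<integral>x. (cmod (f x))\<^sup>2 / gauss x \<partial>lborel))"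
    using fourier_L2_bound[OF N] by metis
  obtain a where a: "Cc a" "\<And>x. x \<in> fsupp F \<Longrightarrow> conv a F x = 1" using Cc_conv_plateau[OF F(1,3)] by metis
  have Fi: "integrable lborel (fcheck F)"
    using F pos_def_fcheck by (intro fcheck_integrable_nonneg) auto
  note [measurable_cong] = locally_finite_sets[OF translation_bounded_locally_finite[OF N]]
  interpret N: sigma_finite_measure N
    using N translation_bounded_locally_finite locally_finite_sigma_finite by blast
  interpret pair_sigma_finite lborel N ..
  have [measurable]: "fcheck F \<in> borel_measurable borel" "fcheck a \<in> borel_measurable borel"
    using F a by (auto intro: fcheck_measurable Cc_lborel)
  let ?\<phi> = "conv a F"
  have \<phi>: "Cc ?\<phi>" using a F by (intro Cc_conv)
  have "F x * ?\<phi> x = F x" for x using a(2)[of x] not_in_fsupp[of x F] by (cases "x \<in> fsupp F") auto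
  then have F\<phi>: "(\<lambda>x. F x * ?\<phi> x) = F" by blast
  have rep: "fcheck F y = (\<integral>z. fcheck F z * fcheck ?\<phi> (y - z) \<partial>lborel)" for y
    using fcheck_mult[OF F(1) Fi \<phi>, of y] unfolding F\<phi> .
  \<comment> \<open>The cut-off at 0 makes the values nonnegative, so that \<open>ennreal\<close>
    respects the sum \<open>Q a + Q F\<close>.\<close>
  define Q where "Q g = max 0 (S * (\<integral>x. (cmod (g x))\<^sup>2 / gauss x \<partial>lborel))" for g :: "'a \<Rightarrow> complex"
  have Q: "(\<integral>\<^sup>+y. ennreal ((cmod (fcheck g (y - z)))\<^sup>2) \<partial>N) \<le> ennreal (Q g)" if "Cc g" for g z
    unfolding Q_def by (rule order_trans[OF fourier_L2_bound_shift[OF that S] ennreal_leI]) auto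
  have Q0: "0 \<le> Q g" for g by (simp add: Q_def)
  have conv_bd: "(\<integral>\<^sup>+y. ennreal (norm (fcheck ?\<phi> (y - z))) \<partial>N) \<le> ennreal (Q a + Q F)" for z
  proof -
    have "(\<integral>\<^sup>+y. ennreal (norm (fcheck ?\<phi> (y - z))) \<partial>N)
      \<le> (\<integral>\<^sup>+y. ennreal ((cmod (fcheck a (y - z)))\<^sup>2) + ennreal ((cmod (fcheck F (y - z)))\<^sup>2) \<partial>N)"
    proof (intro nn_integral_mono)
      fix y
      let ?u = "cmod (fcheck a (y - z))" and ?v = "cmod (fcheck F (y - z))"
      have "2 * (?u * ?v) \<le> ?u\<^sup>2 + ?v\<^sup>2" using zero_le_power2[of "?u - ?v"] by (simp add: power2_eq_square algebra_simps)
      moreover have "0 \<le> ?u * ?v" by simp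
      ultimately have "?u * ?v \<le> ?u\<^sup>2 + ?v\<^sup>2" by linarith
      then show "ennreal (norm (fcheck ?\<phi> (y - z))) \<le> ennreal (?u\<^sup>2) + ennreal (?v\<^sup>2)"
        using a F by (subst fcheck_conv) (auto simp: norm_mult Cc_lborel simp flip: ennreal_plus intro!: ennreal_leI)
    qed
    also have "\<dots> = (\<integral>\<^sup>+y. ennreal ((cmod (fcheck a (y - z)))\<^sup>2) \<partial>N) + (\<integral>\<^sup>+y. ennreal ((cmod (fcheck F (y - z)))\<^sup>2) \<partial>N)"
      by (intro nn_integral_add) measurable
    also have "\<dots> \<le> ennreal (Q a) + ennreal (Q F)" by (intro add_mono Q a F)
    finally show ?thesis using Q0 by (simp flip: ennreal_plus)
  qed
  have [measurable]: "fcheck ?\<phi> \<in> borel_measurable borel" using \<phi> by (intro fcheck_measurable Cc_lborel)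
  have "(\<integral>\<^sup>+y. ennreal (norm (fcheck F y)) \<partial>N) \<le> (\<integral>\<^sup>+y. (\<integral>\<^sup>+z. ennreal (norm (fcheck F z)) * ennreal (norm (fcheck ?\<phi> (y - z))) \<partial>lborel) \<partial>N)"
  proof (intro nn_integral_mono)
    fix y
    have "ennreal (norm (\<integral>z. fcheck F z * fcheck ?\<phi> (y - z) \<partial>lborel)) \<le> (\<integral>\<^sup>+z. norm (fcheck F z * fcheck ?\<phi> (y - z)) \<partial>lborel)"
      by (cases "integrable lborel (\<lambda>z. fcheck F z * fcheck ?\<phi> (y - z))")
         (auto intro: integral_norm_bound_ennreal simp: not_integrable_integral_eq)
    then show "ennreal (norm (fcheck F y)) \<le> (\<integral>\<^sup>+z. ennreal (norm (fcheck F z)) * ennreal (norm (fcheck ?\<phi> (y - z))) \<partial>lborel)"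
      by (subst rep) (simp add: norm_mult ennreal_mult)
  qed
  also have "\<dots> = (\<integral>\<^sup>+z. (\<integral>\<^sup>+y. ennreal (norm (fcheck F z)) * ennreal (norm (fcheck ?\<phi> (y - z))) \<partial>N) \<partial>lborel)"
    by (rule Fubini') measurable
  also have "\<dots> = (\<integral>\<^sup>+z. ennreal (norm (fcheck F z)) * (\<integral>\<^sup>+y. ennreal (norm (fcheck ?\<phi> (y - z))) \<partial>N) \<partial>lborel)"
    by (intro nn_integral_cong nn_integral_cmult) measurable
  also have "\<dots> \<le> (\<integral>\<^sup>+z. ennreal (norm (fcheck F z)) * ennreal (Q a + Q F) \<partial>lborel)"
    by (intro nn_integral_mono mult_left_mono conv_bd) auto
  also have "\<dots> = (\<integral>\<^sup>+z. ennreal (norm (fcheck F z)) \<partial>lborel) * ennreal (Q a + Q F)"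
    by (intro nn_integral_multc) measurable
  also have "\<dots> < \<infinity>"
    using Fi by (simp add: integrable_iff_bounded ennreal_mult_less_top)
  finally show ?thesis by (simp add: integrable_iff_bounded)
qed

section \<open>A finite complex measure with vanishing transform\<close>

lemma fourier_zero_Cc:
  fixes M :: "'a::euclidean_space measure"
  assumes M: "finite_measure M" "sets M = sets borel" and g: "integrable M g"
    and zero: "\<And>x. (\<integral>y. g y * wave x y \<partial>M) = 0" and \<phi>: "Cc \<phi>"
  shows "(\<integral>y. g y * \<phi> y \<partial>M) = 0"
proof (rule LIMSEQ_unique)
  interpret finite_measure M by fact
  have sf: "sigma_finite_measure M" ..
  note [measurable_cong] = M(2)
  let ?e = "\<lambda>n. inverse (real (Suc n))"
  obtain B where B: "\<And>x. norm (\<phi> x) \<le> B" using Cc_bounded[OF \<phi>] by metis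
  have [measurable]: "\<phi> \<in> borel_measurable borel" "g \<in> borel_measurable M"
    using \<phi> g by (auto intro: Cc_measurable)
  define \<Phi> where "\<Phi> s y = (\<integral>r. \<phi> (y + s *\<^sub>R r) * of_real (gauss r) \<partial>lborel)" for s y
  have [measurable]: "\<Phi> s \<in> borel_measurable borel" for s unfolding \<Phi>_def by measurable
  have bd: "norm (\<phi> x * of_real (gauss r)) \<le> B * gauss r" for x r
    using B by (simp add: norm_mult mult_right_mono abs_of_pos[OF gauss_pos] less_imp_le[OF gauss_pos])
  have gi: "integrable lborel (\<lambda>r. B * gauss (r::'a))" by (intro integrable_mult_right integrable_gauss)
  have \<Phi>_lim: "(\<lambda>n. \<Phi> (?e n) y) \<longlonglongrightarrow> \<phi> y" for y
    unfolding \<Phi>_def by (rule gauss_mean_tendsto[OF \<phi>])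
  have \<Phi>_bd: "norm (\<Phi> s y) \<le> B" for s y
  proof -
    have "norm (\<Phi> s y) \<le> (\<integral>r. norm (\<phi> (y + s *\<^sub>R r) * of_real (gauss r)) \<partial>lborel)"
      unfolding \<Phi>_def by (rule integral_norm_bound)
    also have "\<dots> \<le> (\<integral>r. B * gauss (r::'a) \<partial>lborel)"
      by (rule integral_mono[OF integrable_norm[OF Bochner_Integration.integrable_bound[OF gi]] gi])
         (use bd in \<open>auto intro: order_trans[OF bd abs_ge_self] always_eventually\<close>)
    finally show ?thesis by (simp add: integral_gauss)
  qed
  show "(\<lambda>n. \<integral>y. g y * \<Phi> (?e n) y \<partial>M) \<longlonglongrightarrow> (\<integral>y. g y * \<phi> y \<partial>M)"
  proof (rule integral_dominated_convergence[where w="\<lambda>y. B * norm (g y)"])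
    show "AE y in M. norm (g y * \<Phi> (?e n) y) \<le> B * norm (g y)" for n
      using \<Phi>_bd unfolding mult.commute[of B] by (intro always_eventually allI) (simp add: norm_mult mult_left_mono)
  qed (use \<Phi>_lim g in \<open>auto intro!: tendsto_mult always_eventually\<close>)
  \<comment> \<open>The averaging kernel is a superposition of characters with integrable
    coefficients, so testing \<open>g\<close> against it gives 0 by \<open>zero\<close>. As
    \<open>s\<close> tends to 0 the averages of \<open>\<phi>\<close> return to
    \<open>\<phi>\<close>.\<close>
  have "(\<integral>y. g y * \<Phi> s y \<partial>M) = 0" if s: "0 < s" for s
  proof -
    define k where "k y z = complex_of_real (gauss ((y - z) /\<^sub>R s) / s ^ DIM('a))" for y z :: 'a
    have \<Phi>k: "\<Phi> s y = (\<integral>z. \<phi> z * k y z \<partial>lborel)" for y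
    proof -
      have eq: "\<phi> (y + s *\<^sub>R r) * k y (y + s *\<^sub>R r) = \<phi> (y + s *\<^sub>R r) * of_real (gauss r) / of_real (s ^ DIM('a))" for r
        using s gauss_minus[of r] by (simp add: k_def)
      show ?thesis
        using s lborel_integral_affine[of s "\<lambda>z. \<phi> z * k y z" y]
        unfolding eq integral_divide_zero by (simp add: scaleR_conv_of_real \<Phi>_def)
    qed
    have gz: "(\<integral>y. g y * k y z \<partial>M) = 0" for z
    proof -
      define q where "q w = of_real (gker (s *\<^sub>R w)) * cnj (wave z w)" for w
      have qi: "integrable lborel q"
        unfolding q_def using integrable_of_real[OF fourier_gker(2)[OF s]] by (rule integrable_mult_bounded[where B=1]) auto
      have "(\<integral>y. g y * k y z \<partial>M) = (\<integral>y. g y * (\<integral>w. q w * wave w y \<partial>lborel) \<partial>M)"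
      proof (rule Bochner_Integration.integral_cong[OF refl arg_cong2[where f=times, OF refl]])
        fix y
        have "q w * wave w y = of_real (gker (s *\<^sub>R w)) * wave (y - z) w" for w
          unfolding q_def wave_diff by (simp add: mult_ac inner_commute)
        then show "k y z = (\<integral>w. q w * wave w y \<partial>lborel)"
          unfolding k_def fourier_gker(1)[OF s, symmetric] by presburger
      qed
      also have "\<dots> = (\<integral>w. q w * (\<integral>y. g y * wave w y \<partial>M) \<partial>lborel)"
        by (rule Fubini_wave[symmetric]) (use sf M qi g in \<open>auto intro: sigma_finite_lborel\<close>)
      finally show ?thesis by (simp add: zero)
    qed
    have km: "(\<lambda>(x, y). k x y) \<in> borel_measurable (M \<Otimes>\<^sub>M lborel)"
      unfolding k_def by measurable
    have kb: "norm (k y z) \<le> (1 / sqrt (2 * pi) ^ DIM('a)) / s ^ DIM('a)" for y z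
      using s unfolding k_def norm_of_real by (simp add: abs_of_pos gauss_pos) (simp add: gauss_def divide_right_mono)
    have "(\<integral>y. g y * \<Phi> s y \<partial>M) = (\<integral>z. \<phi> z * (\<integral>y. g y * k y z \<partial>M) \<partial>lborel)"
      unfolding \<Phi>k by (rule Fubini_kernel[OF sf sigma_finite_lborel g Cc_lborel[OF \<phi>] km kb])
    then show ?thesis by (simp add: gz)
  qed
  then show "(\<lambda>n. \<integral>y. g y * \<Phi> (?e n) y \<partial>M) \<longlonglongrightarrow> 0" by simp
qed

text \<open>Truncated multiples of the distance to the complement lie in C_c and increase to the
  indicator, because each point of an open box has positive distance from the complement.\<close>

lemma integral_box_zero:
  fixes M :: "'a::euclidean_space measure"
  assumes M: "sets M = sets borel" and g: "integrable M (g :: 'a \<Rightarrow> complex)"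
    and zero: "\<And>\<phi>::'a \<Rightarrow> complex. Cc \<phi> \<Longrightarrow> (\<integral>y. g y * \<phi> y \<partial>M) = 0"
  shows "(\<integral>y. g y * of_real (indicator (box a b) y) \<partial>M) = 0"
proof (rule LIMSEQ_unique)
  note [measurable_cong] = M
  have [measurable]: "g \<in> borel_measurable M" using g by auto
  let ?D = "- box a b"
  \<comment> \<open>\<open>infdist\<close> from the empty set is 0 by convention, so the complement
    must be nonempty; it is, because a box is bounded.\<close>
  have D: "closed ?D" "?D \<noteq> {}"
  proof -
    have "box a b \<noteq> UNIV" using bounded_box[of a b] not_bounded_UNIV by metis
    then show "?D \<noteq> {}" by blast
    show "closed ?D" by (auto intro: open_box)
  qed
  define \<phi> where "\<phi> n x = complex_of_real (min 1 (real n * infdist x ?D))" for n x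
  have \<phi>c: "Cc (\<phi> n)" for n
  proof (rule CcI[of _ "cbox a b"])
    fix x assume "x \<notin> cbox a b"
    then have "x \<in> ?D" using box_subset_cbox by blast
    then show "\<phi> n x = 0" by (simp add: \<phi>_def)
  qed (auto simp: \<phi>_def intro!: continuous_intros)
  have [measurable]: "\<phi> n \<in> borel_measurable borel" for n using \<phi>c by (rule Cc_measurable)
  have lim: "(\<lambda>n. \<phi> n x) \<longlonglongrightarrow> of_real (indicator (box a b) x)" for x
  proof (cases "x \<in> box a b")
    case True
    then have pos: "0 < infdist x ?D" using D by (intro infdist_pos_not_in_closed) auto
    obtain n0 where n0: "1 \<le> real n0 * infdist x ?D"
      using reals_Archimedean3[OF pos, rule_format, of 1] by (auto intro: less_imp_le)
    have "\<forall>\<^sub>F n in sequentially. \<phi> n x = 1"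
    proof (rule eventually_sequentiallyI[of n0])
      fix n assume "n0 \<le> n"
      then have "1 \<le> real n * infdist x ?D" using n0 pos
        by (meson mult_right_mono of_nat_mono order_trans less_imp_le)
      then show "\<phi> n x = 1" by (simp add: \<phi>_def)
    qed
    then show ?thesis using True by (simp add: tendsto_eventually)
  next
    case False
    then show ?thesis by (simp add: \<phi>_def)
  qed
  show "(\<lambda>n. \<integral>y. g y * \<phi> n y \<partial>M) \<longlonglongrightarrow> (\<integral>y. g y * of_real (indicator (box a b) y) \<partial>M)"
  proof (rule integral_dominated_convergence[where w="\<lambda>y. norm (g y)"])
    have "norm (\<phi> n y) \<le> 1" for n y by (simp add: \<phi>_def infdist_nonneg)
    then show "AE y in M. norm (g y * \<phi> n y) \<le> norm (g y)" for n
      by (intro always_eventually allI) (simp add: norm_mult mult_left_le)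
  qed (use lim g in \<open>auto intro!: tendsto_mult always_eventually\<close>)
  show "(\<lambda>n. \<integral>y. g y * \<phi> n y \<partial>M) \<longlonglongrightarrow> 0" by (simp add: zero \<phi>c)
qed

text \<open>It suffices that \<open>g\<close> integrates to 0 over every Borel set, which is then
  applied to its real and imaginary parts. Boxes form a generator closed under intersection;
  complements also need the total integral, which is the transform at 0.\<close>

lemma fourier_unique:
  fixes M :: "'a::euclidean_space measure"
  assumes M: "finite_measure M" "sets M = sets borel" and g: "integrable M g"
    and zero: "\<And>x. (\<integral>y. g y * wave x y \<partial>M) = 0"
  shows "AE y in M. g y = 0"
proof -
  note [measurable_cong] = M(2)
  have [measurable]: "g \<in> borel_measurable M" using g by auto
  have sp: "space M = UNIV" using sets_eq_imp_space_eq[OF M(2)] by simp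
  let ?E = "range (\<lambda>(a, b). box a b::'a set)"
  have si: "set_integrable M A g" if "A \<in> sets M" for A
    using integrable_mult_indicator[OF that g] by (simp add: set_integrable_def)
  have "(LINT y:A|M. g y) = 0" if "A \<in> sets M" for A
  proof -
    have "Int_stable ?E" by (auto simp: Int_stable_def box_Int_box)
    moreover have "?E \<subseteq> Pow UNIV" by simp
    moreover have "A \<in> sigma_sets UNIV ?E" using that M(2) by (simp add: borel_eq_box)
    ultimately show ?thesis
    proof (induction rule: sigma_sets_induct_disjoint)
      case (basic A)
      then obtain a b where "A = box a b" by auto
      then show ?case
        using integral_box_zero[OF M(2) g fourier_zero_Cc[OF M g zero], of a b]
        by (simp add: set_lebesgue_integral_def scaleR_conv_of_real mult.commute)
    next
      case (compl A)
      then have A[measurable]: "A \<in> sets M" using M(2) by (simp add: borel_eq_box)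
      have "(LINT y:A|M. g y) + (LINT y:(UNIV - A)|M. g y) = (LINT y:(A \<union> (UNIV - A))|M. g y)"
        using A sp by (intro set_integral_Un[symmetric] si) auto
      also have "\<dots> = (\<integral>y. g y \<partial>M)" by (simp add: set_lebesgue_integral_def)
      also have "\<dots> = 0" using zero[of 0] by simp
      finally show ?case using compl by simp
    next
      case (union A)
      then have A: "range A \<subseteq> sets M" using M(2) by (auto simp: borel_eq_box)
      have "(LINT y:(\<Union>i. A i)|M. g y) = (\<Sum>i. LINT y:A i|M. g y)"
        using A union by (intro lebesgue_integral_countable_add si) (auto simp: disjoint_family_on_def)
      then show ?case using union by simp
    qed (simp add: set_lebesgue_integral_def)
  qed
  note z = this
  have "AE y in M. Re (g y) = 0" "AE y in M. Im (g y) = 0"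
  proof -
    have "(LINT y:A|M. Re (g y)) = 0" "(LINT y:A|M. Im (g y)) = 0" if A: "A \<in> sets M" for A
    proof -
      have i: "integrable M (\<lambda>y. indicator A y *\<^sub>R g y)" using si[OF A] by (simp add: set_integrable_def)
      show "(LINT y:A|M. Re (g y)) = 0"
        using integral_Re[OF i] z[OF A] by (simp add: set_lebesgue_integral_def)
      show "(LINT y:A|M. Im (g y)) = 0"
        using integral_Im[OF i] z[OF A] by (simp add: set_lebesgue_integral_def)
    qed
    then show "AE y in M. Re (g y) = 0" "AE y in M. Im (g y) = 0"
      using g by (auto intro!: density_unique_real[of M _ "\<lambda>_. 0"])
  qed
  then show ?thesis by eventually_elim (simp add: complex_eq_iff)
qed

subsection \<open>Gluing finite measures\<close>

text \<open>A weighted sum of the \<open>N n\<close>. The weights include one plus the mass in the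
  denominator, so the sum is finite however fast the masses grow; they are positive, so a null set
  of the sum is null for each \<open>N n\<close>.\<close>

lemma dominating_finite_measure:
  fixes N :: "nat \<Rightarrow> 'a::euclidean_space measure"
  assumes fin: "\<And>n. finite_measure (N n)" and sets: "\<And>n. sets (N n) = sets borel"
  obtains \<rho> where "finite_measure \<rho>" "sets \<rho> = sets borel" "\<And>n. absolutely_continuous \<rho> (N n)"
proof -
  define w where "w n = (1/2) ^ Suc n / (1 + measure (N n) UNIV)" for n
  have w: "0 < w n" for n unfolding w_def by (intro divide_pos_pos) (auto intro: add_pos_nonneg)
  have sp: "space (N n) = UNIV" for n using sets_eq_imp_space_eq[OF sets] by simp
  define K where "K n = density (N n) (\<lambda>_. ennreal (w n))" for n
  have KA: "emeasure (K n) A = ennreal (w n) * emeasure (N n) A" if "A \<in> sets borel" for A n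
    using that sets by (simp add: K_def emeasure_density_const)
  have Ks: "sets (K n) = sets borel" for n using sets by (simp add: K_def)
  have KU: "emeasure (K n) UNIV \<le> ennreal ((1/2) ^ Suc n)" for n
  proof -
    interpret finite_measure "N n" by (rule fin)
    have "w n * measure (N n) UNIV \<le> (1/2) ^ Suc n"
    proof -
      have "measure (N n) UNIV / (1 + measure (N n) UNIV) \<le> 1"
        by (rule divide_le_eq_1_pos[THEN iffD2]) (simp_all add: add_pos_nonneg)
      from mult_left_mono[OF this, of "(1/2) ^ Suc n"] show ?thesis by (simp add: w_def)
    qed
    then have "ennreal (w n) * ennreal (measure (N n) UNIV) \<le> ennreal ((1/2) ^ Suc n)"
      using w[of n] by (simp only: ennreal_mult[symmetric] less_imp_le measure_nonneg) (rule ennreal_leI)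
    then show ?thesis by (subst KA) (auto simp: emeasure_eq_measure)
  qed
  have K[measurable]: "K \<in> measurable (count_space UNIV) (subprob_algebra borel)"
  proof (rule measurable_count_space_eq1[THEN iffD2], safe)
    fix n
    have "(1/2::real) ^ Suc n \<le> 1" by (rule power_le_one) auto
    then have "ennreal ((1/2) ^ Suc n) \<le> 1" using ennreal_leI[of "(1/2) ^ Suc n" 1] by (simp only: ennreal_1)
    with KU[of n] have "emeasure (K n) UNIV \<le> 1" by (rule order_trans)
    then have "emeasure (K n) (space (K n)) \<le> 1"
      using sets_eq_imp_space_eq[OF Ks[of n]] by simp
    then have "subprob_space (K n)" using sets_eq_imp_space_eq[OF Ks[of n]] by (intro subprob_spaceI) auto
    then show "K n \<in> space (subprob_algebra borel)" using Ks by (simp add: space_subprob_algebra)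
  qed
  \<comment> \<open>Binding over the counting measure on the naturals is a countable sum of
    measures; the weights make each \<open>K n\<close> a subprobability, as \<open>bind\<close>
    requires.\<close>
  define \<rho> where "\<rho> = bind (count_space UNIV) K"
  have \<rho>s: "sets \<rho> = sets borel" unfolding \<rho>_def by (rule sets_bind) (auto simp: Ks)
  have em: "emeasure \<rho> A = (\<Sum>n. emeasure (K n) A)" if "A \<in> sets borel" for A
    unfolding \<rho>_def using that by (subst emeasure_bind[OF _ K]) (auto simp: nn_integral_count_space_nat)
  show ?thesis
  proof (rule that[OF _ \<rho>s])
    have "emeasure \<rho> UNIV \<le> (\<Sum>n. ennreal ((1/2) ^ Suc n))"
      by (subst em, simp) (rule suminf_le[OF KU], auto)
    also have "\<dots> = ennreal (\<Sum>n. (1/2) ^ Suc n)"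
      using power_half_series by (intro suminf_ennreal2) (auto dest: sums_summable)
    also have "\<dots> < \<infinity>" by simp
    finally show "finite_measure \<rho>"
      using sets_eq_imp_space_eq[OF \<rho>s] by (intro finite_measureI) simp
    fix n
    show "absolutely_continuous \<rho> (N n)"
      unfolding absolutely_continuous_def
    proof
      fix A assume "A \<in> null_sets \<rho>"
      then have A: "A \<in> sets borel" "emeasure \<rho> A = 0" using \<rho>s by auto
      have "emeasure (K n) A \<le> (\<Sum>n. emeasure (K n) A)"
        using sum_le_suminf[of "\<lambda>n. emeasure (K n) A" "{n}"] by simp
      then have "ennreal (w n) * emeasure (N n) A = 0" using A em KA by simp
      then show "A \<in> null_sets (N n)" using A sets w[of n] by (auto simp: null_sets_def ennreal_eq_0_iff)
    qed
  qed
qed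

text \<open>Let \<open>g n\<close> be the density of the n-th complex measure with respect to a
  common \<open>\<rho>\<close>. Uniqueness turns \<open>eq\<close> into c_m g_n = c_n g_m almost
  everywhere, for all pairs at once as there are countably many. At each point some
  \<open>c k\<close> is positive, so g_n = c_n G with G = g_k / c_k, and the zeros of the other
  \<open>c n\<close> do no harm. The total variation of the glued measure is |G| times
  \<open>\<rho>\<close>.\<close>

lemma glue_measures:
  fixes N :: "nat \<Rightarrow> 'a::euclidean_space measure" and h :: "nat \<Rightarrow> 'a \<Rightarrow> complex" and c :: "nat \<Rightarrow> 'a \<Rightarrow> real"
  assumes fin: "\<And>n. finite_measure (N n)" and sets: "\<And>n. sets (N n) = sets borel"
    and hm: "\<And>n. h n \<in> borel_measurable borel" and h1: "\<And>n y. norm (h n y) = 1"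
    and cm: "\<And>n. c n \<in> borel_measurable borel" and c0: "\<And>n y. 0 \<le> c n y" and c1: "\<And>n y. c n y \<le> 1"
    and clim: "\<And>y. (\<lambda>n. c n y) \<longlonglongrightarrow> 1"
    and eq: "\<And>n m x. (\<integral>y. of_real (c m y) * h n y * wave x y \<partial>N n) = (\<integral>y. of_real (c n y) * h m y * wave x y \<partial>N m)"
    and C: "0 < C" and bd: "\<And>n t. emeasure (N n) (cball t 1) \<le> ennreal C"
  obtains M H where "translation_bounded M C" "H \<in> borel_measurable borel" "\<And>y. norm (H y) = 1"
    "\<And>n \<phi>. \<phi> \<in> borel_measurable borel \<Longrightarrow> (\<integral>y. \<phi> y * h n y \<partial>N n) = (\<integral>y. \<phi> y * of_real (c n y) * H y \<partial>M)"
proof -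
  note [measurable] = hm cm
  obtain \<rho> where \<rho>: "finite_measure \<rho>" and \<rho>s[measurable_cong]: "sets \<rho> = sets borel" and ac: "\<And>n. absolutely_continuous \<rho> (N n)"
    using dominating_finite_measure[of N] fin sets by metis
  interpret \<rho>: finite_measure \<rho> by fact
  have "\<exists>D. D \<in> borel_measurable borel \<and> (\<forall>x. 0 \<le> D x) \<and> N n = density \<rho> (\<lambda>x. ennreal (D x))" for n
  proof -
    obtain D where D: "D \<in> borel_measurable \<rho>" "AE x in \<rho>. RN_deriv \<rho> (N n) x = ennreal (D x)" "\<And>x. 0 \<le> D x"
      using \<rho>.real_RN_deriv[OF fin ac] sets \<rho>s by metis
    have "N n = density \<rho> (RN_deriv \<rho> (N n))"
      using \<rho>.density_RN_deriv[OF ac] sets \<rho>s by simp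
    also have "\<dots> = density \<rho> (\<lambda>x. ennreal (D x))"
      using D by (intro density_cong) auto
    finally have "N n = density \<rho> (\<lambda>x. ennreal (D x))" .
    moreover have "D \<in> borel_measurable borel" using D(1) \<rho>s measurable_cong_sets by blast
    ultimately show ?thesis using D(3) by blast
  qed
  then obtain D where Dm[measurable]: "\<And>n. D n \<in> borel_measurable borel" and D0: "\<And>n x. 0 \<le> D n x"
    and D: "\<And>n. N n = density \<rho> (\<lambda>x. ennreal (D n x))" by metis
  have ND: "(\<integral>y. \<phi> y \<partial>N n) = (\<integral>y. of_real (D n y) * \<phi> y \<partial>\<rho>)" if [measurable]: "\<phi> \<in> borel_measurable borel" for \<phi> :: "'a \<Rightarrow> complex" and n
    unfolding D by (subst integral_density) (auto simp: D0 scaleR_conv_of_real)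
  define g where "g n y = of_real (D n y) * h n y" for n y
  have gm[measurable]: "g n \<in> borel_measurable borel" for n unfolding g_def by measurable
  have ng: "norm (g n y) = D n y" for n y by (simp add: g_def norm_mult h1 D0)
  have gi: "integrable \<rho> (g n)" for n
  proof -
    interpret N: finite_measure "N n" by (rule fin)
    have "(\<integral>\<^sup>+y. ennreal (norm (g n y)) \<partial>\<rho>) = emeasure (N n) (space (N n))"
      unfolding ng by (simp add: D emeasure_density)
    then show ?thesis by (auto simp: integrable_iff_bounded less_top[symmetric])
  qed
  have "AE y in \<rho>. of_real (c m y) * g n y = of_real (c n y) * g m y" for n m
  proof -
    have cgi: "integrable \<rho> (\<lambda>y. g n y * of_real (c m y))" for n m
      by (rule integrable_mult_bounded[OF gi, where B=1]) (auto simp: c0 c1)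
    have wi: "integrable \<rho> (\<lambda>y. (g n y * of_real (c m y)) * wave x y)" for n m x
      by (rule integrable_mult_bounded[OF cgi, where B=1]) auto
    have 1: "(\<integral>y. (g n y * of_real (c m y)) * wave x y \<partial>\<rho>) = (\<integral>y. of_real (c m y) * h n y * wave x y \<partial>N n)" for n m x
      by (subst ND) (auto simp: g_def mult_ac)
    have "AE y in \<rho>. g n y * of_real (c m y) - g m y * of_real (c n y) = 0"
    proof (rule fourier_unique[OF \<rho> \<rho>s])
      show "integrable \<rho> (\<lambda>y. g n y * of_real (c m y) - g m y * of_real (c n y))"
        by (intro Bochner_Integration.integrable_diff cgi)
      fix x
      show "(\<integral>y. (g n y * of_real (c m y) - g m y * of_real (c n y)) * wave x y \<partial>\<rho>) = 0"
        unfolding left_diff_distrib Bochner_Integration.integral_diff[OF wi wi] 1 eq[of m n] by simp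
    qed
    then show ?thesis by eventually_elim (simp add: mult.commute)
  qed
  then have AE1: "AE y in \<rho>. \<forall>n m. of_real (c m y) * g n y = of_real (c n y) * g m y"
    by (simp add: AE_all_countable)
  \<comment> \<open>Since \<open>c n\<close> tends to 1, the quotient g_k / c_k is also the limit of
    \<open>g n\<close>. As a limit it is measurable, and no index \<open>k\<close> depending on the
    point has to be chosen.\<close>
  define G where "G y = lim (\<lambda>n. g n y)" for y
  have Gm[measurable]: "G \<in> borel_measurable borel" unfolding G_def by measurable
  have AE2: "AE y in \<rho>. (\<forall>n. g n y = of_real (c n y) * G y) \<and> (\<lambda>n. g n y) \<longlonglongrightarrow> G y"
    using AE1
  proof eventually_elim
    case (elim y)
    have "\<forall>\<^sub>F n in sequentially. 0 < c n y" using clim[of y] by (rule order_tendstoD) simp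
    then obtain k where k: "0 < c k y" by (meson eventually_happens sequentially_bot)
    have gk: "g n y = of_real (c n y) * (g k y / of_real (c k y))" for n
      using elim[rule_format, of k n] k by (simp add: field_simps)
    have "(\<lambda>n. of_real (c n y) * (g k y / of_real (c k y))) \<longlonglongrightarrow> of_real 1 * (g k y / of_real (c k y))"
      by (intro tendsto_mult tendsto_of_real clim tendsto_const)
    then have l: "(\<lambda>n. g n y) \<longlonglongrightarrow> g k y / of_real (c k y)"
      unfolding gk[symmetric] by simp
    then have Gy: "G y = g k y / of_real (c k y)" unfolding G_def by (rule limI)
    show ?case unfolding Gy using gk l by blast
  qed
  define M where "M = density \<rho> (\<lambda>y. ennreal (norm (G y)))"
  \<comment> \<open>\<open>is_cmeasure\<close> asks for modulus 1 at every point. The value 1 at the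
    zeros of \<open>G\<close> is arbitrary, as these form a null set for \<open>M\<close>.\<close>
  define H where "H y = (if y \<in> G -` {0} then 1 else G y / of_real (norm (G y)))" for y
  have Hm[measurable]: "H \<in> borel_measurable borel"
    unfolding H_def using measurable_sets_borel[OF Gm, of "{0}"]
    by (intro measurable_If_set) auto
  have GH: "of_real (norm (G y)) * H y = G y" for y by (simp add: H_def)
  have Ms: "sets M = sets borel" by (simp add: M_def \<rho>s)
  show ?thesis
  proof (rule that[OF _ Hm])
    show "norm (H y) = 1" for y by (simp add: H_def norm_divide)
    have "emeasure M (cball t 1) \<le> ennreal C" for t
    proof -
      have [measurable]: "cball t 1 \<in> sets borel" by simp
      have "emeasure M (cball t 1) = (\<integral>\<^sup>+y. ennreal (norm (G y)) * indicator (cball t 1) y \<partial>\<rho>)"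
        unfolding M_def by (subst emeasure_density) (auto simp: \<rho>s)
      also have "\<dots> = (\<integral>\<^sup>+y. liminf (\<lambda>n. ennreal (D n y) * indicator (cball t 1) y) \<partial>\<rho>)"
      proof (rule nn_integral_cong_AE)
        show "AE y in \<rho>. ennreal (norm (G y)) * indicator (cball t 1) y = liminf (\<lambda>n. ennreal (D n y) * indicator (cball t 1) y)"
          using AE2
        proof eventually_elim
          case (elim y)
          then have "(\<lambda>n. norm (g n y)) \<longlonglongrightarrow> norm (G y)" by (intro tendsto_norm) auto
          then have "(\<lambda>n. ennreal (D n y)) \<longlonglongrightarrow> ennreal (norm (G y))" unfolding ng by (rule tendsto_ennrealI)
          then have "(\<lambda>n. ennreal (D n y) * indicator (cball t 1) y) \<longlonglongrightarrow> ennreal (norm (G y)) * indicator (cball t 1) y"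
            by (cases "y \<in> cball t 1") auto
          then show ?case
            by (intro lim_imp_Liminf[symmetric]) auto
        qed
      qed
      also have "\<dots> \<le> liminf (\<lambda>n. \<integral>\<^sup>+y. ennreal (D n y) * indicator (cball t 1) y \<partial>\<rho>)"
        by (intro nn_integral_liminf) measurable
      also have "\<dots> = liminf (\<lambda>n. emeasure (N n) (cball t 1))"
        unfolding D by (subst emeasure_density) (auto simp: \<rho>s)
      also have "\<dots> \<le> liminf (\<lambda>n. ennreal C)"
        by (intro Liminf_mono always_eventually allI bd)
      also have "\<dots> = ennreal C" by (rule Liminf_const) simp
      finally show ?thesis .
    qed
    then show "translation_bounded M C" using C Ms by (simp add: translation_bounded_def)
    fix n and \<phi> :: "'a \<Rightarrow> complex" assume [measurable]: "\<phi> \<in> borel_measurable borel"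
    have "(\<integral>y. \<phi> y * h n y \<partial>N n) = (\<integral>y. \<phi> y * g n y \<partial>\<rho>)"
      by (subst ND) (auto simp: g_def mult_ac)
    also have "\<dots> = (\<integral>y. of_real (norm (G y)) * (\<phi> y * of_real (c n y) * H y) \<partial>\<rho>)"
    proof (rule integral_cong_AE)
      show "AE y in \<rho>. \<phi> y * g n y = of_real (norm (G y)) * (\<phi> y * of_real (c n y) * H y)"
        using AE2
      proof eventually_elim
        case (elim y)
        then have "\<phi> y * g n y = \<phi> y * of_real (c n y) * (of_real (norm (G y)) * H y)"
          unfolding GH by (simp add: mult.assoc)
        then show ?case by (simp only: mult_ac)
      qed
    qed measurable
    also have "\<dots> = (\<integral>y. \<phi> y * of_real (c n y) * H y \<partial>M)"
      unfolding M_def by (subst integral_density) (auto simp: scaleR_conv_of_real)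
    finally show "(\<integral>y. \<phi> y * h n y \<partial>N n) = (\<integral>y. \<phi> y * of_real (c n y) * H y \<partial>M)" .
  qed
qed

subsection \<open>Convolution with the approximate identity\<close>

lemma norm_cis_diff_le: "norm (cis a - cis b) \<le> \<bar>a - b\<bar>"
proof -
  have "cis a - cis b = cis b * (cis (a - b) - 1)" by (simp add: algebra_simps cis_mult)
  then have "norm (cis a - cis b) = norm (cis (a - b) - 1)" by (simp add: norm_mult)
  also have "\<dots> \<le> \<bar>a - b\<bar>" using iexp_approx1[of "a - b" 0] by (simp add: cis_conv_exp)
  finally show ?thesis .
qed

lemma cmeasure_locally_finite: "is_cmeasure mu \<Longrightarrow> locally_finite (fst mu)"
  by (simp add: is_cmeasure_def locally_finite_def)

lemma cmeasure_phase: "is_cmeasure mu \<Longrightarrow> snd mu \<in> borel_measurable borel" "is_cmeasure mu \<Longrightarrow> norm (snd mu x) = 1"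
  by (simp_all add: is_cmeasure_def)

lemma conv_norm_le:
  assumes "Cc g" "\<And>x. norm (f x) \<le> B"
  shows "norm (conv f g x) \<le> B * (\<integral>y. norm (g y) \<partial>lborel)"
proof -
  have "norm (conv f g x) \<le> (\<integral>y. norm (f (x - y) * g y) \<partial>lborel)"
    unfolding conv_def by (rule integral_norm_bound)
  also have "\<dots> \<le> (\<integral>y. B * norm (g y) \<partial>lborel)"
  proof (rule integral_mono')
    show "integrable lborel (\<lambda>y. B * norm (g y))"
      using assms(1) by (intro integrable_mult_right integrable_norm Cc_lborel)
    fix y
    show "norm (f (x - y) * g y) \<le> B * norm (g y)"
      unfolding norm_mult by (intro mult_right_mono assms) simp
    show "0 \<le> B * norm (g y)" using order_trans[OF norm_ge_zero assms(2)] by simp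
  qed
  finally show ?thesis by simp
qed

lemma conv_translate: "conv (\<lambda>t. f (t - x)) g = (\<lambda>z. conv f g (z - x))"
  by (simp add: conv_def fun_eq_iff algebra_simps)

lemma fcheck_translate': "fcheck (\<lambda>t. f (t - x)) = (\<lambda>y. wave x y * fcheck f y)"
  by (rule ext) (rule fcheck_translate)

lemma conv_fcheck_abs2:
  assumes "Cc f" shows "fcheck (conv f (tilde f)) y = complex_of_real ((cmod (fcheck f y))\<^sup>2)"
  using assms complex_norm_square[of "fcheck f y"]
  by (subst fcheck_conv) (simp_all add: Cc_lborel Cc_tilde fcheck_tilde del: of_real_power)

lemma Cc_translate:
  fixes f :: "'a::euclidean_space \<Rightarrow> complex"
  assumes "Cc f" shows "Cc (\<lambda>x. f (x - t))"
  using Cc_affine[OF assms, of 1 "-t"] by simp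

text \<open>Evenness replaces \<open>F (x - y)\<close> by \<open>F (y - x)\<close>, so after Fubini
  the inner integral is \<open>conv \<phi> F y\<close>. The measure may be infinite, so again an
  indicator of a compact set carrying the integrand is inserted.\<close>

lemma integral_conv_meas:
  fixes \<phi> F :: "'a::euclidean_space \<Rightarrow> complex"
  assumes M: "locally_finite M" and h: "h \<in> borel_measurable borel" "\<And>y. norm (h y) = 1"
    and \<phi>: "Cc \<phi>" and F: "Cc F" and ev: "\<And>x. F (- x) = F x"
  shows "(\<integral>x. \<phi> x * (\<integral>y. F (x - y) * h y \<partial>M) \<partial>lborel) = (\<integral>y. conv \<phi> F y * h y \<partial>M)"
proof -
  note [measurable_cong] = locally_finite_sets[OF M]
  note [measurable] = h(1)
  have [measurable]: "F \<in> borel_measurable borel" using F by (rule Cc_measurable)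
  obtain B where B: "\<And>x. norm (F x) \<le> B" using Cc_bounded[OF F] by metis
  let ?S = "{x + y | x y. x \<in> fsupp \<phi> \<and> y \<in> fsupp F}"
  have S: "compact ?S" using \<phi> F by (intro compact_sums Cc_compact)
  then have [measurable]: "?S \<in> sets borel" by (rule borel_compact)
  define I where "I y = complex_of_real (indicator ?S y)" for y
  have I: "y \<in> ?S \<Longrightarrow> I y = 1" "y \<notin> ?S \<Longrightarrow> I y = 0" for y by (simp_all only: I_def indicator_simps of_real_1 of_real_0 simp_thms)
  have "integrable M (indicator ?S :: 'a \<Rightarrow> real)"
    using locally_finite_compact[OF M S] by (intro integrable_real_indicator) auto
  then have "integrable M I" unfolding I_def[abs_def] by (rule integrable_of_real)
  then have Ih: "integrable M (\<lambda>y. I y * h y)"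
    by (rule integrable_mult_bounded[where B=1]) (auto simp: h)
  have "(\<integral>x. \<phi> x * (\<integral>y. F (x - y) * h y \<partial>M) \<partial>lborel) = (\<integral>x. \<phi> x * (\<integral>y. (I y * h y) * F (x - y) \<partial>M) \<partial>lborel)"
  proof (rule Bochner_Integration.integral_cong[OF refl])
    fix x
    have *: "F (x - y) * h y = (I y * h y) * F (x - y)" if "\<phi> x \<noteq> 0" for y
    proof (cases "F (x - y) = 0")
      case False
      then have "F (y - x) \<noteq> 0" using ev[of "y - x"] by simp
      then have "x \<in> fsupp \<phi>" "y - x \<in> fsupp F"
        using that not_in_fsupp[of x \<phi>] not_in_fsupp[of "y - x" F] by auto
      moreover have "y = x + (y - x)" by simp
      ultimately have "y \<in> ?S" by blast
      then show ?thesis using I(1) by simp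
    qed simp
    show "\<phi> x * (\<integral>y. F (x - y) * h y \<partial>M) = \<phi> x * (\<integral>y. (I y * h y) * F (x - y) \<partial>M)"
    proof (cases "\<phi> x = 0")
      case False show ?thesis unfolding *[OF False] ..
    qed simp
  qed
  also have "\<dots> = (\<integral>y. (I y * h y) * (\<integral>x. \<phi> x * F (x - y) \<partial>lborel) \<partial>M)"
    by (rule Fubini_kernel[OF sigma_finite_lborel locally_finite_sigma_finite[OF M] Cc_lborel[OF \<phi>] Ih _ B]) measurable
  also have "\<dots> = (\<integral>y. conv \<phi> F y * h y \<partial>M)"
  proof (rule Bochner_Integration.integral_cong[OF refl])
    fix y
    have "F (x - y) = F (y - x)" for x using ev[of "y - x"] by simp
    then have "(\<integral>x. \<phi> x * F (x - y) \<partial>lborel) = conv F \<phi> y"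
      by (simp add: conv_def mult.commute)
    then have e: "(\<integral>x. \<phi> x * F (x - y) \<partial>lborel) = conv \<phi> F y" by (simp add: conv_commute)
    show "(I y * h y) * (\<integral>x. \<phi> x * F (x - y) \<partial>lborel) = conv \<phi> F y * h y"
    proof (cases "y \<in> ?S")
      case True show ?thesis unfolding e I(1)[OF True] by simp
    next
      case False show ?thesis unfolding e I(2)[OF False] conv_eq_0[OF False] by simp
    qed
  qed
  finally show ?thesis .
qed

text \<open>Moves the transform from \<open>nu\<close> to \<open>\<phi>\<close>, so that an identity
  of densities can be tested through \<open>fcheck \<phi>\<close>.\<close>

lemma integral_mcheck:
  assumes nu: "is_cmeasure nu" "finite_cmeasure nu" and \<phi>: "Cc \<phi>"
  shows "(\<integral>x. \<phi> x * mcheck nu x \<partial>lborel) = (\<integral>y. fcheck \<phi> y * snd nu y \<partial>fst nu)"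
proof -
  have lf: "locally_finite (fst nu)" using nu by (intro cmeasure_locally_finite)
  note [measurable_cong] = locally_finite_sets[OF lf]
  note [measurable] = cmeasure_phase(1)[OF nu(1)]
  have "space (fst nu) = UNIV" using sets_eq_imp_space_eq[OF locally_finite_sets[OF lf]] by simp
  then interpret finite_measure "fst nu"
    using nu by (intro finite_measureI) (simp add: finite_cmeasure_def tvar_def)
  have hi: "integrable (fst nu) (snd nu)"
    using cmeasure_phase(2)[OF nu(1)] by (intro integrable_const_bound[where B=1]) auto
  have "(\<integral>x. \<phi> x * mcheck nu x \<partial>lborel) = (\<integral>x. \<phi> x * (\<integral>y. snd nu y * wave x y \<partial>fst nu) \<partial>lborel)"
    by (simp add: mcheck_def cint_def mult.commute)
  also have "\<dots> = (\<integral>y. snd nu y * (\<integral>x. \<phi> x * wave x y \<partial>lborel) \<partial>fst nu)"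
    by (rule Fubini_wave) (use locally_finite_sigma_finite[OF lf] locally_finite_sets[OF lf] hi \<phi> in
        \<open>auto intro: sigma_finite_lborel Cc_lborel\<close>)
  finally show ?thesis by (simp add: fcheck_def mult.commute)
qed

section \<open>The approximate identity and its transforms\<close>

locale pos_def_approx_identity =
  fixes f :: "nat \<Rightarrow> 'a::euclidean_space \<Rightarrow> real" and K :: "'a set"
  assumes approx: "approx_identity (\<lambda>n x. complex_of_real (f n x))"
    and Kc: "compact K"
    and fCc: "\<And>n. Cc (f n)"
    and fsupp: "\<And>n. fsupp (f n) \<subseteq> K"
    and fnonneg: "\<And>n x. f n x \<ge> 0"
    and fint: "\<And>n. (\<integral>x. f n x \<partial>lborel) = 1"
    and fpd: "\<And>n. pos_def (\<lambda>x. complex_of_real (f n x))"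
begin

definition fc :: "nat \<Rightarrow> 'a \<Rightarrow> complex" where "fc n x = complex_of_real (f n x)"

text \<open>The transform of \<open>fc n\<close> is a nonnegative real, so the real part loses
  nothing and can serve as a density.\<close>

definition fhat :: "nat \<Rightarrow> 'a \<Rightarrow> real" where "fhat n y = Re (fcheck (fc n) y)"

lemma fc_eq: "fc n = (\<lambda>x. complex_of_real (f n x))" by (simp add: fc_def fun_eq_iff)

lemma fc_outside: "x \<notin> K \<Longrightarrow> fc n x = 0"
  using not_in_fsupp[of x "f n"] fsupp[of n] by (auto simp: fc_def)

lemma Cc_fc: "Cc (fc n)"
  by (rule CcI[OF _ Kc]) (use Cc_cont[OF fCc] in \<open>auto simp: fc_outside\<close>, auto simp: fc_def intro!: continuous_intros)

lemma fsupp_fc: "fsupp (fc n) \<subseteq> K"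
  unfolding fsupp_def using fc_outside Kc by (intro closure_minimal) (auto intro: compact_imp_closed)

lemma integral_fc: "(\<integral>x. fc n x \<partial>lborel) = 1"
  unfolding fc_def by (simp add: integral_complex_of_real fint)

lemma integral_norm_fc: "(\<integral>x. norm (fc n x) \<partial>lborel) = 1"
  using fint[of n] by (simp add: fc_def fnonneg)

lemma pos_def_fc: "pos_def (fc n)" unfolding fc_eq by (rule fpd)

lemma fc_even: "fc n (- x) = fc n x"
  unfolding fc_def using pos_def_even[OF fpd] by simp

lemma fcheck_fc: "fcheck (fc n) y = of_real (fhat n y)"
  using pos_def_fcheck[OF pos_def_fc Cc_fc, of n y] by (simp add: fhat_def complex_nonneg_Reals_iff complex_eq_iff)

lemma fhat_nonneg: "0 \<le> fhat n y"
  using pos_def_fcheck[OF pos_def_fc Cc_fc, of n y] by (simp add: fhat_def complex_nonneg_Reals_iff)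

lemma fhat_le_1: "fhat n y \<le> 1"
  using fcheck_norm_le[of "fc n" y] by (simp add: fcheck_fc integral_norm_fc)

lemma continuous_fhat: "continuous_on UNIV (fhat n)"
  unfolding fhat_def[abs_def] by (intro continuous_intros continuous_fcheck Cc_lborel Cc_fc)

lemma fhat_measurable [measurable]: "fhat n \<in> borel_measurable borel"
  by (rule borel_measurable_continuous_onI) (rule continuous_fhat)

lemma conv_fc_uniform_limit:
  assumes "Cu g" shows "uniform_limit UNIV (\<lambda>n. conv (fc n) g) g sequentially"
  using assms approx unfolding approx_identity_def fc_eq by blast

text \<open>A character is bounded and Lipschitz, hence in C_u. Evaluated at 0, its convolution with
  \<open>fc n\<close> is exactly \<open>fcheck (fc n) y\<close>, while the character itself is 1
  there.\<close>

lemma fhat_tendsto: "(\<lambda>n. fhat n y) \<longlonglongrightarrow> 1"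
proof -
  define g where "g x = wave x (- y)" for x
  have "uniformly_continuous_on UNIV g"
  proof -
    have "\<bar>2 * pi * (x \<bullet> (- y)) - 2 * pi * (x' \<bullet> (- y))\<bar> \<le> 2 * pi * norm y * dist x x'" for x x'
    proof -
      have "2 * pi * (x \<bullet> (- y)) - 2 * pi * (x' \<bullet> (- y)) = - 2 * pi * ((x - x') \<bullet> y)"
        by (simp add: algebra_simps)
      then show ?thesis using mult_left_mono[OF Cauchy_Schwarz_ineq2[of "x - x'" y], of "2 * pi"]
        by (simp add: abs_mult dist_norm mult_ac)
    qed
    then have "norm (g x - g x') \<le> 2 * pi * norm y * dist x x'" for x x'
      unfolding g_def by (rule order_trans[OF norm_cis_diff_le])
    then show ?thesis
      by (intro lipschitz_on_uniformly_continuous[of "2 * pi * norm y"] lipschitz_onI) (auto simp: dist_norm)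
  qed
  moreover have "bounded (range g)" unfolding bounded_iff by (intro exI[of _ 1]) (auto simp: g_def)
  ultimately have "uniform_limit UNIV (\<lambda>n. conv (fc n) g) g sequentially"
    by (intro conv_fc_uniform_limit) (simp add: Cu_def)
  then have "(\<lambda>n. conv (fc n) g 0) \<longlonglongrightarrow> g 0" by (rule tendsto_uniform_limitI) simp
  moreover have "conv (fc n) g 0 = fcheck (fc n) y" for n
  proof -
    have "conv (fc n) g 0 = (\<integral>t. fc n (0 - t) * g t \<partial>lborel)" by (simp add: conv_def)
    also have "\<dots> = (\<integral>t. fc n (0 - (0 - t)) * g (0 - t) \<partial>lborel)"
      by (rule lborel_integral_reflect[symmetric])
    also have "\<dots> = fcheck (fc n) y" by (simp add: fcheck_def g_def)
    finally show ?thesis .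
  qed
  ultimately have "(\<lambda>n. Re (fcheck (fc n) y)) \<longlonglongrightarrow> Re (g 0)" by (intro tendsto_Re) simp
  then show ?thesis by (simp add: fhat_def g_def)
qed

text \<open>The common support \<open>K\<close> is essential here: all \<open>conv F (fc n)\<close>
  live on one compact set and are bounded by the supremum of |F|, which gives an integrable majorant
  for a measure that is only locally finite.\<close>

lemma conv_fc_limit:
  assumes M: "locally_finite M" and h: "h \<in> borel_measurable borel" "\<And>y. norm (h y) = 1" and F: "Cc F"
  shows "(\<lambda>n. \<integral>x. conv F (fc n) x * h x \<partial>M) \<longlonglongrightarrow> (\<integral>x. F x * h x \<partial>M)"
proof -
  note [measurable_cong] = locally_finite_sets[OF M]
  note [measurable] = h(1)
  obtain B where B: "0 < B" "\<And>x. norm (F x) \<le> B" using Cc_bounded[OF F] by metis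
  let ?S = "{x + y | x y. x \<in> fsupp F \<and> y \<in> K}"
  have S: "compact ?S" using F Kc by (intro compact_sums Cc_compact)
  then have [measurable]: "?S \<in> sets borel" by (rule borel_compact)
  have [measurable]: "F \<in> borel_measurable borel" "conv F (fc n) \<in> borel_measurable borel" for n
    using F Cc_fc by (auto intro!: Cc_measurable Cc_conv)
  show ?thesis
  proof (rule integral_dominated_convergence[where w="\<lambda>x. B * indicator ?S x"])
    show "integrable M (\<lambda>x. B * indicator ?S x)"
      using locally_finite_compact[OF M S] by (intro integrable_mult_right integrable_real_indicator) auto
    show "AE x in M. (\<lambda>n. conv F (fc n) x * h x) \<longlonglongrightarrow> F x * h x"
    proof (intro always_eventually allI tendsto_mult tendsto_const)
      fix x
      show "(\<lambda>n. conv F (fc n) x) \<longlonglongrightarrow> F x"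
        using tendsto_uniform_limitI[OF conv_fc_uniform_limit[OF Cc_Cu[OF F]], of x] by (simp add: conv_commute)
    qed
    fix n
    show "AE x in M. norm (conv F (fc n) x * h x) \<le> B * indicator ?S x"
    proof (intro always_eventually allI)
      fix x
      show "norm (conv F (fc n) x * h x) \<le> B * indicator ?S x"
      proof (cases "x \<in> ?S")
        case True
        then have i: "indicator ?S x = (1::real)" by (rule indicator_simps)
        show ?thesis unfolding i
          using conv_norm_le[OF Cc_fc[of n] B(2), where x=x] by (simp add: norm_mult h integral_norm_fc)
      next
        case False
        then have "x \<notin> {x + y | x y. x \<in> fsupp F \<and> y \<in> fsupp (fc n)}" using fsupp_fc by blast
        then have z: "conv F (fc n) x = 0" by (rule conv_eq_0)
        from False have i: "indicator ?S x = (0::real)" by (rule indicator_simps)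
        show ?thesis unfolding i z by simp
      qed
    qed
  qed measurable
qed

lemma fourier_transformableI:
  fixes nu :: "nat \<Rightarrow> 'a cmeasure"
  assumes mu: "is_cmeasure mu"
    and nu: "\<And>n. is_cmeasure (nu n)" "\<And>n. finite_cmeasure (nu n)"
    and tb: "equi_translation_bounded nu"
    and eq: "\<And>n. same_density_measure (mcheck (nu n)) (conv_meas (fc n) mu)"
  shows "fourier_transformable mu"
proof -
  have lf: "locally_finite (fst mu)" using mu by (rule cmeasure_locally_finite)
  note ph = cmeasure_phase[OF mu]
  \<comment> \<open>The density identity tested against \<open>\<phi>\<close>: both
    \<open>consist\<close> and the final formula are instances of it.\<close>
  have key: "(\<integral>y. fcheck \<phi> y * snd (nu n) y \<partial>fst (nu n)) = (\<integral>y. conv \<phi> (fc n) y * snd mu y \<partial>fst mu)" if \<phi>: "Cc \<phi>" for \<phi> n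
  proof -
    have "(\<integral>y. fcheck \<phi> y * snd (nu n) y \<partial>fst (nu n)) = (\<integral>x. \<phi> x * conv_meas (fc n) mu x \<partial>lborel)"
      using eq[of n] \<phi> unfolding same_density_measure_def integral_mcheck[OF nu \<phi>, symmetric] by blast
    also have "\<dots> = (\<integral>y. conv \<phi> (fc n) y * snd mu y \<partial>fst mu)"
      unfolding conv_meas_def cint_def by (rule integral_conv_meas[OF lf ph \<phi> Cc_fc fc_even])
    finally show ?thesis .
  qed
  \<comment> \<open>Equi translation boundedness on the unit ball; \<open>max 1 C0\<close> then
    supplies the positive constant that \<open>translation_bounded\<close> asks for.\<close>
  obtain C0 where C0: "\<And>n t. emeasure (tvar (nu n)) ((+) t ` cball 0 1) \<le> ennreal C0"
    using tb compact_cball unfolding equi_translation_bounded_def by metis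
  have C: "emeasure (fst (nu n)) (cball t 1) \<le> ennreal (max 1 C0)" for n t
  proof -
    have "(+) t ` cball 0 1 = cball t 1" using cball_translation[of t 0 1] by simp
    then show ?thesis using order_trans[OF C0[of n t] ennreal_leI[of C0 "max 1 C0"]] by (simp add: tvar_def)
  qed
  have fin: "finite_measure (fst (nu n))" for n
    using nu[of n] sets_eq_imp_space_eq[OF locally_finite_sets[OF cmeasure_locally_finite[OF nu(1)]], of n]
    by (intro finite_measureI) (simp add: finite_cmeasure_def tvar_def)
  \<comment> \<open>Use \<open>key\<close> with a translate of \<open>fc m\<close>, whose transform
    is \<open>wave x y * fhat m y\<close>. The result involves \<open>conv (fc m) (fc n)\<close>,
    which is symmetric in \<open>m\<close> and \<open>n\<close>.\<close>
  have consist: "(\<integral>y. of_real (fhat m y) * snd (nu n) y * wave x y \<partial>fst (nu n))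
    = (\<integral>y. of_real (fhat n y) * snd (nu m) y * wave x y \<partial>fst (nu m))" for n m x
  proof -
    have 1: "(\<integral>y. of_real (fhat m y) * snd (nu n) y * wave x y \<partial>fst (nu n))
       = (\<integral>y. conv (fc m) (fc n) (y - x) * snd mu y \<partial>fst mu)" for n m
    proof -
      have "(\<integral>y. of_real (fhat m y) * snd (nu n) y * wave x y \<partial>fst (nu n))
         = (\<integral>y. fcheck (\<lambda>t. fc m (t - x)) y * snd (nu n) y \<partial>fst (nu n))"
        unfolding fcheck_translate fcheck_fc by (simp add: mult_ac)
      also have "\<dots> = (\<integral>y. conv (\<lambda>t. fc m (t - x)) (fc n) y * snd mu y \<partial>fst mu)"
        by (rule key) (intro Cc_translate Cc_fc)
      finally show ?thesis unfolding conv_translate .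
    qed
    show ?thesis unfolding 1 by (simp add: conv_commute)
  qed
  obtain M H where M: "translation_bounded M (max 1 C0)" and H[measurable]: "H \<in> borel_measurable borel" and H1: "\<And>y. norm (H y) = 1"
    and MH: "\<And>n \<phi>. \<phi> \<in> borel_measurable borel \<Longrightarrow> (\<integral>y. \<phi> y * snd (nu n) y \<partial>fst (nu n)) = (\<integral>y. \<phi> y * of_real (fhat n y) * H y \<partial>M)"
  proof (rule glue_measures[of "\<lambda>n. fst (nu n)" "\<lambda>n. snd (nu n)" fhat "max 1 C0"])
    show "sets (fst (nu n)) = sets borel" for n
      by (rule locally_finite_sets[OF cmeasure_locally_finite[OF nu(1)]])
    show "0 < max 1 C0" by simp
  qed (rule fin cmeasure_phase[OF nu(1)] fhat_measurable fhat_nonneg fhat_le_1 fhat_tendsto consist C | blast)+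
  have lfM: "locally_finite M" using M by (rule translation_bounded_locally_finite)
  note [measurable_cong] = locally_finite_sets[OF lfM]
  have cm: "is_cmeasure (M, H)"
    using lfM H H1 by (simp add: is_cmeasure_def locally_finite_def)
  have "integrable M (\<lambda>y. (cmod (fcheck g y))\<^sup>2) \<and> cint mu (conv g (tilde g)) = cint (M, H) (\<lambda>y. complex_of_real ((cmod (fcheck g y))\<^sup>2))"
    if g: "Cc g" for g
  proof
    have [measurable]: "fcheck g \<in> borel_measurable borel" using fcheck_measurable[OF Cc_lborel[OF g]] .
    obtain S where "(\<integral>\<^sup>+y. ennreal ((cmod (fcheck g y))\<^sup>2) \<partial>M) \<le> ennreal S"
      using fourier_L2_bound[OF M] g by metis
    then have "(\<integral>\<^sup>+y. ennreal ((cmod (fcheck g y))\<^sup>2) \<partial>M) < \<infinity>" by (rule le_less_trans) simp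
    then show i: "integrable M (\<lambda>y. (cmod (fcheck g y))\<^sup>2)" by (simp add: integrable_iff_bounded)
    let ?F = "conv g (tilde g)"
    have F: "Cc ?F" using g by (intro Cc_conv Cc_tilde)
    \<comment> \<open>The transform of \<open>?F\<close> is the square |fcheck g|^2. So
      \<open>key\<close> followed by \<open>MH\<close> gives one sequence; its limit is computed on
      the side of \<open>mu\<close> by \<open>conv_fc_limit\<close> and on the side of
      \<open>M\<close> by dominated convergence.\<close>
    have eqn: "(\<integral>x. conv ?F (fc n) x * snd mu x \<partial>fst mu) = (\<integral>y. of_real ((cmod (fcheck g y))\<^sup>2) * of_real (fhat n y) * H y \<partial>M)" for n
      unfolding key[OF F, symmetric] conv_fcheck_abs2[OF g] by (rule MH) measurable
    have L1: "(\<lambda>n. \<integral>x. conv ?F (fc n) x * snd mu x \<partial>fst mu) \<longlonglongrightarrow> cint mu ?F"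
      unfolding cint_def by (rule conv_fc_limit[OF lf ph F])
    have L2: "(\<lambda>n. \<integral>y. of_real ((cmod (fcheck g y))\<^sup>2) * of_real (fhat n y) * H y \<partial>M) \<longlonglongrightarrow> (\<integral>y. of_real ((cmod (fcheck g y))\<^sup>2) * H y \<partial>M)"
    proof (rule integral_dominated_convergence[OF _ _ i])
      show "AE y in M. (\<lambda>n. of_real ((cmod (fcheck g y))\<^sup>2) * of_real (fhat n y) * H y) \<longlonglongrightarrow> of_real ((cmod (fcheck g y))\<^sup>2) * H y"
      proof (intro always_eventually allI)
        fix y
        have "(\<lambda>n. of_real ((cmod (fcheck g y))\<^sup>2) * of_real (fhat n y) * H y) \<longlonglongrightarrow> of_real ((cmod (fcheck g y))\<^sup>2) * of_real 1 * H y"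
          by (intro tendsto_mult tendsto_of_real fhat_tendsto tendsto_const)
        then show "(\<lambda>n. of_real ((cmod (fcheck g y))\<^sup>2) * of_real (fhat n y) * H y) \<longlonglongrightarrow> of_real ((cmod (fcheck g y))\<^sup>2) * H y" by simp
      qed
      show "AE y in M. norm (of_real ((cmod (fcheck g y))\<^sup>2) * of_real (fhat n y) * H y) \<le> (cmod (fcheck g y))\<^sup>2" for n
        using fhat_nonneg fhat_le_1 by (intro always_eventually allI) (simp add: norm_mult norm_power H1 mult_left_le)
    qed measurable
    have "cint mu ?F = (\<integral>y. of_real ((cmod (fcheck g y))\<^sup>2) * H y \<partial>M)"
      by (rule LIMSEQ_unique[OF L1[unfolded eqn] L2])
    then show "cint mu ?F = cint (M, H) (\<lambda>y. complex_of_real ((cmod (fcheck g y))\<^sup>2))"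
      by (simp add: cint_def)
  qed
  then show ?thesis unfolding fourier_transformable_def using cm by (intro exI[of _ "(M, H)"]) (simp add: tvar_def)
qed

end

subsection \<open>Transformable measures\<close>

lemma translation_bounded_compact:
  assumes N: "translation_bounded N C" and W: "compact W"
  obtains C' where "\<And>t. emeasure N ((+) t ` W) \<le> ennreal C'"
  using emeasure_translates_bounded[of N 1 C W] N W by (auto simp: translation_bounded_def)

lemma translation_boundedI:
  fixes N :: "'a::euclidean_space measure"
  assumes Ns: "sets N = sets borel" and r: "0 < r" and bd: "\<And>t. emeasure N (cball t r) \<le> ennreal C"
  obtains C' where "translation_bounded N C'"
proof -
  obtain C' where C': "\<And>t. emeasure N ((+) t ` cball 0 1) \<le> ennreal C'"
    using emeasure_translates_bounded[OF Ns r bd compact_cball] by metis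
  have "emeasure N (cball t 1) \<le> ennreal (max 1 C')" for t
    using order_trans[OF C'[of t] ennreal_leI[of C' "max 1 C'"]] cball_translation[of t 0 1] by simp
  then show ?thesis using Ns by (intro that[of "max 1 C'"]) (simp add: translation_bounded_def)
qed

text \<open>\<open>tilde\<close> is conjugate linear, so the four terms carry the factors 1,
  \<open>cnj w\<close>, \<open>w\<close> and \<open>w * cnj w\<close>, ready for
  polarization.\<close>

lemma conv_tilde_expand:
  fixes F G :: "'a::euclidean_space \<Rightarrow> complex"
  assumes F: "Cc F" and G: "Cc G"
  shows "conv (\<lambda>x. F x + w * G x) (tilde (\<lambda>x. F x + w * G x)) x
    = conv F (tilde F) x + cnj w * conv F (tilde G) x + w * conv G (tilde F) x + w * cnj w * conv G (tilde G) x"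
proof -
  have i: "integrable lborel (\<lambda>y. A (x - y) * tilde B y)" if "Cc A" "Cc B" for A B :: "'a \<Rightarrow> complex"
  proof -
    have "Cc (\<lambda>y. A (x + (-1) *\<^sub>R y))" using that by (intro Cc_affine) auto
    then have "Cc (\<lambda>y. A (x - y) * tilde B y)" using Cc_cont[OF Cc_tilde[OF that(2)]] by (intro Cc_mult_cont) simp_all
    then show ?thesis by (rule Cc_lborel)
  qed
  have "(F (x - y) + w * G (x - y)) * tilde (\<lambda>x. F x + w * G x) y = F (x - y) * tilde F y + cnj w * (F (x - y) * tilde G y)
     + w * (G (x - y) * tilde F y) + w * cnj w * (G (x - y) * tilde G y)" for y
    by (simp add: tilde_def algebra_simps)
  then show ?thesis
    unfolding conv_def using i[OF F F] i[OF F G] i[OF G F] i[OF G G] by simp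
qed

lemma fcheck_lincomb:
  assumes "Cc F" "Cc G" shows "fcheck (\<lambda>x. F x + w * G x) y = fcheck F y + w * fcheck G y"
proof -
  have "integrable lborel (\<lambda>x. F x * wave x y)" "integrable lborel (\<lambda>x. G x * wave x y)"
    using assms[THEN Cc_lborel] by (auto intro!: integrable_mult_bounded[where B=1])
  then show ?thesis unfolding fcheck_def by (simp add: algebra_simps)
qed

context pos_def_approx_identity
begin

lemma fhat_0: "fhat n 0 = 1"
  by (simp add: fhat_def fcheck_def integral_fc)

text \<open>A gliding hump: if $N$ were very large near points $t_k$, modulating $f_0$ by
  $\sum_k 2^{-k} e^{-2 \pi i \langle t_k, x \rangle}$ would give a function in $C_c$ whose transform is not square
  integrable. There is no cancellation between the humps because \<^term>\<open>fhat 0\<close> is nonnegative.\<close>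

lemma square_integrable_translation_bounded:
  fixes N :: "'a measure"
  assumes N: "locally_finite N" and sq: "\<And>g. Cc g \<Longrightarrow> integrable N (\<lambda>y. (cmod (fcheck g y))\<^sup>2)"
  obtains C where "translation_bounded N C"
proof -
  note Ns[measurable_cong] = locally_finite_sets[OF N]
  obtain r where r: "0 < r" "\<And>y. y \<in> cball 0 r \<Longrightarrow> 1/2 \<le> fhat 0 y"
  proof -
    have "isCont (fhat 0) 0" using continuous_fhat[of 0] by (simp add: continuous_on_eq_continuous_at)
    then have "\<forall>\<^sub>F y in at 0. 1/2 < fhat 0 y" unfolding isCont_def fhat_0 by (rule order_tendstoD) simp
    then obtain d where d: "0 < d" "\<And>y. y \<noteq> 0 \<Longrightarrow> dist y 0 < d \<Longrightarrow> 1/2 < fhat 0 y"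
      unfolding eventually_at by auto
    have "1/2 \<le> fhat 0 y" if "y \<in> cball 0 (d/2)" for y
    proof (cases "y = 0")
      case False
      have "dist y 0 < d" using that d(1) by simp
      then show ?thesis using d(2)[OF False] by simp
    qed (simp add: fhat_0)
    then show ?thesis using that[of "d/2"] d(1) by simp
  qed
  \<comment> \<open>Why powers of 8: the k-th hump has height at least 2^-k / 2 on its ball, so its
    square contributes 4^-k / 4 times the mass of the ball. Mass above 8^k leaves 2^k / 4, which is
    unbounded.\<close>
  have "\<exists>k::nat. \<forall>t. emeasure N (cball t r) \<le> ennreal (8 ^ k)"
  proof (rule ccontr)
    assume "\<nexists>k::nat. \<forall>t. emeasure N (cball t r) \<le> ennreal (8 ^ k)"
    then have "\<forall>k::nat. \<exists>t. ennreal (8 ^ k) < emeasure N (cball t r)" by (simp add: not_le)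
    then obtain t where t: "\<And>k. ennreal (8 ^ k) < emeasure N (cball (t k) r)" by metis
    \<comment> \<open>The series of characters is written as an integral over counting measure, so
      that \<open>Fubini_kernel\<close> exchanges it with the transform.\<close>
    define Q :: "nat measure" where "Q = count_space UNIV"
    have Qsf: "sigma_finite_measure Q" unfolding Q_def by (rule sigma_finite_measure_count_space)
    have tm[measurable]: "t \<in> measurable Q borel" by (simp add: Q_def)
    have hQ: "integrable Q (\<lambda>k. (1/2::real) ^ k)" unfolding Q_def by (subst integrable_count_space_nat_iff) simp
    have hQc: "integrable Q (\<lambda>k. complex_of_real ((1/2) ^ k))" using hQ by (rule integrable_of_real)
    define s where "s x = (\<integral>k. complex_of_real ((1/2) ^ k) * wave x (- t k) \<partial>Q)" for x
    have "continuous_on UNIV s" unfolding s_def[abs_def]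
      by (rule continuous_integral[OF _ _ hQ]) (auto simp: norm_mult norm_power Q_def intro!: continuous_intros)
    then have g: "Cc (\<lambda>x. fc 0 x * s x)" by (rule Cc_mult_cont[OF Cc_fc])
    have gh: "fcheck (\<lambda>x. fc 0 x * s x) y = of_real (\<integral>k. (1/2) ^ k * fhat 0 (y - t k) \<partial>Q)" for y
    proof -
      have "fcheck (\<lambda>x. fc 0 x * s x) y = (\<integral>x. (fc 0 x * wave x y) * s x \<partial>lborel)"
        unfolding fcheck_def by (simp add: mult_ac)
      also have "\<dots> = (\<integral>k. complex_of_real ((1/2) ^ k) * (\<integral>x. (fc 0 x * wave x y) * wave x (- t k) \<partial>lborel) \<partial>Q)"
        unfolding s_def
        by (rule Fubini_kernel[OF sigma_finite_lborel Qsf integrable_mult_bounded[OF Cc_lborel[OF Cc_fc], where B=1] hQc, where B=1])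
           simp_all
      also have "\<dots> = (\<integral>k. complex_of_real ((1/2) ^ k * fhat 0 (y - t k)) \<partial>Q)"
      proof (rule Bochner_Integration.integral_cong[OF refl])
        fix k
        have "(\<integral>x. (fc 0 x * wave x y) * wave x (- t k) \<partial>lborel) = fcheck (fc 0) (y - t k)"
          unfolding fcheck_def diff_conv_add_uminus[of y] wave_add(2) by (simp only: mult.assoc)
        then show "complex_of_real ((1/2) ^ k) * (\<integral>x. (fc 0 x * wave x y) * wave x (- t k) \<partial>lborel) = complex_of_real ((1/2) ^ k * fhat 0 (y - t k))"
          by (simp only: fcheck_fc of_real_mult)
      qed
      finally show ?thesis by (simp only: integral_complex_of_real)
    qed
    have low: "(1/2) ^ j * (1/2) \<le> cmod (fcheck (\<lambda>x. fc 0 x * s x) y)" if y: "y \<in> cball (t j) r" for j y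
    proof -
      have "1/2 \<le> fhat 0 (y - t j)" using y by (intro r(2)) (simp add: dist_norm norm_minus_commute)
      then have "(1/2) ^ j * (1/2) \<le> (1/2) ^ j * fhat 0 (y - t j)" by (intro mult_left_mono) auto
      also have "\<dots> \<le> (\<integral>k. (1/2) ^ k * fhat 0 (y - t k) \<partial>Q)"
      proof -
        have i: "integrable Q (\<lambda>k. (1/2) ^ k * fhat 0 (y - t k))"
          by (rule Bochner_Integration.integrable_bound[OF hQ])
             (auto simp: Q_def abs_mult fhat_nonneg fhat_le_1 intro!: always_eventually)
        then have "(\<integral>k. (1/2) ^ k * fhat 0 (y - t k) \<partial>Q) = (\<Sum>k. (1/2) ^ k * fhat 0 (y - t k))"
          unfolding Q_def by (rule integral_count_space_nat)
        moreover have "summable (\<lambda>k. (1/2) ^ k * fhat 0 (y - t k))"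
          using i unfolding Q_def integrable_count_space_nat_iff by (rule summable_norm_cancel)
        then have "(\<Sum>k\<in>{j}. (1/2) ^ k * fhat 0 (y - t k)) \<le> (\<Sum>k. (1/2) ^ k * fhat 0 (y - t k))"
          by (rule sum_le_suminf) (auto simp: fhat_nonneg)
        ultimately show ?thesis by simp
      qed
      also have "\<dots> \<le> cmod (fcheck (\<lambda>x. fc 0 x * s x) y)" unfolding gh norm_of_real by (rule abs_ge_self)
      finally show ?thesis .
    qed
    define A where "A = (\<integral>y. (cmod (fcheck (\<lambda>x. fc 0 x * s x) y))\<^sup>2 \<partial>N)"
    have A: "(\<integral>\<^sup>+y. ennreal ((cmod (fcheck (\<lambda>x. fc 0 x * s x) y))\<^sup>2) \<partial>N) = ennreal A"
      unfolding A_def using sq[OF g] by (rule nn_integral_eq_integral) simp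
    have A0: "0 \<le> A" unfolding A_def by simp
    have "2 ^ j \<le> 4 * A" for j :: nat
    proof -
      have "ennreal ((1/4) ^ j * (1/4)) * ennreal (8 ^ j) \<le> ennreal ((1/4) ^ j * (1/4)) * emeasure N (cball (t j) r)"
        using t[of j] by (intro mult_left_mono) auto
      also have "\<dots> = (\<integral>\<^sup>+y. ennreal ((1/4) ^ j * (1/4)) * indicator (cball (t j) r) y \<partial>N)"
        by (subst nn_integral_cmult_indicator) (auto simp: Ns)
      also have "\<dots> \<le> (\<integral>\<^sup>+y. ennreal ((cmod (fcheck (\<lambda>x. fc 0 x * s x) y))\<^sup>2) \<partial>N)"
      proof (rule nn_integral_mono)
        fix y
        show "ennreal ((1/4) ^ j * (1/4)) * indicator (cball (t j) r) y \<le> ennreal ((cmod (fcheck (\<lambda>x. fc 0 x * s x) y))\<^sup>2)"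
        proof (cases "y \<in> cball (t j) r")
          case True
          have "((1/2::real) ^ j * (1/2))\<^sup>2 = (1/4) ^ j * (1/4)"
            by (simp add: power_mult_distrib power2_eq_square flip: power_mult_distrib)
          then have "(1/4) ^ j * (1/4) \<le> (cmod (fcheck (\<lambda>x. fc 0 x * s x) y))\<^sup>2"
            using power_mono[OF low[OF True], of 2] by (simp only: zero_le_mult_iff zero_le_power zero_le_divide_1_iff zero_le_numeral simp_thms)
          then show ?thesis using True by (simp add: ennreal_leI)
        qed simp
      qed
      also have "\<dots> = ennreal A" by (rule A)
      finally have "ennreal ((1/4) ^ j * (1/4) * 8 ^ j) \<le> ennreal A" by (subst ennreal_mult) auto
      then have "(1/4) ^ j * (1/4) * 8 ^ j \<le> A" using A0 by (simp add: ennreal_le_iff)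
      moreover have "(1/4::real) ^ j * (1/4) * 8 ^ j = 2 ^ j / 4" by (simp flip: power_mult_distrib)
      ultimately show ?thesis by simp
    qed
    moreover obtain j :: nat where "4 * A < 2 ^ j" using real_arch_pow[of 2 "4 * A"] by auto
    ultimately show False by (meson not_le)
  qed
  then obtain k :: nat where "\<And>t. emeasure N (cball t r) \<le> ennreal (8 ^ k)" by blast
  with translation_boundedI[OF Ns r(1)] that show ?thesis by metis
qed

end

section \<open>Consequences of a given transform\<close>

locale transform_pair = pos_def_approx_identity f K for f :: "nat \<Rightarrow> 'a::euclidean_space \<Rightarrow> real" and K +
  fixes mu muhat :: "'a cmeasure"
  assumes mu: "is_cmeasure mu" and muhat: "is_cmeasure muhat"
    and sq: "\<And>g. Cc g \<Longrightarrow> integrable (fst muhat) (\<lambda>y. (cmod (fcheck g y))\<^sup>2)"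
    and transform: "\<And>g. Cc g \<Longrightarrow> cint mu (conv g (tilde g)) = cint muhat (\<lambda>y. complex_of_real ((cmod (fcheck g y))\<^sup>2))"
begin

abbreviation "N \<equiv> fst muhat"
abbreviation "H \<equiv> snd muhat"

lemma N_lf: "locally_finite N" using muhat by (rule cmeasure_locally_finite)
lemma N_sets [measurable_cong]: "sets N = sets borel" using N_lf by (rule locally_finite_sets)
lemma H_measurable [measurable]: "H \<in> borel_measurable borel" using muhat by (rule cmeasure_phase)
lemma H_norm: "norm (H y) = 1" using muhat by (rule cmeasure_phase)
lemma mu_lf: "locally_finite (fst mu)" using mu by (rule cmeasure_locally_finite)

lemma obtain_bound: obtains C where "translation_bounded N C"
  using square_integrable_translation_bounded[OF N_lf sq] by metis

lemma cint_integrable: "Cc g \<Longrightarrow> integrable (fst mu) (\<lambda>x. g x * snd mu x)"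
  by (rule integrable_mult_bounded[OF Cc_integrable[OF _ mu_lf], where B=1])
     (use cmeasure_phase[OF mu] locally_finite_sets[OF mu_lf] in \<open>auto cong: measurable_cong_sets\<close>)

lemma cross_integrable:
  assumes F: "Cc F" and G: "Cc G"
  shows "integrable N (\<lambda>y. fcheck F y * cnj (fcheck G y) * H y)"
proof -
  have [measurable]: "fcheck F \<in> borel_measurable borel" "fcheck G \<in> borel_measurable borel"
    using F G by (auto intro!: fcheck_measurable Cc_lborel)
  show ?thesis
  proof (rule Bochner_Integration.integrable_bound[OF Bochner_Integration.integrable_add[OF sq[OF F] sq[OF G]]])
    show "AE y in N. norm (fcheck F y * cnj (fcheck G y) * H y) \<le> norm ((cmod (fcheck F y))\<^sup>2 + (cmod (fcheck G y))\<^sup>2)"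
    proof (intro always_eventually allI)
      fix y
      let ?u = "cmod (fcheck F y)" and ?v = "cmod (fcheck G y)"
      have "2 * (?u * ?v) \<le> ?u\<^sup>2 + ?v\<^sup>2" using zero_le_power2[of "?u - ?v"] by (simp add: power2_eq_square algebra_simps)
      moreover have "0 \<le> ?u * ?v" by simp
      ultimately have "?u * ?v \<le> ?u\<^sup>2 + ?v\<^sup>2" by linarith
      then show "norm (fcheck F y * cnj (fcheck G y) * H y) \<le> norm (?u\<^sup>2 + ?v\<^sup>2)"
        by (simp add: norm_mult H_norm)
    qed
  qed measurable
qed

text \<open>Apply the hypothesis to F + w G and cancel the diagonal terms; \<open>w = 1\<close> and
  \<open>w = \<i>\<close> then determine the sum and the difference of the two cross terms.\<close>

lemma transform_polarized:
  assumes F: "Cc F" and G: "Cc G"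
  shows "cint mu (conv F (tilde G)) = (\<integral>y. fcheck F y * cnj (fcheck G y) * H y \<partial>N)"
proof -
  define T where "T A B = cint mu (conv A (tilde B))" for A B
  define S where "S A B = (\<integral>y. fcheck A y * cnj (fcheck B y) * H y \<partial>N)" for A B
  have TS: "T A A = S A A" if "Cc A" for A
    unfolding T_def S_def transform[OF that] unfolding cint_def complex_norm_square ..
  have Fw: "Cc (\<lambda>x. F x + w * G x)" for w
    using Cc_add[OF F, of "\<lambda>x. G x * w"] Cc_mult_cont[OF G, of "\<lambda>_. w"] by (simp add: mult.commute)
  have Tw: "T (\<lambda>x. F x + w * G x) (\<lambda>x. F x + w * G x) = T F F + cnj w * T F G + w * T G F + w * cnj w * T G G" for w
  proof -
    have i: "integrable (fst mu) (\<lambda>x. conv A (tilde B) x * snd mu x)" if "Cc A" "Cc B" for A B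
      using that by (intro cint_integrable Cc_conv Cc_tilde)
    show ?thesis unfolding T_def cint_def conv_tilde_expand[OF F G] distrib_right mult.assoc
      using i[OF F F] i[OF F G] i[OF G F] i[OF G G] by simp
  qed
  have Sw: "S (\<lambda>x. F x + w * G x) (\<lambda>x. F x + w * G x) = S F F + cnj w * S F G + w * S G F + w * cnj w * S G G" for w
  proof -
    have "fcheck (\<lambda>x. F x + w * G x) y * cnj (fcheck (\<lambda>x. F x + w * G x) y) * H y
      = fcheck F y * cnj (fcheck F y) * H y + cnj w * (fcheck F y * cnj (fcheck G y) * H y)
       + w * (fcheck G y * cnj (fcheck F y) * H y) + w * cnj w * (fcheck G y * cnj (fcheck G y) * H y)" for y
      unfolding fcheck_lincomb[OF F G] by (simp add: algebra_simps)
    then show ?thesis unfolding S_def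
      using cross_integrable[OF F F] cross_integrable[OF F G] cross_integrable[OF G F] cross_integrable[OF G G] by simp
  qed
  have "T F F + cnj w * T F G + w * T G F + w * cnj w * T G G = S F F + cnj w * S F G + w * S G F + w * cnj w * S G G" for w
    unfolding Tw[symmetric] Sw[symmetric] by (rule TS[OF Fw])
  then have e: "cnj w * T F G + w * T G F = cnj w * S F G + w * S G F" for w
    using TS[OF F] TS[OF G] by simp
  have "T F G + T G F = S F G + S G F" using e[of 1] by simp
  moreover have "- T F G + T G F = - S F G + S G F"
  proof -
    have "\<i> * (- T F G + T G F) = \<i> * (- S F G + S G F)" using e[of \<i>] by (simp add: algebra_simps)
    then show ?thesis by simp
  qed
  ultimately have "2 * T F G = 2 * S F G" by algebra
  then show ?thesis by (simp add: T_def S_def)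
qed

text \<open>A general \<open>F\<close> is not of the form \<open>conv g (tilde g)\<close>, but
  \<open>conv F (fc n)\<close> is covered by polarization with \<open>G = tilde (fc n)\<close>. The
  limit in \<open>n\<close> exists on both sides, on the transform side because |fcheck F|
  dominates.\<close>

lemma transform_integrable:
  assumes F: "Cc F" and i: "integrable N (fcheck F)"
  shows "cint mu F = (\<integral>y. fcheck F y * H y \<partial>N)"
proof (rule LIMSEQ_unique)
  have [measurable]: "fcheck F \<in> borel_measurable borel"
    using F by (auto intro!: fcheck_measurable Cc_lborel)
  show "(\<lambda>n. \<integral>x. conv F (fc n) x * snd mu x \<partial>fst mu) \<longlonglongrightarrow> cint mu F"
    unfolding cint_def by (rule conv_fc_limit[OF mu_lf cmeasure_phase[OF mu] F])
  have eq: "(\<integral>x. conv F (fc n) x * snd mu x \<partial>fst mu) = (\<integral>y. fcheck F y * of_real (fhat n y) * H y \<partial>N)" for n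
    using transform_polarized[OF F Cc_tilde[OF Cc_fc[of n]]] unfolding tilde_tilde fcheck_tilde complex_cnj_cnj fcheck_fc
    by (simp add: cint_def)
  show "(\<lambda>n. \<integral>x. conv F (fc n) x * snd mu x \<partial>fst mu) \<longlonglongrightarrow> (\<integral>y. fcheck F y * H y \<partial>N)"
    unfolding eq
  proof (rule integral_dominated_convergence[OF _ _ integrable_norm[OF i]])
    show "AE y in N. (\<lambda>n. fcheck F y * of_real (fhat n y) * H y) \<longlonglongrightarrow> fcheck F y * H y"
    proof (intro always_eventually allI)
      fix y
      have "(\<lambda>n. fcheck F y * of_real (fhat n y) * H y) \<longlonglongrightarrow> fcheck F y * of_real 1 * H y"
        by (intro tendsto_mult tendsto_of_real fhat_tendsto tendsto_const)
      then show "(\<lambda>n. fcheck F y * of_real (fhat n y) * H y) \<longlonglongrightarrow> fcheck F y * H y" by simp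
    qed
    show "AE y in N. norm (fcheck F y * of_real (fhat n y) * H y) \<le> norm (fcheck F y)" for n
      using fhat_nonneg fhat_le_1 by (intro always_eventually allI) (simp add: norm_mult H_norm mult_left_le)
  qed measurable
qed

text \<open>Since \<open>fhat n\<close> is nonnegative, multiplying \<open>muhat\<close> by it
  changes only the total variation and keeps the phase.\<close>

definition nu :: "nat \<Rightarrow> 'a cmeasure" where "nu n = (density N (\<lambda>y. ennreal (fhat n y)), H)"

text \<open>From \<open>fhat n \<le> 1\<close>. One measure dominates all \<open>nu n\<close>, so
  bounds for it hold uniformly in \<open>n\<close>.\<close>

lemma fst_nu_le: "A \<in> sets borel \<Longrightarrow> emeasure (fst (nu n)) A \<le> emeasure N A"
proof -
  assume A: "A \<in> sets borel"
  have "emeasure (fst (nu n)) A = (\<integral>\<^sup>+y. ennreal (fhat n y) * indicator A y \<partial>N)"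
    unfolding nu_def using A N_sets by (simp add: emeasure_density)
  also have "\<dots> \<le> (\<integral>\<^sup>+y. indicator A y \<partial>N)"
    using ennreal_leI[OF fhat_le_1[of n]] by (intro nn_integral_mono) (simp add: indicator_def)
  also have "\<dots> = emeasure N A" using A N_sets by simp
  finally show ?thesis .
qed

lemma is_cmeasure_nu: "is_cmeasure (nu n)"
  unfolding is_cmeasure_def
proof (intro conjI allI impI)
  show "sets (fst (nu n)) = sets borel" by (simp add: nu_def N_sets)
  fix K :: "'a set" assume K: "compact K"
  show "emeasure (fst (nu n)) K < \<infinity>"
    using fst_nu_le[OF borel_compact[OF K]] locally_finite_compact[OF N_lf K] by (rule le_less_trans)
qed (auto simp: nu_def H_norm)

lemma fhat_integrable: "integrable N (fcheck (fc n))"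
  using pos_def_fcheck_integrable[OF _ Cc_fc pos_def_fc integral_fc] obtain_bound by metis

lemma finite_cmeasure_nu: "finite_cmeasure (nu n)"
proof -
  have "emeasure (fst (nu n)) UNIV = (\<integral>\<^sup>+y. ennreal (norm (fcheck (fc n) y)) \<partial>N)"
    unfolding nu_def using sets_eq_imp_space_eq[OF N_sets] N_sets
    by (simp add: emeasure_density fcheck_fc fhat_nonneg)
  also have "\<dots> < \<infinity>" using fhat_integrable[of n] by (simp add: integrable_iff_bounded)
  finally show ?thesis by (simp add: finite_cmeasure_def tvar_def)
qed

lemma equi_translation_bounded_nu: "equi_translation_bounded nu"
  unfolding equi_translation_bounded_def tvar_def
proof (intro allI impI)
  fix W :: "'a set" assume W: "compact W"
  obtain C where "translation_bounded N C" by (rule obtain_bound)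
  then obtain C' where C': "\<And>t. emeasure N ((+) t ` W) \<le> ennreal C'"
    using translation_bounded_compact[OF _ W] by metis
  have "emeasure (fst (nu n)) ((+) t ` W) \<le> ennreal C'" for n t
    using W by (intro order_trans[OF fst_nu_le C'] borel_compact compact_translation)
  then show "\<exists>C. \<forall>n t. emeasure (fst (nu n)) ((+) t ` W) \<le> ennreal C" by blast
qed

text \<open>The character in \<open>mcheck\<close> times \<open>fhat n\<close> is the transform of a
  translate of \<open>fc n\<close>, to which the formula for \<open>mu\<close> applies; evenness
  then turns \<open>t - x\<close> into \<open>x - t\<close>. The equality holds at every
  point.\<close>

lemma mcheck_nu: "mcheck (nu n) = conv_meas (fc n) mu"
proof
  fix x
  have [measurable]: "fcheck (fc n) \<in> borel_measurable borel" by (intro fcheck_measurable Cc_lborel Cc_fc)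
  have "mcheck (nu n) x = (\<integral>y. fcheck (\<lambda>t. fc n (t - x)) y * H y \<partial>N)"
    unfolding mcheck_def cint_def nu_def fcheck_translate fcheck_fc
    by (simp, subst integral_density) (auto simp: fhat_nonneg scaleR_conv_of_real mult_ac)
  also have "\<dots> = cint mu (\<lambda>t. fc n (t - x))"
  proof (rule transform_integrable[symmetric])
    show "Cc (\<lambda>t. fc n (t - x))" by (intro Cc_translate Cc_fc)
    show "integrable N (fcheck (\<lambda>t. fc n (t - x)))"
      unfolding fcheck_translate' mult.commute[of "wave x _"]
      by (rule integrable_mult_bounded[OF fhat_integrable, where B=1]) auto
  qed
  also have "(\<lambda>t. fc n (t - x)) = (\<lambda>t. fc n (x - t))"
    using fc_even[of n "x - _"] by (simp add: fun_eq_iff)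
  finally show "mcheck (nu n) x = conv_meas (fc n) mu x" by (simp add: conv_meas_def)
qed

end

subsection \<open>Temperedness\<close>

text \<open>Each factor 1 + (x \<bullet> b)^2 is at most (1 + |x|)^2, so the exponent
  \<open>2 * DIM('a)\<close> lets a product of one-dimensional integrable functions dominate the
  weight.\<close>

definition wgt :: "'a::euclidean_space \<Rightarrow> real" where
  "wgt x = inverse ((1 + norm x) ^ (2 * DIM('a)))"

lemma wgt_pos: "0 < wgt x"
  unfolding wgt_def by (intro positive_imp_inverse_positive zero_less_power add_pos_nonneg) auto

lemma wgt_measurable [measurable]: "wgt \<in> borel_measurable borel"
  unfolding wgt_def by measurable

lemma integrable_lborel_inverse_1_plus_square: "integrable lborel (\<lambda>x::real. inverse (1 + x\<^sup>2))"
  using integrable_inverse_1_plus_square by (simp add: set_integrable_def einterval_eq)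

lemma integrable_wgt: "integrable lborel (wgt :: 'a::euclidean_space \<Rightarrow> real)"
proof -
  have "integrable lborel (\<lambda>x::'a. \<Prod>b\<in>Basis. complex_of_real (inverse (1 + (x \<bullet> b)\<^sup>2)))"
    by (rule lborel_integrable_prod) (rule integrable_of_real[OF integrable_lborel_inverse_1_plus_square])
  then show ?thesis
  proof (rule Bochner_Integration.integrable_bound)
    show "AE x in lborel. norm (wgt x) \<le> norm (\<Prod>b\<in>Basis. complex_of_real (inverse (1 + ((x::'a) \<bullet> b)\<^sup>2)))"
    proof (intro always_eventually allI)
      fix x :: 'a
      have "(\<Prod>b\<in>Basis. 1 + (x \<bullet> b)\<^sup>2) \<le> (\<Prod>b\<in>(Basis::'a set). (1 + norm x)\<^sup>2)"
      proof (intro prod_mono conjI)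
        fix b :: 'a assume b: "b \<in> Basis"
        have "(x \<bullet> b)\<^sup>2 \<le> (norm x)\<^sup>2" using Basis_le_norm[OF b, of x] by (simp add: abs_le_square_iff[symmetric])
        then have "1 + (x \<bullet> b)\<^sup>2 \<le> 1 + 2 * norm x + (norm x)\<^sup>2" using norm_ge_zero[of x] by linarith
        then show "1 + (x \<bullet> b)\<^sup>2 \<le> (1 + norm x)\<^sup>2" by (simp add: power2_sum)
      qed (simp add: add_nonneg_nonneg)
      also have "\<dots> = (1 + norm x) ^ (2 * DIM('a))" by (simp add: power_mult)
      finally have "wgt x \<le> inverse (\<Prod>b\<in>Basis. 1 + (x \<bullet> b)\<^sup>2)"
        unfolding wgt_def by (intro le_imp_inverse_le prod_pos) (auto intro: add_pos_nonneg)
      then show "norm (wgt x) \<le> norm (\<Prod>b\<in>Basis. complex_of_real (inverse (1 + (x \<bullet> b)\<^sup>2)))"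
      proof -
        have "(\<Prod>b\<in>Basis. complex_of_real (inverse (1 + (x \<bullet> b)\<^sup>2))) = complex_of_real (inverse (\<Prod>b\<in>Basis. 1 + (x \<bullet> b)\<^sup>2))"
          by (simp only: of_real_prod[symmetric] prod_inversef[unfolded o_def])
        moreover assume "wgt x \<le> inverse (\<Prod>b\<in>Basis. 1 + (x \<bullet> b)\<^sup>2)"
        ultimately show ?thesis using wgt_pos[of x] by (simp only: norm_of_real real_norm_def)
      qed
    qed
  qed measurable
qed

text \<open>1 + |t| \<le> 2 (1 + |y|) for points at distance at most 1. The weight varies so slowly
  that it can be averaged over unit balls and can dominate difference quotients.\<close>

lemma wgt_shift:
  fixes t y :: "'a::euclidean_space"
  assumes d: "dist t y \<le> 1"
  shows "wgt y \<le> 2 ^ (2 * DIM('a)) * wgt t"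
proof -
  have "norm t \<le> norm y + 1" using d norm_triangle_sub[of t y] by (simp add: dist_norm)
  then have "1 + norm t \<le> 2 * (1 + norm y)" using norm_ge_zero[of y] by argo
  then have "(1 + norm t) ^ (2 * DIM('a)) \<le> (2 * (1 + norm y)) ^ (2 * DIM('a))"
    by (rule power_mono) (simp add: add_nonneg_nonneg)
  moreover have "0 < (1 + norm t) ^ (2 * DIM('a))" "0 < (1 + norm y) ^ (2 * DIM('a))"
    by (auto intro!: zero_less_power add_pos_nonneg)
  ultimately show ?thesis unfolding wgt_def power_mult_distrib by (simp add: divide_simps mult_ac)
qed

lemma translation_bounded_wgt:
  assumes "translation_bounded N C" shows "integrable N (wgt :: 'a::euclidean_space \<Rightarrow> real)"
proof -
  have [measurable_cong]: "sets N = sets borel" using assms by (simp add: translation_bounded_def)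
  have "(\<integral>\<^sup>+y. ennreal (wgt (y - 0)) \<partial>N) \<le> ennreal (C * (\<integral>x. 2 ^ (2 * DIM('a)) * wgt (x::'a) \<partial>lborel) / measure lborel (cball (0::'a) 1))"
    using wgt_pos by (intro translation_bounded_weight[OF assms] wgt_shift integrable_mult_right integrable_wgt)
      (auto intro!: mult_nonneg_nonneg less_imp_le[OF wgt_pos])
  then have "(\<integral>\<^sup>+y. ennreal (wgt (y - 0)) \<partial>N) < \<infinity>" by (rule le_less_trans) simp
  then have "(\<integral>\<^sup>+y. ennreal (norm (wgt y)) \<partial>N) < \<infinity>"
    by (simp add: abs_of_pos[OF wgt_pos])
  then show ?thesis by (simp add: integrable_iff_bounded)
qed

section \<open>Decay of the transform of a test function\<close>

lemma difference_quotient_tendsto: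
  fixes p :: "real \<Rightarrow> complex"
  assumes "(p has_vector_derivative p') (at 0)"
  shows "(\<lambda>n. (p (inverse (real (Suc n))) - p 0) / of_real (inverse (real (Suc n)))) \<longlonglongrightarrow> p'"
proof -
  let ?e = "\<lambda>n. inverse (real (Suc n))"
  have "((\<lambda>h. norm (p (0 + h) - p 0 - h *\<^sub>R p') / norm h) \<longlongrightarrow> 0) (at 0)"
    using assms unfolding has_vector_derivative_def has_derivative_at by blast
  moreover have "filterlim ?e (at 0) sequentially"
    unfolding filterlim_at using LIMSEQ_inverse_real_of_nat by auto
  ultimately have "(\<lambda>n. norm (p (0 + ?e n) - p 0 - ?e n *\<^sub>R p') / norm (?e n)) \<longlonglongrightarrow> 0"
    by (rule filterlim_compose)
  moreover have "norm (p (0 + ?e n) - p 0 - ?e n *\<^sub>R p') / norm (?e n) = norm ((p (?e n) - p 0) / of_real (?e n) - p')" for n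
  proof -
    have "(p (0 + h) - p 0 - h *\<^sub>R p') / of_real h = (p h - p 0) / of_real h - p'" if "h \<noteq> 0" for h
      using that by (simp add: scaleR_conv_of_real diff_divide_distrib)
    then have "(p (0 + ?e n) - p 0 - ?e n *\<^sub>R p') / of_real (?e n) = (p (?e n) - p 0) / of_real (?e n) - p'"
      by (metis inverse_eq_imp_eq inverse_zero nat.distinct(1) of_nat_eq_0_iff)
    then show ?thesis by (metis norm_divide norm_of_real real_norm_def)
  qed
  ultimately have "(\<lambda>n. norm ((p (?e n) - p 0) / of_real (?e n) - p')) \<longlonglongrightarrow> 0" by simp
  then show ?thesis by (simp add: tendsto_norm_zero_iff LIM_zero_iff)
qed

text \<open>In place of integration by parts, compute the limit of the transforms of difference
  quotients in two ways. Translation multiplies the transform by an exponential, whose derivative at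
  0 is the asserted factor. On the other side the mean value inequality gives an intermediate point
  at distance less than 1, so \<open>wgt_shift\<close> yields a majorant independent of
  \<open>n\<close>.\<close>

lemma fcheck_derivative:
  fixes \<psi> \<psi>' :: "'a::euclidean_space \<Rightarrow> complex"
  assumes c: "continuous_on UNIV \<psi>" "continuous_on UNIV \<psi>'" and v: "norm v = 1"
    and d: "\<And>x. ((\<lambda>t::real. \<psi> (x + t *\<^sub>R v)) has_vector_derivative \<psi>' x) (at 0)"
    and b: "\<And>x. norm (\<psi> x) \<le> B * wgt x" "\<And>x. norm (\<psi>' x) \<le> B * wgt x"
  shows "fcheck \<psi>' y = - 2 * pi * \<i> * (v \<bullet> y) * fcheck \<psi> y"
proof (rule LIMSEQ_unique)
  let ?e = "\<lambda>n. inverse (real (Suc n))" and ?K = "2 ^ (2 * DIM('a))"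
  have [measurable]: "\<psi> \<in> borel_measurable borel" "\<psi>' \<in> borel_measurable borel"
    using c by (auto intro: borel_measurable_continuous_onI)
  have B: "0 \<le> B" using order_trans[OF norm_ge_zero b(1)[of 0]] by (simp add: wgt_def)
  have \<psi>i: "integrable lborel \<psi>"
    by (rule Bochner_Integration.integrable_bound[OF integrable_mult_right[OF integrable_wgt, of B]])
       (use b(1) in \<open>auto intro: order_trans[OF _ abs_ge_self]\<close>)
  have dt: "((\<lambda>t. \<psi> (x + t *\<^sub>R v)) has_vector_derivative \<psi>' (x + t *\<^sub>R v)) (at t)" for x t
  proof -
    have "((\<lambda>s. s - t) has_vector_derivative 1) (at t)" by (auto intro!: derivative_eq_intros)
    moreover have "((\<lambda>s. \<psi> ((x + t *\<^sub>R v) + s *\<^sub>R v)) has_vector_derivative \<psi>' (x + t *\<^sub>R v)) (at (t - t))"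
      using d[of "x + t *\<^sub>R v"] by simp
    ultimately have "((\<lambda>s. \<psi> ((x + t *\<^sub>R v) + s *\<^sub>R v)) \<circ> (\<lambda>s. s - t) has_vector_derivative 1 *\<^sub>R \<psi>' (x + t *\<^sub>R v)) (at t)"
      by (rule vector_diff_chain_at)
    then show ?thesis by (simp add: o_def algebra_simps)
  qed
  define q where "q n x = (\<psi> (x + ?e n *\<^sub>R v) - \<psi> x) / of_real (?e n)" for n x
  have [measurable]: "q n \<in> borel_measurable borel" for n unfolding q_def by measurable
  have qb: "norm (q n x) \<le> B * ?K * wgt x" for n x
  proof -
    have e: "0 < ?e n" "?e n \<le> 1" by (auto simp: field_simps)
    have "\<exists>s\<in>{0<..<?e n}. norm (\<psi> (x + ?e n *\<^sub>R v) - \<psi> (x + 0 *\<^sub>R v)) \<le> norm ((?e n - 0) *\<^sub>R \<psi>' (x + s *\<^sub>R v))"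
    proof (rule mvt_general[OF e(1)])
      show "continuous_on {0..?e n} (\<lambda>t. \<psi> (x + t *\<^sub>R v))"
        by (rule continuous_on_compose2[OF c(1)]) (auto intro!: continuous_intros)
    qed (rule dt[unfolded has_vector_derivative_def])
    then obtain s where s: "s \<in> {0<..<?e n}" "norm (\<psi> (x + ?e n *\<^sub>R v) - \<psi> (x + 0 *\<^sub>R v)) \<le> norm ((?e n - 0) *\<^sub>R \<psi>' (x + s *\<^sub>R v))"
      by blast
    have "norm (\<psi> (x + ?e n *\<^sub>R v) - \<psi> x) \<le> norm (\<psi>' (x + s *\<^sub>R v)) * ?e n"
      using s(2) by (simp only: norm_scaleR diff_0_right scaleR_zero_left add_0_right abs_of_pos[OF e(1)] mult.commute)
    then have "norm (q n x) \<le> norm (\<psi>' (x + s *\<^sub>R v))"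
      using e(1) by (simp only: q_def norm_divide norm_of_real abs_of_pos[OF e(1)] pos_divide_le_eq)
    also have "\<dots> \<le> B * wgt (x + s *\<^sub>R v)" by (rule b)
    also have "\<dots> \<le> B * (?K * wgt x)"
      using B s e v by (intro mult_left_mono wgt_shift) (auto simp: dist_norm)
    finally show ?thesis by (simp add: mult.assoc)
  qed
  have "(\<lambda>n. \<integral>x. q n x * wave x y \<partial>lborel) \<longlonglongrightarrow> (\<integral>x. \<psi>' x * wave x y \<partial>lborel)"
  proof (rule integral_dominated_convergence[where w="\<lambda>x. B * ?K * wgt x"])
    show "AE x in lborel. (\<lambda>n. q n x * wave x y) \<longlonglongrightarrow> \<psi>' x * wave x y"
      unfolding q_def using difference_quotient_tendsto[OF d]
      by (intro always_eventually allI tendsto_mult tendsto_const) simp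
  qed (use qb in \<open>auto simp: norm_mult intro!: integrable_mult_right integrable_wgt\<close>)
  then show "(\<lambda>n. \<integral>x. q n x * wave x y \<partial>lborel) \<longlonglongrightarrow> fcheck \<psi>' y" by (simp add: fcheck_def)
  define A where "A = - 2 * pi * \<i> * (v \<bullet> y)"
  have cisA: "cnj (wave (t *\<^sub>R v) y) = exp (t *\<^sub>R A)" for t
    unfolding cis_cnj by (simp add: cis_conv_exp A_def scaleR_conv_of_real mult_ac)
  have "(\<integral>x. q n x * wave x y \<partial>lborel) = ((exp (?e n *\<^sub>R A) - exp (0 *\<^sub>R A)) / of_real (?e n)) * fcheck \<psi> y" for n
  proof -
    have i: "integrable lborel (\<lambda>x. \<psi> x * wave x y)" "integrable lborel (\<lambda>x. \<psi> (x + ?e n *\<^sub>R v) * wave x y)"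
      using \<psi>i lborel_integrable_translate[OF \<psi>i, of "?e n *\<^sub>R v"]
      by (auto intro!: integrable_mult_bounded[where B=1] simp: add.commute)
    have "(\<integral>x. q n x * wave x y \<partial>lborel) = (\<integral>x. (\<psi> (x + ?e n *\<^sub>R v) * wave x y - \<psi> x * wave x y) / of_real (?e n) \<partial>lborel)"
      by (simp add: q_def left_diff_distrib diff_divide_distrib)
    also have "\<dots> = (fcheck (\<lambda>x. \<psi> (x + ?e n *\<^sub>R v)) y - fcheck \<psi> y) / of_real (?e n)"
      using i by (simp add: fcheck_def)
    also have "fcheck (\<lambda>x. \<psi> (x + ?e n *\<^sub>R v)) y = exp (?e n *\<^sub>R A) * fcheck \<psi> y"
      using fcheck_translate[of \<psi> "- (?e n *\<^sub>R v)" y] unfolding wave_minus cisA by simp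
    finally show ?thesis by (simp add: algebra_simps)
  qed
  moreover have "(\<lambda>n. (exp (?e n *\<^sub>R A) - exp (0 *\<^sub>R A)) / of_real (?e n)) \<longlonglongrightarrow> exp (0 *\<^sub>R A) * A"
    by (rule difference_quotient_tendsto) (rule exp_scaleR_has_vector_derivative_right)
  then have "(\<lambda>n. ((exp (?e n *\<^sub>R A) - exp (0 *\<^sub>R A)) / of_real (?e n)) * fcheck \<psi> y) \<longlonglongrightarrow> exp (0 *\<^sub>R A) * A * fcheck \<psi> y"
    by (intro tendsto_mult tendsto_const)
  ultimately show "(\<lambda>n. \<integral>x. q n x * wave x y \<partial>lborel) \<longlonglongrightarrow> - 2 * pi * \<i> * (v \<bullet> y) * fcheck \<psi> y"
    by (simp add: A_def)
qed

text \<open>Only derivatives along one axis are taken: for the coordinate \<open>b\<close> with the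
  largest |b \<bullet> y|, 1 + |y| is at most 1 + d times max 1 |b \<bullet> y|, where d is the
  dimension. If |b \<bullet> y| < 1, the bound without derivatives suffices; otherwise
  \<open>2 * DIM('a)\<close> derivatives along \<open>b\<close> supply the needed power.\<close>

lemma fcheck_decay:
  fixes \<phi> :: "'a::euclidean_space \<Rightarrow> complex"
  assumes \<phi>: "smooth \<phi>"
    and B: "\<And>x vs. vs \<in> lists Basis \<Longrightarrow> length vs \<le> 2 * DIM('a) \<Longrightarrow> (1 + norm x) ^ (2 * DIM('a)) * norm (dirs vs \<phi> x) \<le> B"
  shows "norm (fcheck \<phi> y) \<le> B * (real (1 + DIM('a)) ^ (2 * DIM('a)) * (\<integral>x. wgt (x::'a) \<partial>lborel)) * wgt y"
proof -
  let ?p = "2 * DIM('a)"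
  define W where "W = (\<integral>x. wgt (x::'a) \<partial>lborel)"
  have W0: "0 \<le> W" unfolding W_def using wgt_pos by (intro integral_nonneg_AE) (auto intro: less_imp_le)
  have bw: "norm (dirs vs \<phi> x) \<le> B * wgt x" if "vs \<in> lists Basis" "length vs \<le> ?p" for vs x
  proof -
    have "0 < (1 + norm x) ^ ?p" by (intro zero_less_power add_pos_nonneg) auto
    then show ?thesis using B[OF that, of x] by (simp add: wgt_def field_simps)
  qed
  have pw: "fcheck (dirs (replicate m b) \<phi>) y = (- 2 * pi * \<i> * (b \<bullet> y)) ^ m * fcheck \<phi> y" if b: "b \<in> Basis" and "m \<le> ?p" for b m
    using that(2)
  proof (induction m)
    case (Suc m)
    have l: "replicate m b \<in> lists Basis" "b # replicate m b \<in> lists Basis" using b by auto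
    have "fcheck (dirs (b # replicate m b) \<phi>) y = - 2 * pi * \<i> * (b \<bullet> y) * fcheck (dirs (replicate m b) \<phi>) y"
    proof (rule fcheck_derivative)
      show "continuous_on UNIV (dirs (replicate m b) \<phi>)" "continuous_on UNIV (dirs (b # replicate m b) \<phi>)"
        "\<And>x. ((\<lambda>t::real. dirs (replicate m b) \<phi> (x + t *\<^sub>R b)) has_vector_derivative dirs (b # replicate m b) \<phi> x) (at 0)"
        using \<phi> l b unfolding smooth_def by blast+
      show "norm (dirs (replicate m b) \<phi> x) \<le> B * wgt x" "norm (dirs (b # replicate m b) \<phi> x) \<le> B * wgt x" for x
        using bw[OF l(1)] bw[OF l(2)] Suc.prems by simp_all
    qed (use b in simp)
    then show ?case using Suc by (simp add: mult_ac del: dirs.simps)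
  qed simp
  have dW: "norm (fcheck (dirs vs \<phi>) y) \<le> B * W" if l: "vs \<in> lists Basis" "length vs \<le> ?p" for vs
  proof -
    have "norm (fcheck (dirs vs \<phi>) y) \<le> (\<integral>x. norm (dirs vs \<phi> x) \<partial>lborel)" by (rule fcheck_norm_le)
    also have "\<dots> \<le> (\<integral>x. B * wgt (x::'a) \<partial>lborel)"
    proof (rule integral_mono')
      show "norm (dirs vs \<phi> x) \<le> B * wgt x" "0 \<le> B * wgt x" for x
        using bw[OF l, of x] order_trans[OF norm_ge_zero bw[OF l, of x]] by auto
    qed (intro integrable_mult_right integrable_wgt)
    finally show ?thesis by (simp add: W_def)
  qed
  obtain b where b: "b \<in> Basis" "\<And>b'. b' \<in> Basis \<Longrightarrow> \<bar>b' \<bullet> y\<bar> \<le> \<bar>b \<bullet> y\<bar>"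
  proof -
    have "finite ((\<lambda>b. \<bar>b \<bullet> y\<bar>) ` Basis)" "(\<lambda>b. \<bar>b \<bullet> y\<bar>) ` Basis \<noteq> {}" by auto
    from Max_in[OF this] Max_ge[OF this(1)] that show ?thesis by (metis (no_types, lifting) image_iff)
  qed
  have "norm y \<le> (\<Sum>b'\<in>Basis. \<bar>y \<bullet> b'\<bar>)" by (rule norm_le_l1)
  also have "\<dots> \<le> (\<Sum>b'\<in>(Basis::'a set). \<bar>b \<bullet> y\<bar>)" using b by (intro sum_mono) (simp add: inner_commute)
  finally have "1 + norm y \<le> 1 + real DIM('a) * \<bar>b \<bullet> y\<bar>" by simp
  also have "\<dots> \<le> max 1 \<bar>b \<bullet> y\<bar> + real DIM('a) * max 1 \<bar>b \<bullet> y\<bar>"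
    by (intro add_mono mult_left_mono) auto
  also have "\<dots> = real (1 + DIM('a)) * max 1 \<bar>b \<bullet> y\<bar>" by (simp add: algebra_simps)
  finally have "(1 + norm y) ^ ?p \<le> (real (1 + DIM('a)) * max 1 \<bar>b \<bullet> y\<bar>) ^ ?p"
    by (rule power_mono) (simp add: add_nonneg_nonneg)
  also have "\<dots> = real (1 + DIM('a)) ^ ?p * (max 1 \<bar>b \<bullet> y\<bar>) ^ ?p" by (rule power_mult_distrib)
  finally have "(1 + norm y) ^ ?p * norm (fcheck \<phi> y) \<le> real (1 + DIM('a)) ^ ?p * (max 1 \<bar>b \<bullet> y\<bar>) ^ ?p * norm (fcheck \<phi> y)"
    by (rule mult_right_mono) simp
  also have "\<dots> \<le> real (1 + DIM('a)) ^ ?p * (B * W)"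
    unfolding mult.assoc
  proof (rule mult_left_mono)
    show "(max 1 \<bar>b \<bullet> y\<bar>) ^ ?p * norm (fcheck \<phi> y) \<le> B * W"
    proof (cases "1 \<le> \<bar>b \<bullet> y\<bar>")
      case False
      then show ?thesis using dW[of "[]"] by (simp add: max_def)
    next
      case True
      have "\<bar>b \<bullet> y\<bar> ^ ?p \<le> (2 * pi * \<bar>b \<bullet> y\<bar>) ^ ?p"
        using mult_right_mono[of 1 "2 * pi" "\<bar>b \<bullet> y\<bar>"] pi_gt3 by (intro power_mono) auto
      then have "\<bar>b \<bullet> y\<bar> ^ ?p * norm (fcheck \<phi> y) \<le> (2 * pi * \<bar>b \<bullet> y\<bar>) ^ ?p * norm (fcheck \<phi> y)"
        by (rule mult_right_mono) simp
      also have "\<dots> = norm (fcheck (dirs (replicate ?p b) \<phi>) y)"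
        unfolding pw[OF b(1) order_refl] by (simp add: norm_mult norm_power)
      also have "\<dots> \<le> B * W" using b by (intro dW) auto
      finally show ?thesis using True by (simp add: max_def)
    qed
  qed simp
  finally have "(1 + norm y) ^ ?p * norm (fcheck \<phi> y) \<le> real (1 + DIM('a)) ^ ?p * (B * W)" .
  moreover have "0 < (1 + norm y) ^ ?p" by (intro zero_less_power add_pos_nonneg) auto
  ultimately show ?thesis by (simp add: wgt_def W_def field_simps)
qed

context transform_pair
begin

text \<open>The exponent \<open>2 * DIM('a)\<close> serves twice: in \<open>x\<close> it makes the
  derivatives integrable, and that many derivatives make the transform decay like
  \<open>wgt\<close>, which is integrable for the translation bounded \<open>N\<close>. The
  constants depend on neither \<open>\<phi>\<close> nor \<open>B\<close>.\<close>

lemma tempered_mu: "tempered mu"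
  unfolding tempered_def
proof (intro exI allI impI)
  let ?p = "2 * DIM('a)"
  let ?L = "real (1 + DIM('a)) ^ ?p * (\<integral>x. wgt (x::'a) \<partial>lborel)"
  fix \<phi> :: "'a \<Rightarrow> complex" and B :: real
  assume \<phi>: "test_fun \<phi>"
    and B: "\<forall>x. \<forall>vs\<in>lists Basis. length vs \<le> ?p \<longrightarrow> (1 + norm x) ^ ?p * norm (dirs vs \<phi> x) \<le> B"
  have sm: "smooth \<phi>" and cs: "compact (fsupp \<phi>)" using \<phi> by (auto simp: test_fun_def)
  have "continuous_on UNIV (dirs [] \<phi>)" using sm unfolding smooth_def by blast
  then have Cc: "Cc \<phi>" using cs by (simp add: Cc_def)
  have dec: "norm (fcheck \<phi> y) \<le> B * ?L * wgt y" for y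
    by (rule fcheck_decay[OF sm]) (use B in blast)
  obtain C where "translation_bounded N C" by (rule obtain_bound)
  then have wi: "integrable N (\<lambda>y. B * ?L * wgt y)" by (intro integrable_mult_right translation_bounded_wgt)
  have [measurable]: "fcheck \<phi> \<in> borel_measurable borel" using Cc by (intro fcheck_measurable Cc_lborel)
  have i: "integrable N (fcheck \<phi>)"
    by (rule Bochner_Integration.integrable_bound[OF wi]) (use dec in \<open>auto intro: order_trans[OF _ abs_ge_self]\<close>)
  have "norm (cint mu \<phi>) \<le> (\<integral>y. norm (fcheck \<phi> y * H y) \<partial>N)"
    unfolding transform_integrable[OF Cc i] by (rule integral_norm_bound)
  also have "\<dots> \<le> (\<integral>y. B * ?L * wgt y \<partial>N)"
    using i wi dec by (intro integral_mono) (auto simp: norm_mult H_norm)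
  also have "\<dots> = (?L * (\<integral>y. wgt y \<partial>N)) * B" by simp
  finally show "norm (cint mu \<phi>) \<le> (?L * (\<integral>y. wgt y \<partial>N)) * B" .
qed

end

theorem theorem7p3:
  fixes f :: "nat \<Rightarrow> 'a::euclidean_space \<Rightarrow> real"
    and K :: "'a set"
    and mu :: "'a cmeasure"
  assumes approx: "approx_identity (\<lambda>n x. complex_of_real (f n x))"
    and Kc: "compact K"
    and fCc: "\<And>n. Cc (f n)"
    and fsupp: "\<And>n. fsupp (f n) \<subseteq> K"
    and fnonneg: "\<And>n x. f n x \<ge> 0"
    and fint: "\<And>n. (\<integral>x. f n x \<partial>lborel) = 1"
    and fpd: "\<And>n. pos_def (\<lambda>x. complex_of_real (f n x))"
    and mu: "is_cmeasure mu"
  shows "fourier_transformable mu \<longleftrightarrow>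
    (tempered mu \<and>
     (\<exists>nu :: nat \<Rightarrow> 'a cmeasure.
        (\<forall>n. is_cmeasure (nu n) \<and> finite_cmeasure (nu n)) \<and>
        equi_translation_bounded nu \<and>
        (\<forall>n. same_density_measure (mcheck (nu n))
               (conv_meas (\<lambda>x. complex_of_real (f n x)) mu))))"
proof -
  interpret pos_def_approx_identity f K
    by unfold_locales (fact assms)+
  show ?thesis
  proof
    assume "fourier_transformable mu"
    then obtain muhat where muhat: "is_cmeasure muhat"
      "\<And>g. Cc g \<Longrightarrow> integrable (fst muhat) (\<lambda>y. (cmod (fcheck g y))\<^sup>2)"
      "\<And>g. Cc g \<Longrightarrow> cint mu (conv g (tilde g)) = cint muhat (\<lambda>y. complex_of_real ((cmod (fcheck g y))\<^sup>2))"
      unfolding fourier_transformable_def tvar_def by blast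
    interpret transform_pair f K mu muhat
      by unfold_locales (fact mu muhat)+
    show "tempered mu \<and>
     (\<exists>nu :: nat \<Rightarrow> 'a cmeasure.
        (\<forall>n. is_cmeasure (nu n) \<and> finite_cmeasure (nu n)) \<and>
        equi_translation_bounded nu \<and>
        (\<forall>n. same_density_measure (mcheck (nu n))
               (conv_meas (\<lambda>x. complex_of_real (f n x)) mu)))"
      using tempered_mu is_cmeasure_nu finite_cmeasure_nu equi_translation_bounded_nu mcheck_nu
      by (auto simp: same_density_measure_def fc_eq intro!: exI[of _ nu])
  next
    assume "tempered mu \<and>
     (\<exists>nu :: nat \<Rightarrow> 'a cmeasure.
        (\<forall>n. is_cmeasure (nu n) \<and> finite_cmeasure (nu n)) \<and>
        equi_translation_bounded nu \<and>
        (\<forall>n. same_density_measure (mcheck (nu n))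
               (conv_meas (\<lambda>x. complex_of_real (f n x)) mu)))"
    then show "fourier_transformable mu"
      using fourier_transformableI[OF mu] unfolding fc_eq by blast
  qed
qed

end
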